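(* Let $\mathbf{A}$ be a finite nilpotent algebra in a congruence modular variety that is a direct product of algebras of prime power order, and let $m \in \mathbb{N}$ be such that all fundamental operations of $\mathbf{A}$ are of arity at most $m$. Assume $|A|>1$. Let \[ s := \big(m (|A| - 1)\big)^{(\log_2 (|A|)-1)}. \] Then $\mathbf{A}$ is $s$-supernilpotent, and there is a polynomial $p \in \mathbb{R}[x]$ of degree $\le s$ such that the free spectrum of $\mathbf{A}$ satisfies $f_{\mathbf{A}}(n)= 2^{p(n)}$ for all $n \in \mathbb{N}$.
   Context: $\mathbb{N}=\{1,2,3,\dots\}$, $\mathbb{N}_0=\mathbb{N}\cup\{0\}$. Algebras are universal algebras; $A$ denotes the universe of $\mathbf{A}$; $0_A$ and $1_A$ denote the equality relation and the total relation on $A$. Commutator: for congruences $\alpha,\beta$ of $\mathbf{A}$, $[\alpha,\beta]$ is the (term condition) commutator, i.e. the smallest congruence $\delta$ such that for every term function $t(\mathbf{x},\mathbf{y})$ of $\mathbf{A}$ and all tuples $\mathbf{a},\mathbf{b}$ that are componentwise $\alpha$-related and $\mathbf{c},\mathbf{d}$ that are componentwise $\beta$-related, $t(\mathbf{a},\mathbf{c}) \mathrel{\delta} t(\mathbf{a},\mathbf{d})$ implies $t(\mathbf{b},\mathbf{c}) \mathrel{\delta} t(\mathbf{b},\mathbf{d})$. Nilpotency: put $\lambda_1 := 1_A$ and $\lambda_{k+1} := [1_A,\lambda_k]$ for $k\in\mathbb{N}$. $\mathbf{A}$ is $k$-nilpotent if $\lambda_{k+1}=0_A$, and nilpotent if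 it is $k$-nilpotent for some $k \in \mathbb{N}$. Supernilpotency: for $k\in\mathbb{N}$, $\mathbf{A}$ is $k$-supernilpotent if for all $n_1,\dots,n_{k+1}\in\mathbb{N}_0$, all $a^{(i)}_1,a^{(i)}_2\in A^{n_i}$ ($i=1,\dots,k+1$), and all $\big(\sum_{i=1}^{k+1} n_i\big)$-ary term functions $t$ of $\mathbf{A}$: if $t(a^{(1)}_{f(1)},\dots,a^{(k)}_{f(k)},a^{(k+1)}_1)=t(a^{(1)}_{f(1)},\dots,a^{(k)}_{f(k)},a^{(k+1)}_2)$ for all $f:\{1,\dots,k\}\to\{1,2\}$ that are not constantly $2$, then $t(a^{(1)}_2,\dots,a^{(k)}_2,a^{(k+1)}_1)=t(a^{(1)}_2,\dots,a^{(k)}_2,a^{(k+1)}_2)$. For a real number $s\ge 1$, "$s$-supernilpotent" means $\lfloor s\rfloor$-supernilpotent. Free spectrum: $f_{\mathbf{A}}(n)$ is the number of $n$-ary term functions on $\mathbf{A}$ (equivalently, the size of the free algebra on $n$ generators in the variety generated by $\mathbf{A}$). *)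

theory Defs
  imports
    Complex_Main
    "HOL-Library.FuncSet"
    "HOL-Library.NList"
    "HOL-Library.Countable_Set"
    "HOL-Computational_Algebra.Polynomial"
    "HOL-Number_Theory.Prime_Powers"
begin

section \<open>Algebras and term functions\<close>

text \<open>As rewrite rules these two loop together with \<open>nlists_def\<close>.\<close>

declare nlistsE_length [simp del] nlistsE_set [simp del]

record 'f signature =
  syms :: "'f set"
  arity :: "'f \<Rightarrow> nat"

record ('f, 'a) alg =
  univ :: "'a set"
  interp :: "'f \<Rightarrow> 'a list \<Rightarrow> 'a"

definition algebra :: "'f signature \<Rightarrow> ('f, 'a) alg \<Rightarrow> bool" where
  "algebra Sg A \<longleftrightarrow> univ A \<noteq> {} \<and>
     (\<forall>f\<in>syms Sg. \<forall>xs\<in>nlists (arity Sg f) (univ A). interp A f xs \<in> univ A)"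

datatype 'f trm = Var nat | App 'f "'f trm list"

inductive_set trms :: "'f signature \<Rightarrow> nat set \<Rightarrow> 'f trm set"
  for Sg :: "'f signature" and X :: "nat set" where
  Var: "i \<in> X \<Longrightarrow> Var i \<in> trms Sg X"
| App: "f \<in> syms Sg \<Longrightarrow> length ts = arity Sg f \<Longrightarrow> \<forall>t\<in>set ts. t \<in> trms Sg X
        \<Longrightarrow> App f ts \<in> trms Sg X"

primrec eval :: "('f, 'a) alg \<Rightarrow> (nat \<Rightarrow> 'a) \<Rightarrow> 'f trm \<Rightarrow> 'a" where
  "eval A \<rho> (Var i) = \<rho> i"
| "eval A \<rho> (App f ts) = interp A f (map (eval A \<rho>) ts)"

text \<open>The \<open>n\<close>-ary term functions, as functions on the lists of length \<open>n\<close> over the universe.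
  They are \<open>undefined\<close> elsewhere, so that distinct elements of this set are distinct
  functions on the \<open>n\<close>-th power of the universe.\<close>

definition term_funs :: "'f signature \<Rightarrow> ('f, 'a) alg \<Rightarrow> nat \<Rightarrow> ('a list \<Rightarrow> 'a) set" where
  "term_funs Sg A n =
     (\<lambda>t. \<lambda>xs\<in>nlists n (univ A). eval A (\<lambda>i. xs ! i) t) ` trms Sg {..<n}"

definition free_spectrum :: "'f signature \<Rightarrow> ('f, 'a) alg \<Rightarrow> nat \<Rightarrow> nat" where
  "free_spectrum Sg A n = card (term_funs Sg A n)"


section \<open>Congruences, commutator and nilpotency\<close>

definition congruence :: "'f signature \<Rightarrow> ('f, 'a) alg \<Rightarrow> ('a \<times> 'a) set \<Rightarrow> bool" where
  "congruence Sg A \<theta> \<longleftrightarrow> equiv (univ A) \<theta> \<and>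
     (\<forall>f\<in>syms Sg. \<forall>xs\<in>nlists (arity Sg f) (univ A). \<forall>ys\<in>nlists (arity Sg f) (univ A).
        list_all2 (\<lambda>x y. (x, y) \<in> \<theta>) xs ys \<longrightarrow> (interp A f xs, interp A f ys) \<in> \<theta>)"

definition cong_join ::
  "'f signature \<Rightarrow> ('f, 'a) alg \<Rightarrow> ('a \<times> 'a) set \<Rightarrow> ('a \<times> 'a) set \<Rightarrow> ('a \<times> 'a) set" where
  "cong_join Sg A \<alpha> \<beta> = \<Inter>{\<theta>. congruence Sg A \<theta> \<and> \<alpha> \<union> \<beta> \<subseteq> \<theta>}"

definition centralizes ::
  "'f signature \<Rightarrow> ('f, 'a) alg \<Rightarrow> ('a \<times> 'a) set \<Rightarrow> ('a \<times> 'a) set \<Rightarrow> ('a \<times> 'a) set \<Rightarrow> bool" where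
  "centralizes Sg A \<alpha> \<beta> \<delta> \<longleftrightarrow>
     (\<forall>k l. \<forall>t\<in>term_funs Sg A (k + l).
        \<forall>a\<in>nlists k (univ A). \<forall>b\<in>nlists k (univ A).
        \<forall>c\<in>nlists l (univ A). \<forall>d\<in>nlists l (univ A).
          list_all2 (\<lambda>x y. (x, y) \<in> \<alpha>) a b \<longrightarrow> list_all2 (\<lambda>x y. (x, y) \<in> \<beta>) c d \<longrightarrow>
          (t (a @ c), t (a @ d)) \<in> \<delta> \<longrightarrow> (t (b @ c), t (b @ d)) \<in> \<delta>)"

definition commutator ::
  "'f signature \<Rightarrow> ('f, 'a) alg \<Rightarrow> ('a \<times> 'a) set \<Rightarrow> ('a \<times> 'a) set \<Rightarrow> ('a \<times> 'a) set" where
  "commutator Sg A \<alpha> \<beta> = \<Inter>{\<delta>. congruence Sg A \<delta> \<and> centralizes Sg A \<alpha> \<beta> \<delta>}"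

text \<open>\<open>lower_central Sg A k\<close> is $\lambda_{k+1}$ for the series $\lambda_1 = 1_A$,
  $\lambda_{k+1} = [1_A, \lambda_k]$.\<close>

primrec lower_central :: "'f signature \<Rightarrow> ('f, 'a) alg \<Rightarrow> nat \<Rightarrow> ('a \<times> 'a) set" where
  "lower_central Sg A 0 = univ A \<times> univ A"
| "lower_central Sg A (Suc k) = commutator Sg A (univ A \<times> univ A) (lower_central Sg A k)"

definition nilpotent :: "'f signature \<Rightarrow> ('f, 'a) alg \<Rightarrow> bool" where
  "nilpotent Sg A \<longleftrightarrow> (\<exists>k\<ge>1. lower_central Sg A k = Id_on (univ A))"

text \<open>\<open>a i j\<close> is the tuple $a^{(i)}_j$, of length \<open>n i\<close>, for $1 \le i \le k+1$ and
  $j \in \{1,2\}$.\<close>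

definition supernilpotent :: "nat \<Rightarrow> 'f signature \<Rightarrow> ('f, 'a) alg \<Rightarrow> bool" where
  "supernilpotent k Sg A \<longleftrightarrow>
     (\<forall>(n :: nat \<Rightarrow> nat) (a :: nat \<Rightarrow> nat \<Rightarrow> 'a list).
        (\<forall>i\<in>{1..k + 1}. \<forall>j\<in>{1, 2}. a i j \<in> nlists (n i) (univ A)) \<longrightarrow>
        (\<forall>t\<in>term_funs Sg A (\<Sum>i = 1..k + 1. n i).
           (\<forall>f\<in>{1..k} \<rightarrow> {1, 2}. (\<exists>i\<in>{1..k}. f i \<noteq> 2) \<longrightarrow>
              t (concat (map (\<lambda>i. a i (f i)) [1..<k + 1]) @ a (k + 1) 1)
            = t (concat (map (\<lambda>i. a i (f i)) [1..<k + 1]) @ a (k + 1) 2)) \<longrightarrow>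
           t (concat (map (\<lambda>i. a i 2) [1..<k + 1]) @ a (k + 1) 1)
         = t (concat (map (\<lambda>i. a i 2) [1..<k + 1]) @ a (k + 1) 2)))"


section \<open>Direct products\<close>

definition prod_alg :: "'i set \<Rightarrow> ('i \<Rightarrow> ('f, 'a) alg) \<Rightarrow> ('f, 'i \<Rightarrow> 'a) alg" where
  "prod_alg I B = \<lparr>univ = (\<Pi>\<^sub>E i\<in>I. univ (B i)),
     interp = (\<lambda>f xs. \<lambda>i\<in>I. interp (B i) f (map (\<lambda>x. x i) xs))\<rparr>"

definition isomorphic :: "'f signature \<Rightarrow> ('f, 'a) alg \<Rightarrow> ('f, 'b) alg \<Rightarrow> bool" where
  "isomorphic Sg A B \<longleftrightarrow> (\<exists>h. bij_betw h (univ A) (univ B) \<and>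
     (\<forall>f\<in>syms Sg. \<forall>xs\<in>nlists (arity Sg f) (univ A).
        h (interp A f xs) = interp B f (map h xs)))"

text \<open>Algebras of prime power order are finite, so each is isomorphic to one with universe a
  set of natural numbers; hence it is no restriction to take the factors on \<^typ>\<open>nat\<close>.
  The order $p^0 = 1$ is not counted as a prime power; one-element factors can be dropped
  from a product.\<close>

definition product_of_prime_power_algebras :: "'f signature \<Rightarrow> ('f, 'a) alg \<Rightarrow> bool" where
  "product_of_prime_power_algebras Sg A \<longleftrightarrow>
     (\<exists>(r :: nat) (B :: nat \<Rightarrow> ('f, nat) alg).
        (\<forall>i<r. algebra Sg (B i) \<and> finite (univ (B i)) \<and> primepow (card (univ (B i)))) \<and>
        isomorphic Sg A (prod_alg {..<r} B))"


section \<open>Congruence modular varieties\<close>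

text \<open>A variety is given by a set \<open>E\<close> of identities in countably many variables
  (Birkhoff's theorem); its members are the algebras satisfying \<open>E\<close>.\<close>

definition identities :: "'f signature \<Rightarrow> ('f trm \<times> 'f trm) set \<Rightarrow> bool" where
  "identities Sg E \<longleftrightarrow> E \<subseteq> trms Sg UNIV \<times> trms Sg UNIV"

definition satisfies :: "('f, 'a) alg \<Rightarrow> ('f trm \<times> 'f trm) set \<Rightarrow> bool" where
  "satisfies A E \<longleftrightarrow>
     (\<forall>(s, t)\<in>E. \<forall>\<rho>. range \<rho> \<subseteq> univ A \<longrightarrow> eval A \<rho> s = eval A \<rho> t)"

definition modular_congruences :: "'f signature \<Rightarrow> ('f, 'a) alg \<Rightarrow> bool" where
  "modular_congruences Sg A \<longleftrightarrow>
     (\<forall>\<alpha> \<beta> \<gamma>. congruence Sg A \<alpha> \<longrightarrow> congruence Sg A \<beta> \<longrightarrow> congruence Sg A \<gamma> \<longrightarrow> \<alpha> \<subseteq> \<gamma> \<longrightarrow>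
        cong_join Sg A \<alpha> (\<beta> \<inter> \<gamma>) = cong_join Sg A \<alpha> \<beta> \<inter> \<gamma>)"

text \<open>HOL cannot quantify over the carrier types of the members of a variety inside a
  formula. It is enough to consider the members whose universe consists of sets of terms
  (in particular, up to isomorphism, all countably generated ones): the theorem
  \<open>congruence_modular_variety_any_type\<close> below shows that then all members, on any type,
  have modular congruence lattices.\<close>

definition congruence_modular_variety :: "'f signature \<Rightarrow> ('f trm \<times> 'f trm) set \<Rightarrow> bool" where
  "congruence_modular_variety Sg E \<longleftrightarrow> identities Sg E \<and>
     (\<forall>B :: ('f, 'f trm set) alg. algebra Sg B \<longrightarrow> satisfies B E \<longrightarrow> modular_congruences Sg B)"

definition in_congruence_modular_variety :: "'f signature \<Rightarrow> ('f, 'a) alg \<Rightarrow> bool" where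
  "in_congruence_modular_variety Sg A \<longleftrightarrow>
     (\<exists>E. congruence_modular_variety Sg E \<and> algebra Sg A \<and> satisfies A E)"


subsection \<open>Independence of the carrier type\<close>

lemma eval_closed:
  assumes "algebra Sg A" "range \<rho> \<subseteq> univ A" "t \<in> trms Sg X"
  shows "eval A \<rho> t \<in> univ A"
  using assms(3)
proof induction
  case (Var i)
  show ?case using assms(2) by (simp add: image_subset_iff)
next
  case (App f ts)
  then have "map (eval A \<rho>) ts \<in> nlists (arity Sg f) (univ A)"
    by (simp add: nlists_def image_subset_iff)
  then show ?case using assms(1) App(1) by (simp add: algebra_def)
qed

lemma congruenceD:
  assumes "congruence Sg A \<theta>" "f \<in> syms Sg"
    "xs \<in> nlists (arity Sg f) (univ A)" "ys \<in> nlists (arity Sg f) (univ A)"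
    "list_all2 (\<lambda>x y. (x, y) \<in> \<theta>) xs ys"
  shows "(interp A f xs, interp A f ys) \<in> \<theta>"
  using assms by (simp add: congruence_def)

lemma congruence_Int:
  assumes "congruence Sg A \<alpha>" "congruence Sg A \<beta>"
  shows "congruence Sg A (\<alpha> \<inter> \<beta>)"
proof -
  have "equiv (univ A) (\<alpha> \<inter> \<beta>)"
    using assms by (auto simp: congruence_def equiv_def refl_on_def intro: sym_Int trans_Int)
  moreover have "list_all2 (\<lambda>x y. (x, y) \<in> \<alpha> \<inter> \<beta>) xs ys \<longleftrightarrow>
      list_all2 (\<lambda>x y. (x, y) \<in> \<alpha>) xs ys \<and> list_all2 (\<lambda>x y. (x, y) \<in> \<beta>) xs ys" for xs ys
    by (auto simp: list_all2_conv_all_nth)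
  ultimately show ?thesis using assms by (auto simp: congruence_def)
qed

lemma congruence_total: "algebra Sg A \<Longrightarrow> congruence Sg A (univ A \<times> univ A)"
  unfolding congruence_def equiv_def refl_on_def sym_def trans_def algebra_def by auto

lemma congruence_join:
  assumes "algebra Sg A" "congruence Sg A \<alpha>" "congruence Sg A \<beta>"
  shows "congruence Sg A (cong_join Sg A \<alpha> \<beta>)"
proof -
  define S where "S = {\<theta>. congruence Sg A \<theta> \<and> \<alpha> \<union> \<beta> \<subseteq> \<theta>}"
  have S: "congruence Sg A \<theta>" "equiv (univ A) \<theta>" if "\<theta> \<in> S" for \<theta>
    using that by (auto simp: S_def congruence_def)
  have "\<alpha> \<union> \<beta> \<subseteq> univ A \<times> univ A"
    using assms(2,3) unfolding congruence_def equiv_def by auto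
  then have tot: "univ A \<times> univ A \<in> S" using congruence_total[OF assms(1)] by (auto simp: S_def)
  have "equiv (univ A) (\<Inter>S)"
  proof (rule equivI)
    show "\<Inter>S \<subseteq> univ A \<times> univ A" using tot by blast
    show "refl_on (univ A) (\<Inter>S)"
      unfolding refl_on_def using S(2) by (auto simp: equiv_def refl_on_def)
    show "sym (\<Inter>S)" unfolding sym_def
      using S(2) by (meson InterE InterI equiv_def symD)
    show "trans (\<Inter>S)" unfolding trans_def
      using S(2) by (meson InterE InterI equiv_def transD)
  qed
  moreover have "(interp A f xs, interp A f ys) \<in> \<Inter>S"
    if "f \<in> syms Sg" "xs \<in> nlists (arity Sg f) (univ A)" "ys \<in> nlists (arity Sg f) (univ A)"
      and l: "list_all2 (\<lambda>x y. (x, y) \<in> \<Inter>S) xs ys" for f xs ys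
  proof (rule InterI)
    fix \<theta> assume "\<theta> \<in> S"
    moreover from this have "list_all2 (\<lambda>x y. (x, y) \<in> \<theta>) xs ys"
      using l by (rule_tac list_all2_mono[OF l]) auto
    ultimately show "(interp A f xs, interp A f ys) \<in> \<theta>"
      using that(1-3) S(1)[of \<theta>] by (auto simp: congruence_def)
  qed
  ultimately have "congruence Sg A (\<Inter>S)" unfolding congruence_def by simp
  then show ?thesis by (simp add: cong_join_def S_def)
qed

lemma cong_join_upper: "\<alpha> \<subseteq> cong_join Sg A \<alpha> \<beta>" "\<beta> \<subseteq> cong_join Sg A \<alpha> \<beta>"
  unfolding cong_join_def by auto

lemma cong_join_least: "congruence Sg A \<theta> \<Longrightarrow> \<alpha> \<subseteq> \<theta> \<Longrightarrow> \<beta> \<subseteq> \<theta> \<Longrightarrow> cong_join Sg A \<alpha> \<beta> \<subseteq> \<theta>"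
  unfolding cong_join_def by auto

lemma congruence_trancl:
  assumes "congruence Sg A \<alpha>" "congruence Sg A \<beta>"
  shows "congruence Sg A ((\<alpha> \<union> \<beta>)\<^sup>+)" (is "congruence Sg A ?R")
proof -
  have sub: "\<alpha> \<union> \<beta> \<subseteq> univ A \<times> univ A" and refl: "\<And>x. x \<in> univ A \<Longrightarrow> (x, x) \<in> \<alpha>"
    using assms by (auto simp: congruence_def equiv_def refl_on_def)
  have subR: "?R \<subseteq> univ A \<times> univ A" using sub by (rule trancl_subset_Sigma)
  have eq: "equiv (univ A) ?R"
  proof (rule equivI)
    show "refl_on (univ A) ?R" unfolding refl_on_def using refl by blast
    have "sym (\<alpha> \<union> \<beta>)" using assms by (auto simp: congruence_def equiv_def intro: sym_Un)
    then show "sym ?R" by (rule sym_trancl)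
  qed (use subR in auto)
  have step: "(interp A f (pre @ x # xs), interp A f (pre @ y # xs)) \<in> ?R"
    if "(x, y) \<in> ?R" "f \<in> syms Sg" "set pre \<subseteq> univ A" "set xs \<subseteq> univ A"
      "length pre + Suc (length xs) = arity Sg f" for f pre x y xs
  proof -
    have one: "(interp A f (pre @ x # xs), interp A f (pre @ y # xs)) \<in> \<theta>"
      if "congruence Sg A \<theta>" "(x, y) \<in> \<theta>" for \<theta> x y
    proof -
      have r: "(z, z) \<in> \<theta>" if "z \<in> univ A" for z
        using that \<open>congruence Sg A \<theta>\<close> by (auto simp: congruence_def equiv_def refl_on_def)
      have "list_all2 (\<lambda>x y. (x, y) \<in> \<theta>) zs zs" if "set zs \<subseteq> univ A" for zs
        unfolding list_all2_same using that r by blast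
      then have "list_all2 (\<lambda>x y. (x, y) \<in> \<theta>) pre pre" "list_all2 (\<lambda>x y. (x, y) \<in> \<theta>) xs xs"
        using \<open>set pre \<subseteq> univ A\<close> \<open>set xs \<subseteq> univ A\<close> by blast+
      then have "list_all2 (\<lambda>x y. (x, y) \<in> \<theta>) (pre @ x # xs) (pre @ y # xs)"
        using that(2) by (simp add: list_all2_appendI)
      moreover have "x \<in> univ A" "y \<in> univ A"
        using that by (auto simp: congruence_def equiv_def)
      moreover from this have "pre @ x # xs \<in> nlists (arity Sg f) (univ A)"
        "pre @ y # xs \<in> nlists (arity Sg f) (univ A)"
        using \<open>set pre \<subseteq> univ A\<close> \<open>set xs \<subseteq> univ A\<close>
          \<open>length pre + Suc (length xs) = arity Sg f\<close> by (simp_all add: nlists_def)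
      ultimately show ?thesis
        by (intro congruenceD[OF that(1) \<open>f \<in> syms Sg\<close>])
    qed
    have one': "(interp A f (pre @ x # xs), interp A f (pre @ y # xs)) \<in> \<alpha> \<union> \<beta>"
      if "(x, y) \<in> \<alpha> \<union> \<beta>" for x y
      using that one assms by blast
    show ?thesis using that(1)
    proof induction
      case (base y)
      then show ?case using one' by blast
    next
      case (step y z)
      show ?case using step.IH one'[OF step(2)] by (rule trancl_into_trancl)
    qed
  qed
  have gen: "(interp A f (pre @ xs), interp A f (pre @ ys)) \<in> ?R"
    if "list_all2 (\<lambda>x y. (x, y) \<in> ?R) xs ys" "f \<in> syms Sg" "set pre \<subseteq> univ A"
      "length pre + length xs = arity Sg f" "set xs \<subseteq> univ A" "set ys \<subseteq> univ A"
      "interp A f (pre @ xs) \<in> univ A"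
    for f pre xs ys
    using that
  proof (induction arbitrary: pre rule: list_all2_induct)
    case Nil
    then show ?case using refl by auto
  next
    case (Cons x xs y ys)
    have 1: "(interp A f (pre @ x # xs), interp A f (pre @ y # xs)) \<in> ?R"
      using Cons by (intro step) auto
    then have "interp A f ((pre @ [y]) @ xs) \<in> univ A" using subR by auto
    then have "(interp A f ((pre @ [y]) @ xs), interp A f ((pre @ [y]) @ ys)) \<in> ?R"
      using Cons.prems by (intro Cons.IH) auto
    with 1 show ?case by (auto intro: trancl_trans)
  qed
  have cl: "interp A f xs \<in> univ A"
    if "f \<in> syms Sg" "xs \<in> nlists (arity Sg f) (univ A)" for f xs
  proof -
    have "list_all2 (\<lambda>x y. (x, y) \<in> \<alpha>) xs xs"
      using that refl by (auto simp: nlists_def intro!: list.rel_refl_strong)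
    then show ?thesis using that assms(1) sub by (auto simp: congruence_def)
  qed
  have "(interp A f xs, interp A f ys) \<in> ?R"
    if "f \<in> syms Sg" "xs \<in> nlists (arity Sg f) (univ A)" "ys \<in> nlists (arity Sg f) (univ A)"
      "list_all2 (\<lambda>x y. (x, y) \<in> ?R) xs ys" for f xs ys
    using gen[of xs ys f "[]"] cl[of f xs] that by (simp add: nlists_def)
  with eq show ?thesis unfolding congruence_def by blast
qed

theorem congruence_modular_variety_any_type:
  fixes B :: "('f, 'b) alg"
  assumes V: "congruence_modular_variety Sg E" and B: "algebra Sg B" "satisfies B E"
  shows "modular_congruences Sg B"
  unfolding modular_congruences_def
proof (intro allI impI equalityI)
  fix \<alpha> \<beta> \<gamma>
  assume c: "congruence Sg B \<alpha>" "congruence Sg B \<beta>" "congruence Sg B \<gamma>" and le: "\<alpha> \<subseteq> \<gamma>"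
  show "cong_join Sg B \<alpha> (\<beta> \<inter> \<gamma>) \<subseteq> cong_join Sg B \<alpha> \<beta> \<inter> \<gamma>"
    using c le B cong_join_upper(1)[of \<alpha> Sg B \<beta>] cong_join_upper(2)[of \<beta> Sg B \<alpha>]
    by (intro cong_join_least congruence_Int congruence_join) auto
  show "cong_join Sg B \<alpha> \<beta> \<inter> \<gamma> \<subseteq> cong_join Sg B \<alpha> (\<beta> \<inter> \<gamma>)"
  proof (rule subrelI)
    fix x y assume xy: "(x, y) \<in> cong_join Sg B \<alpha> \<beta> \<inter> \<gamma>"
    have "cong_join Sg B \<alpha> \<beta> \<subseteq> (\<alpha> \<union> \<beta>)\<^sup>+"
      using congruence_trancl[OF c(1,2)] by (intro cong_join_least) auto
    then have xy': "(x, y) \<in> (\<alpha> \<union> \<beta>)\<^sup>+" using xy by auto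
    have sub: "\<alpha> \<union> \<beta> \<subseteq> univ B \<times> univ B"
      using c by (auto simp: congruence_def equiv_def)
    \<comment> \<open>Only the finitely many points of a chain from \<open>x\<close> to \<open>y\<close> matter.\<close>
    obtain S where S: "finite S" "S \<subseteq> univ B" "(x, y) \<in> ((\<alpha> \<union> \<beta>) \<inter> S \<times> S)\<^sup>+"
    proof -
      have "\<exists>S. finite S \<and> S \<subseteq> univ B \<and> (x, y) \<in> ((\<alpha> \<union> \<beta>) \<inter> S \<times> S)\<^sup>+"
        using xy'
      proof induction
        case (base y)
        then show ?case using sub by (intro exI[of _ "{x, y}"]) auto
      next
        case (step y z)
        then obtain S where S: "finite S" "S \<subseteq> univ B" "(x, y) \<in> ((\<alpha> \<union> \<beta>) \<inter> S \<times> S)\<^sup>+"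
          by blast
        let ?S = "insert y (insert z S)"
        have "(x, y) \<in> ((\<alpha> \<union> \<beta>) \<inter> ?S \<times> ?S)\<^sup>+"
          using S(3) by (rule trancl_mono) auto
        then have "(x, z) \<in> ((\<alpha> \<union> \<beta>) \<inter> ?S \<times> ?S)\<^sup>+"
          using step(2) by (auto intro: trancl_into_trancl)
        then show ?case using S step(2) sub by (intro exI[of _ ?S]) auto
      qed
      then show ?thesis using that by blast
    qed
    have xS: "x \<in> S" "y \<in> S"
      using trancl_subset_Sigma[of "(\<alpha> \<union> \<beta>) \<inter> S \<times> S" S] S(3) by auto
    then have "S \<noteq> {}" by auto
    then obtain \<rho> :: "nat \<Rightarrow> 'b" where \<rho>: "range \<rho> = S"
      using S(1) by (metis countable_finite range_from_nat_into)
    define T :: "'f trm set" where "T = trms Sg UNIV"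
    define h where "h = eval B \<rho>"
    define cl where "cl b = {t \<in> T. h t = b}" for b
    define g where "g u = h (SOME t. t \<in> u)" for u
    define C :: "('f, 'f trm set) alg" where
      "C = \<lparr>univ = cl ` h ` T, interp = (\<lambda>f us. cl (interp B f (map g us)))\<rparr>"
    have gcl: "g (cl b) = b" if "b \<in> h ` T" for b
    proof -
      have "\<exists>t. t \<in> cl b" using that by (auto simp: cl_def)
      then have "(SOME t. t \<in> cl b) \<in> cl b" by (rule someI_ex)
      then show ?thesis by (simp add: cl_def g_def)
    qed
    have hT: "h ` T \<subseteq> univ B"
      using eval_closed[OF B(1), of \<rho>] \<rho> S(2) by (auto simp: h_def T_def)
    have ST: "S \<subseteq> h ` T"
    proof
      fix b assume "b \<in> S"
      then obtain i where "b = \<rho> i" using \<rho> by auto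
      then have "b = h (Var i)" by (simp add: h_def)
      moreover have "Var i \<in> T" unfolding T_def by (rule trms.Var) simp
      ultimately show "b \<in> h ` T" by (metis imageI)
    qed
    have closed: "interp B f bs \<in> h ` T"
      if f: "f \<in> syms Sg" and bs: "bs \<in> nlists (arity Sg f) (h ` T)" for f bs
    proof -
      have "bs \<in> lists (h ` T)" using bs by (auto simp: nlists_def)
      then obtain ts where ts: "bs = map h ts" "ts \<in> lists T" unfolding lists_image by auto
      then have "App f ts \<in> T" using f bs
        by (auto simp: T_def nlists_def intro!: trms.App)
      moreover have "h (App f ts) = interp B f bs" using ts by (simp add: h_def)
      ultimately show ?thesis by (metis imageI)
    qed
    have gC: "g u \<in> h ` T" if "u \<in> univ C" for u using that gcl by (auto simp: C_def)
    have clg: "cl (g u) = u" if "u \<in> univ C" for u using that gcl by (auto simp: C_def)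
    have gmap: "map g us \<in> nlists n (h ` T)" if "us \<in> nlists n (univ C)" for us n
      using that gC by (auto simp: nlists_def)
    have ginterp: "g (interp C f us) = interp B f (map g us)"
      if "f \<in> syms Sg" "us \<in> nlists (arity Sg f) (univ C)" for f us
      using gcl[OF closed[OF that(1) gmap[OF that(2)]]] by (simp add: C_def)
    have C: "algebra Sg C"
    proof -
      have "univ C \<noteq> {}" using ST xS by (auto simp: C_def)
      moreover have "interp C f us \<in> univ C"
        if "f \<in> syms Sg" "us \<in> nlists (arity Sg f) (univ C)" for f us
        using closed[OF that(1) gmap[OF that(2)]] by (auto simp: C_def)
      ultimately show ?thesis by (auto simp: algebra_def)
    qed
    have geval: "g (eval C \<sigma> t) = eval B (\<lambda>i. g (\<sigma> i)) t"
      if "range \<sigma> \<subseteq> univ C" "t \<in> trms Sg UNIV" for \<sigma> t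
      using that(2)
    proof induction
      case (Var i)
      then show ?case by simp
    next
      case (App f ts)
      have "map (eval C \<sigma>) ts \<in> nlists (arity Sg f) (univ C)"
        using App eval_closed[OF C that(1)] by (auto simp: nlists_def)
      then have "g (eval C \<sigma> (App f ts)) = interp B f (map g (map (eval C \<sigma>) ts))"
        using ginterp App(1) by simp
      also have "map g (map (eval C \<sigma>) ts) = map (eval B (\<lambda>i. g (\<sigma> i))) ts"
        using App by simp
      finally show ?case by simp
    qed
    have "satisfies C E"
      unfolding satisfies_def
    proof (clarify)
      fix s t and \<sigma> :: "nat \<Rightarrow> _" assume st: "(s, t) \<in> E" and \<sigma>: "range \<sigma> \<subseteq> univ C"
      have T: "s \<in> trms Sg UNIV" "t \<in> trms Sg UNIV"
        using V st by (auto simp: congruence_modular_variety_def identities_def)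
      have "range (\<lambda>i. g (\<sigma> i)) \<subseteq> univ B" using \<sigma> gC hT by fastforce
      then have "eval B (\<lambda>i. g (\<sigma> i)) s = eval B (\<lambda>i. g (\<sigma> i)) t"
        using B(2) st unfolding satisfies_def by blast
      then have "g (eval C \<sigma> s) = g (eval C \<sigma> t)" using geval \<sigma> T by simp
      then show "eval C \<sigma> s = eval C \<sigma> t"
        using clg eval_closed[OF C \<sigma>] T by metis
    qed
    then have modC: "modular_congruences Sg C"
      using V C by (auto simp: congruence_modular_variety_def)
    define pull where "pull \<theta> = {(u, v) \<in> univ C \<times> univ C. (g u, g v) \<in> \<theta>}" for \<theta>
    have pull: "congruence Sg C (pull \<theta>)" if \<theta>: "congruence Sg B \<theta>" for \<theta>
    proof -
      have e: "equiv (univ B) \<theta>" using \<theta> by (simp add: congruence_def)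
      have "equiv (univ C) (pull \<theta>)"
      proof (rule equivI)
        show "refl_on (univ C) (pull \<theta>)" using e gC hT
          by (auto simp: pull_def refl_on_def equiv_def)
        show "sym (pull \<theta>)" using e by (auto simp: pull_def sym_def equiv_def)
        show "trans (pull \<theta>)" using e unfolding pull_def trans_def equiv_def by blast
      qed (auto simp: pull_def)
      moreover have "(interp C f us, interp C f vs) \<in> pull \<theta>"
        if f: "f \<in> syms Sg" and us: "us \<in> nlists (arity Sg f) (univ C)"
          and vs: "vs \<in> nlists (arity Sg f) (univ C)"
          and l: "list_all2 (\<lambda>x y. (x, y) \<in> pull \<theta>) us vs" for f us vs
      proof -
        have "list_all2 (\<lambda>x y. (x, y) \<in> \<theta>) (map g us) (map g vs)"
          using l by (auto simp: list_all2_conv_all_nth pull_def)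
        moreover have "map g us \<in> nlists (arity Sg f) (univ B)"
          "map g vs \<in> nlists (arity Sg f) (univ B)"
          using gmap[OF us] gmap[OF vs] nlists_mono[OF hT] by auto
        ultimately have "(interp B f (map g us), interp B f (map g vs)) \<in> \<theta>"
          using \<theta> f by (auto simp: congruence_def)
        then show ?thesis using ginterp f us vs C by (auto simp: pull_def algebra_def)
      qed
      ultimately show ?thesis by (auto simp: congruence_def)
    qed
    have inC: "cl b \<in> univ C" if "b \<in> S" for b using that ST by (auto simp: C_def)
    have gS: "g (cl b) = b" if "b \<in> S" for b using that ST gcl by auto
    let ?J = "cong_join Sg C (pull \<alpha>) (pull \<beta>)"
    have "congruence Sg C ?J" using C c pull by (intro congruence_join) auto
    then have tr: "trans ?J" by (simp add: congruence_def equiv_def)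
    have one: "(cl a, cl b) \<in> ?J" if "(a, b) \<in> (\<alpha> \<union> \<beta>) \<inter> S \<times> S" for a b
    proof -
      have "(cl a, cl b) \<in> pull \<alpha> \<union> pull \<beta>" using that inC gS by (auto simp: pull_def)
      then show ?thesis
        using cong_join_upper(1)[of "pull \<alpha>" Sg C "pull \<beta>"] cong_join_upper(2)[of "pull \<beta>" Sg C "pull \<alpha>"]
        by blast
    qed
    have "(cl x, cl y) \<in> ?J" using S(3)
    proof induction
      case (base y)
      then show ?case by (rule one)
    next
      case (step y z)
      then show ?case using one[OF step(2)] tr by (meson transD)
    qed
    moreover have "(cl x, cl y) \<in> pull \<gamma>" using xy xS inC gS by (auto simp: pull_def)
    moreover have "pull \<alpha> \<subseteq> pull \<gamma>" using le by (auto simp: pull_def)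
    ultimately have "(cl x, cl y) \<in> cong_join Sg C (pull \<alpha>) (pull \<beta> \<inter> pull \<gamma>)"
      using modC c pull unfolding modular_congruences_def by blast
    also have "\<dots> \<subseteq> pull (cong_join Sg B \<alpha> (\<beta> \<inter> \<gamma>))"
    proof (rule cong_join_least)
      show "congruence Sg C (pull (cong_join Sg B \<alpha> (\<beta> \<inter> \<gamma>)))"
        using B c by (intro pull congruence_join congruence_Int)
      show "pull \<alpha> \<subseteq> pull (cong_join Sg B \<alpha> (\<beta> \<inter> \<gamma>))"
        using cong_join_upper(1)[of \<alpha> Sg B "\<beta> \<inter> \<gamma>"] by (auto simp: pull_def)
      show "pull \<beta> \<inter> pull \<gamma> \<subseteq> pull (cong_join Sg B \<alpha> (\<beta> \<inter> \<gamma>))"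
        using cong_join_upper(2)[of "\<beta> \<inter> \<gamma>" Sg B \<alpha>] by (auto simp: pull_def)
    qed
    finally show "(x, y) \<in> cong_join Sg B \<alpha> (\<beta> \<inter> \<gamma>)" using xS gS by (auto simp: pull_def)
  qed
qed

end

theory Submission
  imports Defs "HOL-Algebra.FiniteProduct" "HOL-Number_Theory.Cong"
begin

text \<open>Modularity gives Day terms, hence a difference term, and on a nilpotent algebra a difference
  term can be iterated along the lower central series to a Mal'cev term. The prime power factors
  inherit this term and a central series. In such a factor one repeatedly factors out a central
  congruence whose classes are translates of an elementary abelian group \<open>W\<close>. On \<open>W\<close> every
  fundamental operation is the sum of additive maps and of an arbitrary function of its
  arguments modulo \<open>W\<close>. Taking characters of these groups as coordinates modulo \<open>p\<close>, every term
  function is a polynomial in the coordinates of its arguments: substituting terms into the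
  additive part does not increase the degree, and the arbitrary function of at most \<open>m\<close>
  elements of the quotient has degree at most \<open>m\<close> times the order of the quotient minus one. As
  there are at most \<open>log\<^sub>2 |A|\<close> steps and the last quotient contributes degree one, all degrees
  are bounded by \<open>s\<close>. A polynomial of degree at most \<open>k\<close> has vanishing alternating sums over
  \<open>(k+1)\<close>-dimensional cubes, which yields supernilpotency. Finally, with one variable as zero
  element, the number of term functions is a product of numbers of absorbing term functions, and
  those of more than \<open>s\<close> variables are trivial by supernilpotency.\<close>

text \<open>Centrality has to survive the passage to the factors and to their quotients, so it is
  kept in the form of 2 by 2 matrices of term values instead of commutators. With a Mal'cev term,
  three entries of a matrix over a central congruence determine the fourth; the group laws on a
  class and the additivity of the operations come out of this uniqueness. The logarithm arises
  because every \<open>W\<close> at least halves the order. \<open>W\<close> consists of the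
  elements of order dividing \<open>p\<close> in the group on a class; it is invariant under all
  additive maps, and it is nontrivial because the class size divides a power of \<open>p\<close>.
  The one prime also lets coordinates of the quotient interpolate functions with values in the new
  layer: both live modulo \<open>p\<close>. Composition of terms does not raise the degree because
  all characters of \<open>W\<close> are used at once: a character composed with an additive part is
  again a character. So the degree depends on the height of the tower of quotients and not on the
  depth of the term. The counting replaces subtraction by translations \<open>P g r r'\<close>,
  which are injective in \<open>g\<close> by centrality.\<close>

abbreviation vals :: "('f, 'a) alg \<Rightarrow> (nat \<Rightarrow> 'a) set" where
  "vals A \<equiv> {\<rho>. range \<rho> \<subseteq> univ A}"

section \<open>Terms, substitution and congruences\<close>

lemma trms_UNIV: "t \<in> trms Sg X \<Longrightarrow> t \<in> trms Sg UNIV"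
  by (induction rule: trms.induct) (auto intro: trms.intros)

lemma eval_in: "algebra Sg A \<Longrightarrow> \<rho> \<in> vals A \<Longrightarrow> t \<in> trms Sg X \<Longrightarrow> eval A \<rho> t \<in> univ A"
  using eval_closed by blast

lemma eval_cong_vars:
  "t \<in> trms Sg X \<Longrightarrow> (\<And>i. i \<in> X \<Longrightarrow> \<rho> i = \<sigma> i) \<Longrightarrow> eval A \<rho> t = eval A \<sigma> t"
proof (induction rule: trms.induct)
  case (App f ts)
  then have "map (eval A \<rho>) ts = map (eval A \<sigma>) ts" by simp
  then show ?case by (simp only: eval.simps)
qed simp

primrec subst :: "(nat \<Rightarrow> 'f trm) \<Rightarrow> 'f trm \<Rightarrow> 'f trm" where
  "subst \<sigma> (Var i) = \<sigma> i"
| "subst \<sigma> (App f ts) = App f (map (subst \<sigma>) ts)"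

lemma subst_trms:
  "t \<in> trms Sg X \<Longrightarrow> (\<And>i. i \<in> X \<Longrightarrow> \<sigma> i \<in> trms Sg Y) \<Longrightarrow> subst \<sigma> t \<in> trms Sg Y"
  by (induction rule: trms.induct) (auto intro!: trms.App)

lemma eval_subst: "eval A \<rho> (subst \<sigma> t) = eval A (\<lambda>i. eval A \<rho> (\<sigma> i)) t"
proof (induction t)
  case (App f ts)
  then have "map (eval A \<rho> \<circ> subst \<sigma>) ts = map (eval A (\<lambda>i. eval A \<rho> (\<sigma> i))) ts" by simp
  then show ?case by (simp only: eval.simps subst.simps map_map)
qed simp

lemma interp_in:
  "algebra Sg A \<Longrightarrow> f \<in> syms Sg \<Longrightarrow> length xs = arity Sg f \<Longrightarrow> set xs \<subseteq> univ A
    \<Longrightarrow> interp A f xs \<in> univ A"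
  by (auto simp: algebra_def nlists_def)

lemma congruence_equiv: "congruence Sg A \<theta> \<Longrightarrow> equiv (univ A) \<theta>"
  by (simp add: congruence_def)

lemma congruence_subset: "congruence Sg A \<theta> \<Longrightarrow> (x, y) \<in> \<theta> \<Longrightarrow> x \<in> univ A \<and> y \<in> univ A"
  by (auto simp: congruence_def equiv_def)

lemma congruence_refl: "congruence Sg A \<theta> \<Longrightarrow> x \<in> univ A \<Longrightarrow> (x, x) \<in> \<theta>"
  by (auto simp: congruence_def equiv_def refl_on_def)

lemma congruence_sym: "congruence Sg A \<theta> \<Longrightarrow> (x, y) \<in> \<theta> \<Longrightarrow> (y, x) \<in> \<theta>"
  by (auto simp: congruence_def equiv_def sym_def)

lemma congruence_trans: "congruence Sg A \<theta> \<Longrightarrow> (x, y) \<in> \<theta> \<Longrightarrow> (y, z) \<in> \<theta> \<Longrightarrow> (x, z) \<in> \<theta>"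
  unfolding congruence_def equiv_def trans_def by blast

lemma congruence_eval:
  assumes "algebra Sg A" "congruence Sg A \<theta>" "\<And>i. (\<rho> i, \<sigma> i) \<in> \<theta>" "t \<in> trms Sg X"
  shows "(eval A \<rho> t, eval A \<sigma> t) \<in> \<theta>"
  using assms(4)
proof (induction rule: trms.induct)
  case (Var i)
  then show ?case using assms by simp
next
  case (App f ts)
  have "\<rho> \<in> vals A" "\<sigma> \<in> vals A" using congruence_subset[OF assms(2,3)] by auto
  then have "set (map (eval A \<rho>) ts) \<subseteq> univ A" "set (map (eval A \<sigma>) ts) \<subseteq> univ A"
    using App eval_in[OF assms(1)] by (simp_all add: image_subset_iff) metis+
  then have "(interp A f (map (eval A \<rho>) ts), interp A f (map (eval A \<sigma>) ts)) \<in> \<theta>"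
    using App by (intro congruenceD[OF assms(2)])
      (auto simp: nlists_def list_all2_conv_all_nth)
  then show ?case by simp
qed

lemma congruenceI:
  assumes "equiv (univ A) \<theta>"
    "\<And>f xs ys. f \<in> syms Sg \<Longrightarrow> length xs = arity Sg f \<Longrightarrow> length ys = arity Sg f \<Longrightarrow>
      (\<forall>i<arity Sg f. (xs ! i, ys ! i) \<in> \<theta>) \<Longrightarrow> (interp A f xs, interp A f ys) \<in> \<theta>"
  shows "congruence Sg A \<theta>"
  using assms unfolding congruence_def nlists_def list_all2_conv_all_nth by auto

lemma congruence_interp:
  assumes "congruence Sg A \<theta>" "f \<in> syms Sg" "length xs = arity Sg f" "length ys = arity Sg f"
    "\<forall>i<arity Sg f. (xs ! i, ys ! i) \<in> \<theta>"
  shows "(interp A f xs, interp A f ys) \<in> \<theta>"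
proof -
  have "set xs \<subseteq> univ A" "set ys \<subseteq> univ A"
    using assms(3-5) congruence_subset[OF assms(1)] by (metis in_set_conv_nth subsetI)+
  then show ?thesis using assms
    by (intro congruenceD[OF assms(1)]) (auto simp: nlists_def list_all2_conv_all_nth)
qed

lemma congruence_Id: "congruence Sg A (Id_on (univ A))" if "algebra Sg A"
proof (rule congruenceI)
  show "equiv (univ A) (Id_on (univ A))"
    by (auto simp: equiv_def refl_on_def sym_def trans_def)
  fix f xs ys assume *: "f \<in> syms Sg" "length xs = arity Sg f" "length ys = arity Sg f"
    "\<forall>i<arity Sg f. (xs ! i, ys ! i) \<in> Id_on (univ A)"
  then have "xs = ys" by (intro nth_equalityI) auto
  moreover have "set xs \<subseteq> univ A" using * by (auto simp: set_conv_nth)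
  ultimately show "(interp A f xs, interp A f ys) \<in> Id_on (univ A)"
    using interp_in[OF that *(1,2)] by auto
qed

text \<open>A total valuation for ternary terms: all variables beyond the first two receive
  \<open>z\<close>, so any term in \<open>trms Sg UNIV\<close> can serve as a ternary term.\<close>

definition tri :: "'a \<Rightarrow> 'a \<Rightarrow> 'a \<Rightarrow> nat \<Rightarrow> 'a" where
  "tri x y z i = (if i = 0 then x else if i = 1 then y else z)"

lemma tri_vals: "x \<in> univ A \<Longrightarrow> y \<in> univ A \<Longrightarrow> z \<in> univ A \<Longrightarrow> tri x y z \<in> vals A"
  by (auto simp: tri_def)

lemma tri_simps [simp]: "tri x y z 0 = x" "tri x y z (Suc 0) = y" "tri x y z 2 = z"
  by (auto simp: tri_def)

lemma tri_app: "(\<lambda>i. g (tri x y z i)) = tri (g x) (g y) (g z)"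
  by (auto simp: tri_def)

definition quad :: "'a \<Rightarrow> 'a \<Rightarrow> 'a \<Rightarrow> 'a \<Rightarrow> nat \<Rightarrow> 'a" where
  "quad x y z u i = (if i = 0 then x else if i = 1 then y else if i = 2 then z else u)"

lemma quad_vals:
  "x \<in> univ A \<Longrightarrow> y \<in> univ A \<Longrightarrow> z \<in> univ A \<Longrightarrow> u \<in> univ A \<Longrightarrow> quad x y z u \<in> vals A"
  by (auto simp: quad_def)

lemma quad_simps [simp]:
  "quad x y z u 0 = x" "quad x y z u (Suc 0) = y" "quad x y z u 2 = z" "quad x y z u 3 = u"
  by (auto simp: quad_def)

lemma quad_app: "(\<lambda>i. g (quad x y z u i)) = quad (g x) (g y) (g z) (g u)"
  by (auto simp: quad_def)


section \<open>Matrices and centrality\<close>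

text \<open>\<open>mtx Sg A \<theta> x y z w\<close> says that the \<open>2 \<times> 2\<close> matrix with rows \<open>x y\<close> and
  \<open>z w\<close> is of the form \<open>t(a,c) t(a,d)\<close> over \<open>t(b,c) t(b,d)\<close> with \<open>c\<close> and \<open>d\<close> componentwise
  \<open>\<theta>\<close>-related.\<close>

inductive mtx :: "'f signature \<Rightarrow> ('f, 'a) alg \<Rightarrow> ('a \<times> 'a) set \<Rightarrow> 'a \<Rightarrow> 'a \<Rightarrow> 'a \<Rightarrow> 'a \<Rightarrow> bool"
  for Sg A \<theta> where
  row: "x \<in> univ A \<Longrightarrow> z \<in> univ A \<Longrightarrow> mtx Sg A \<theta> x x z z"
| col: "(x, y) \<in> \<theta> \<Longrightarrow> mtx Sg A \<theta> x y x y"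
| app: "f \<in> syms Sg \<Longrightarrow> length xs = arity Sg f \<Longrightarrow> length ys = arity Sg f \<Longrightarrow>
    length zs = arity Sg f \<Longrightarrow> length ws = arity Sg f \<Longrightarrow>
    \<forall>i<arity Sg f. mtx Sg A \<theta> (xs ! i) (ys ! i) (zs ! i) (ws ! i) \<Longrightarrow>
    mtx Sg A \<theta> (interp A f xs) (interp A f ys) (interp A f zs) (interp A f ws)"

lemma mtx_eval:
  assumes "\<And>i. mtx Sg A \<theta> (\<rho>1 i) (\<rho>2 i) (\<rho>3 i) (\<rho>4 i)" "t \<in> trms Sg X"
  shows "mtx Sg A \<theta> (eval A \<rho>1 t) (eval A \<rho>2 t) (eval A \<rho>3 t) (eval A \<rho>4 t)"
  using assms(2)
proof (induction rule: trms.induct)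
  case (Var i)
  then show ?case using assms by simp
next
  case (App f ts)
  then show ?case using mtx.app[of f Sg "map (eval A \<rho>1) ts" "map (eval A \<rho>2) ts"
    "map (eval A \<rho>3) ts" "map (eval A \<rho>4) ts" A \<theta>] by simp
qed

text \<open>The term condition for [1,\<theta>] \<le> \<delta>, read off from matrices: what holds
  in the first row modulo \<delta> holds in the second.\<close>

definition cent :: "'f signature \<Rightarrow> ('f, 'a) alg \<Rightarrow> ('a \<times> 'a) set \<Rightarrow> ('a \<times> 'a) set \<Rightarrow> bool" where
  "cent Sg A \<theta> \<delta> \<longleftrightarrow>
     (\<forall>x y z w. mtx Sg A \<theta> x y z w \<longrightarrow> (x, y) \<in> \<delta> \<longrightarrow> (z, w) \<in> \<delta>)"

lemma centD: "cent Sg A \<theta> \<delta> \<Longrightarrow> mtx Sg A \<theta> x y z w \<Longrightarrow> (x, y) \<in> \<delta> \<Longrightarrow> (z, w) \<in> \<delta>"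
  by (auto simp: cent_def)

lemma mtx_in:
  assumes "algebra Sg A" "\<theta> \<subseteq> univ A \<times> univ A" "mtx Sg A \<theta> x y z w"
  shows "x \<in> univ A \<and> y \<in> univ A \<and> z \<in> univ A \<and> w \<in> univ A"
  using assms(3)
proof (induction rule: mtx.induct)
  case (app f xs ys zs ws)
  then have "set xs \<subseteq> univ A" "set ys \<subseteq> univ A" "set zs \<subseteq> univ A" "set ws \<subseteq> univ A"
    by (auto simp: set_conv_nth)
  then show ?case using app interp_in[OF assms(1)] by auto
qed (use assms in auto)

text \<open>As the algebra is finite, all matrices are values of terms at one and the same choice of
  tuples \<open>a\<close>, \<open>b\<close>, \<open>c\<close>, \<open>d\<close>: list all pairs of elements and all pairs in \<open>\<theta>\<close>.\<close>

lemma centralizes_imp_cent: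
  assumes A: "algebra Sg A" "finite (univ A)" and \<theta>: "\<theta> \<subseteq> univ A \<times> univ A"
    and C: "centralizes Sg A (univ A \<times> univ A) \<theta> \<delta>"
  shows "cent Sg A \<theta> \<delta>"
proof -
  obtain rs where rs: "set rs = univ A \<times> univ A" using A(2) finite_list[of "univ A \<times> univ A"] by auto
  obtain cs where cs: "set cs = \<theta>" using finite_list[OF finite_subset[OF \<theta>]] A(2) by auto
  define a b c d where "a = map fst rs" and "b = map snd rs" and "c = map fst cs" and "d = map snd cs"
  define n where "n = length rs + length cs"
  let ?e = "\<lambda>u v t. eval A (\<lambda>i. (u @ v) ! i) t"
  have ex: "\<exists>t \<in> trms Sg {..<n}. x = ?e a c t \<and> y = ?e a d t \<and> z = ?e b c t \<and> w = ?e b d t"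
    if "mtx Sg A \<theta> x y z w" for x y z w
    using that
  proof (induction rule: mtx.induct)
    case (row x z)
    then have "(x, z) \<in> set rs" using rs by simp
    then obtain i where "i < length rs" "rs ! i = (x, z)" by (auto simp: in_set_conv_nth)
    then show ?case
      by (intro bexI[of _ "Var i"]) (auto simp: a_def b_def nth_append n_def intro!: trms.Var)
  next
    case (col x y)
    then obtain i where "i < length cs" "cs ! i = (x, y)"
      using cs by (auto simp: in_set_conv_nth)
    then show ?case
      by (intro bexI[of _ "Var (length rs + i)"])
        (auto simp: a_def b_def c_def d_def nth_append n_def intro!: trms.Var)
  next
    case (app f xs ys zs ws)
    let ?P = "\<lambda>i t. t \<in> trms Sg {..<n} \<and> xs ! i = ?e a c t \<and> ys ! i = ?e a d t \<and> zs ! i = ?e b c t \<and> ws ! i = ?e b d t"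
    have "\<forall>i<arity Sg f. \<exists>t. ?P i t" using app by blast
    then obtain T where T: "\<And>i. i < arity Sg f \<Longrightarrow> ?P i (T i)" by metis
    let ?ts = "map T [0..<arity Sg f]"
    have "xs = map (?e a c) ?ts" "ys = map (?e a d) ?ts" "zs = map (?e b c) ?ts" "ws = map (?e b d) ?ts"
      using app T by (auto intro!: nth_equalityI)
    moreover have "App f ?ts \<in> trms Sg {..<n}" using app T by (intro trms.App) auto
    ultimately show ?case by (intro bexI[of _ "App f ?ts"]) simp_all
  qed
  have mem: "a \<in> nlists (length rs) (univ A)" "b \<in> nlists (length rs) (univ A)"
    "c \<in> nlists (length cs) (univ A)" "d \<in> nlists (length cs) (univ A)"
    using rs cs \<theta> by (auto simp: a_def b_def c_def d_def nlists_def)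
  have rel: "list_all2 (\<lambda>x y. (x, y) \<in> univ A \<times> univ A) a b" "list_all2 (\<lambda>x y. (x, y) \<in> \<theta>) c d"
    using rs cs nth_mem by (fastforce simp: a_def b_def c_def d_def list_all2_conv_all_nth)+
  show ?thesis unfolding cent_def
  proof (intro allI impI)
    fix x y z w assume "mtx Sg A \<theta> x y z w" and xy: "(x, y) \<in> \<delta>"
    then obtain t where t: "t \<in> trms Sg {..<n}" "x = ?e a c t" "y = ?e a d t" "z = ?e b c t" "w = ?e b d t"
      using ex by blast
    define F where "F = (\<lambda>xs\<in>nlists n (univ A). eval A (\<lambda>i. xs ! i) t)"
    have F: "F \<in> term_funs Sg A (length rs + length cs)" using t(1) unfolding F_def term_funs_def n_def by blast
    have app: "u @ v \<in> nlists n (univ A)" if "u \<in> nlists (length rs) (univ A)" "v \<in> nlists (length cs) (univ A)" for u v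
      using that by (auto simp: nlists_def n_def)
    have "F (a @ c) = x" "F (a @ d) = y" "F (b @ c) = z" "F (b @ d) = w"
      using app mem t by (auto simp: F_def)
    then show "(z, w) \<in> \<delta>" using C F mem rel xy unfolding centralizes_def by metis
  qed
qed

lemma congruence_Inter:
  assumes "S \<noteq> {}" "\<And>\<theta>. \<theta> \<in> S \<Longrightarrow> congruence Sg A \<theta>"
  shows "congruence Sg A (\<Inter>S)"
proof (rule congruenceI)
  show "equiv (univ A) (\<Inter>S)"
  proof (rule equivI)
    show "\<Inter>S \<subseteq> univ A \<times> univ A" using assms congruence_subset by fast
    show "refl_on (univ A) (\<Inter>S)" using assms congruence_refl unfolding refl_on_def by fast
    show "sym (\<Inter>S)" using assms congruence_sym unfolding sym_def by fast
    show "trans (\<Inter>S)" using assms congruence_trans unfolding trans_def by (meson InterE InterI)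
  qed
  fix f xs ys assume *: "f \<in> syms Sg" "length xs = arity Sg f" "length ys = arity Sg f"
    "\<forall>i<arity Sg f. (xs ! i, ys ! i) \<in> \<Inter>S"
  then show "(interp A f xs, interp A f ys) \<in> \<Inter>S"
    using congruence_interp[OF assms(2)] by blast
qed

text \<open>Every \<delta> in the intersection that defines the commutator satisfies the matrix
  condition, and this condition survives intersections; the total relation shows that the
  intersection is over a nonempty set.\<close>

lemma commutator_central:
  assumes A: "algebra Sg A" "finite (univ A)" and \<theta>: "congruence Sg A \<theta>"
  shows "congruence Sg A (commutator Sg A (univ A \<times> univ A) \<theta>)"
    "cent Sg A \<theta> (commutator Sg A (univ A \<times> univ A) \<theta>)"
proof -
  define S where "S = {\<delta>. congruence Sg A \<delta> \<and> centralizes Sg A (univ A \<times> univ A) \<theta> \<delta>}"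
  have \<theta>': "\<theta> \<subseteq> univ A \<times> univ A" using congruence_subset[OF \<theta>] by auto
  have "centralizes Sg A (univ A \<times> univ A) \<theta> (univ A \<times> univ A)"
    unfolding centralizes_def
  proof (intro allI ballI impI)
    fix k l t a b c d
    assume t: "t \<in> term_funs Sg A (k + l)" and mem: "a \<in> nlists k (univ A)" "b \<in> nlists k (univ A)"
     "c \<in> nlists l (univ A)" "d \<in> nlists l (univ A)"
    have "t xs \<in> univ A" if "xs \<in> nlists (k + l) (univ A)" for xs
    proof -
      obtain s where s: "s \<in> trms Sg {..<k+l}" "t xs = eval A (\<lambda>i. xs ! i) s"
        using t \<open>xs \<in> _\<close> by (auto simp: term_funs_def)
      obtain e where e: "e \<in> univ A" using A(1) by (auto simp: algebra_def)
      \<comment> \<open>Beyond the length of \<open>xs\<close> the entry \<open>xs ! i\<close> is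
        unspecified; the default \<open>e\<close> gives a valuation into the universe without
        changing the value.\<close>
      have "eval A (\<lambda>i. if i < k + l then xs ! i else e) s \<in> univ A"
        using that e by (intro eval_in[OF A(1) _ s(1)]) (auto simp: nlists_def)
      also have "eval A (\<lambda>i. if i < k + l then xs ! i else e) s = eval A (\<lambda>i. xs ! i) s"
        by (rule eval_cong_vars[OF s(1)]) auto
      finally show ?thesis using s by simp
    qed
    then show "(t (b @ c), t (b @ d)) \<in> univ A \<times> univ A"
      using mem by (auto simp: nlists_def)
  qed
  then have "S \<noteq> {}" using congruence_total[OF A(1)] by (auto simp: S_def)
  then show "congruence Sg A (commutator Sg A (univ A \<times> univ A) \<theta>)"
    unfolding commutator_def S_def[symmetric] by (rule congruence_Inter) (simp add: S_def)
  have "cent Sg A \<theta> \<delta>" if "\<delta> \<in> S" for \<delta>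
    using that centralizes_imp_cent[OF A \<theta>'] by (simp add: S_def)
  then show "cent Sg A \<theta> (commutator Sg A (univ A \<times> univ A) \<theta>)"
    unfolding commutator_def S_def[symmetric] cent_def by blast
qed

text \<open>What is used of the lower central series. These properties pass to homomorphic images,
  so no commutator of an image has to be computed.\<close>

definition central_series :: "'f signature \<Rightarrow> ('f, 'a) alg \<Rightarrow> nat \<Rightarrow> (nat \<Rightarrow> ('a \<times> 'a) set) \<Rightarrow> bool" where
  "central_series Sg A k \<theta> \<longleftrightarrow> \<theta> 0 = univ A \<times> univ A \<and> \<theta> k = Id_on (univ A) \<and>
     (\<forall>i. congruence Sg A (\<theta> i)) \<and> (\<forall>i. cent Sg A (\<theta> i) (\<theta> (Suc i)))"

lemma nilpotent_central_series:
  assumes A: "algebra Sg A" "finite (univ A)" and N: "nilpotent Sg A"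
  obtains k where "central_series Sg A k (lower_central Sg A)"
proof -
  have c: "congruence Sg A (lower_central Sg A i)" for i
    by (induction i) (use congruence_total[OF A(1)] commutator_central(1)[OF A] in auto)
  show ?thesis using that N commutator_central(2)[OF A c] c
    unfolding nilpotent_def central_series_def by auto
qed

section \<open>A Mal'cev term\<close>

text \<open>The free algebra on countably many generators of the variety generated by
  \<open>A\<close>, realised by term operations; the projections are the free generators.\<close>

definition valuation_algebra :: "'f signature \<Rightarrow> ('f, 'a) alg \<Rightarrow> ('f, (nat \<Rightarrow> 'a) \<Rightarrow> 'a) alg" where
  "valuation_algebra Sg A = \<lparr>univ = (\<lambda>t. \<lambda>\<rho>\<in>vals A. eval A \<rho> t) ` trms Sg UNIV,
     interp = (\<lambda>f gs. \<lambda>\<rho>\<in>vals A. interp A f (map (\<lambda>g. g \<rho>) gs))\<rparr>"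

lemma term_op_in_valuation_algebra:
  "t \<in> trms Sg UNIV \<Longrightarrow> (\<lambda>\<rho>\<in>vals A. eval A \<rho> t) \<in> univ (valuation_algebra Sg A)"
  by (simp add: valuation_algebra_def)

lemma proj_in_valuation_algebra: "(\<lambda>\<rho>\<in>vals A. \<rho> i) \<in> univ (valuation_algebra Sg A)"
proof -
  have "Var i \<in> trms Sg UNIV" by (rule trms.Var) simp
  from term_op_in_valuation_algebra[OF this, of A] show ?thesis by simp
qed

lemma valuation_algebra_alg:
  assumes A: "algebra Sg A"
  shows "algebra Sg (valuation_algebra Sg A)"
proof -
  let ?F = "valuation_algebra Sg A"
  have "interp ?F f gs \<in> univ ?F" if f: "f \<in> syms Sg" and gs: "gs \<in> nlists (arity Sg f) (univ ?F)" for f gs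
  proof -
    have "gs \<in> lists ((\<lambda>t. \<lambda>\<rho>\<in>vals A. eval A \<rho> t) ` trms Sg UNIV)"
      using gs by (auto simp: nlists_def valuation_algebra_def)
    then obtain ts where ts: "gs = map (\<lambda>t. \<lambda>\<rho>\<in>vals A. eval A \<rho> t) ts" "ts \<in> lists (trms Sg UNIV)"
      unfolding lists_image by auto
    then have "App f ts \<in> trms Sg UNIV" using f gs by (intro trms.App) (auto simp: nlists_def)
    moreover have "interp ?F f gs = (\<lambda>\<rho>\<in>vals A. eval A \<rho> (App f ts))"
    proof
      fix \<rho>
      have "\<rho> \<in> vals A \<Longrightarrow> map (\<lambda>g. g \<rho>) gs = map (eval A \<rho>) ts" using ts by simp
      then show "interp ?F f gs \<rho> = (\<lambda>\<rho>\<in>vals A. eval A \<rho> (App f ts)) \<rho>"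
        by (simp add: valuation_algebra_def restrict_def del: map_eq_conv)
    qed
    ultimately show ?thesis using term_op_in_valuation_algebra by metis
  qed
  then show ?thesis using proj_in_valuation_algebra unfolding algebra_def by blast
qed

lemma valuation_algebra_eval:
  assumes "\<rho> \<in> vals A" "t \<in> trms Sg X"
  shows "eval (valuation_algebra Sg A) \<sigma> t \<rho> = eval A (\<lambda>i. \<sigma> i \<rho>) t"
  using assms(2)
proof (induction rule: trms.induct)
  case (App f ts)
  then have "map ((\<lambda>g. g \<rho>) \<circ> eval (valuation_algebra Sg A) \<sigma>) ts = map (eval A (\<lambda>i. \<sigma> i \<rho>)) ts" by simp
  moreover have "interp (valuation_algebra Sg A) f gs \<rho> = interp A f (map (\<lambda>g. g \<rho>) gs)" for gs
    using assms(1) by (simp add: valuation_algebra_def)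
  ultimately show ?case by (simp only: eval.simps map_map)
qed simp

lemma valuation_algebra_univ:
  assumes "algebra Sg A" "g \<in> univ (valuation_algebra Sg A)"
  shows "\<rho> \<in> vals A \<Longrightarrow> g \<rho> \<in> univ A" "\<rho> \<notin> vals A \<Longrightarrow> g \<rho> = undefined"
proof -
  obtain t where "t \<in> trms Sg UNIV" "g = (\<lambda>\<rho>\<in>vals A. eval A \<rho> t)"
    using assms(2) by (auto simp: valuation_algebra_def)
  then show "\<rho> \<in> vals A \<Longrightarrow> g \<rho> \<in> univ A" "\<rho> \<notin> vals A \<Longrightarrow> g \<rho> = undefined"
    using eval_in[OF assms(1), of \<rho>] by (simp_all del: mem_Collect_eq)
qed

text \<open>Identities are checked pointwise; outside \<open>vals A\<close> all elements are
  \<open>undefined\<close>.\<close>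

lemma valuation_algebra_satisfies:
  assumes A: "algebra Sg A" and E: "identities Sg E" "satisfies A E"
  shows "satisfies (valuation_algebra Sg A) E"
  unfolding satisfies_def
proof clarify
  let ?F = "valuation_algebra Sg A"
  fix s t and \<sigma> :: "nat \<Rightarrow> _" assume st: "(s, t) \<in> E" and \<sigma>: "range \<sigma> \<subseteq> univ ?F"
  then have T: "s \<in> trms Sg UNIV" "t \<in> trms Sg UNIV" using E(1) by (auto simp: identities_def)
  show "eval ?F \<sigma> s = eval ?F \<sigma> t"
  proof
    fix \<rho> show "eval ?F \<sigma> s \<rho> = eval ?F \<sigma> t \<rho>"
    proof (cases "\<rho> \<in> vals A")
      case True
      then have "range (\<lambda>i. \<sigma> i \<rho>) \<subseteq> univ A"
        using \<sigma> valuation_algebra_univ(1)[OF A] by (auto simp: image_subset_iff)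
      then show ?thesis using E(2) st True T by (fastforce simp: valuation_algebra_eval satisfies_def)
    next
      case False
      have "eval ?F \<sigma> u \<in> univ ?F" if "u \<in> trms Sg UNIV" for u
        using that \<sigma> eval_in[OF valuation_algebra_alg[OF A]] by blast
      then show ?thesis using T False valuation_algebra_univ(2)[OF A] by metis
    qed
  qed
qed

text \<open>The kernel of restriction to \<open>J\<close>. For \<open>J\<close> the valuations
  giving equal values to certain variables, this is the kernel of identifying the corresponding
  generators.\<close>

definition agree :: "('f, (nat \<Rightarrow> 'a) \<Rightarrow> 'a) alg \<Rightarrow> (nat \<Rightarrow> 'a) set
    \<Rightarrow> (((nat \<Rightarrow> 'a) \<Rightarrow> 'a) \<times> ((nat \<Rightarrow> 'a) \<Rightarrow> 'a)) set" where
  "agree F J = {(g, h) \<in> univ F \<times> univ F. \<forall>\<rho>\<in>J. g \<rho> = h \<rho>}"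

lemma agree_congruence:
  assumes A: "algebra Sg A" and J: "J \<subseteq> vals A"
  shows "congruence Sg (valuation_algebra Sg A) (agree (valuation_algebra Sg A) J)"
proof (rule congruenceI)
  let ?F = "valuation_algebra Sg A"
  show "equiv (univ ?F) (agree ?F J)"
    by (auto simp: equiv_def refl_on_def sym_def trans_def agree_def)
  fix f gs hs assume *: "f \<in> syms Sg" "length gs = arity Sg f" "length hs = arity Sg f"
    "\<forall>i<arity Sg f. (gs ! i, hs ! i) \<in> agree ?F J"
  then have "set gs \<subseteq> univ ?F" "set hs \<subseteq> univ ?F" by (auto simp: set_conv_nth agree_def)
  then have "interp ?F f gs \<in> univ ?F" "interp ?F f hs \<in> univ ?F"
    using interp_in[OF valuation_algebra_alg[OF A]] * by auto
  moreover have "interp ?F f gs \<rho> = interp ?F f hs \<rho>" if "\<rho> \<in> J" for \<rho>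
  proof -
    have "map (\<lambda>g. g \<rho>) gs = map (\<lambda>g. g \<rho>) hs"
      using * that by (intro nth_equalityI) (auto simp: agree_def)
    then show ?thesis using J that by (auto simp: valuation_algebra_def restrict_def simp del: map_eq_conv)
  qed
  ultimately show "(interp ?F f gs, interp ?F f hs) \<in> agree ?F J" by (auto simp: agree_def)
qed

text \<open>Day's argument: in the algebra of term operations, the pair of the first and the last of
  four generators lies in \<open>(\<gamma> \<or> \<alpha>) \<and> \<beta>\<close>, where \<open>\<gamma> \<le> \<beta>\<close>.\<close>

lemma Day_chain:
  fixes A :: "('f, 'a) alg"
  assumes "in_congruence_modular_variety Sg A"
  defines "F \<equiv> valuation_algebra Sg A"
  defines "\<alpha> \<equiv> agree F {quad a a c c | a c. a \<in> univ A \<and> c \<in> univ A}"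
    and "\<beta> \<equiv> agree F {quad a b b a | a b. a \<in> univ A \<and> b \<in> univ A}"
    and "\<gamma> \<equiv> agree F {quad a b b c | a b c. a \<in> univ A \<and> b \<in> univ A \<and> c \<in> univ A}"
  shows "((\<lambda>\<rho>\<in>vals A. \<rho> 0), (\<lambda>\<rho>\<in>vals A. \<rho> 3)) \<in> (\<gamma> \<union> (\<alpha> \<inter> \<beta>))\<^sup>+"
proof -
  obtain E where E: "congruence_modular_variety Sg E" "algebra Sg A" "satisfies A E"
    using assms by (auto simp: in_congruence_modular_variety_def)
  have mod: "modular_congruences Sg F"
    unfolding F_def using E
    by (intro congruence_modular_variety_any_type[OF E(1)] valuation_algebra_alg valuation_algebra_satisfies)
      (auto simp: congruence_modular_variety_def)
  have cong: "congruence Sg F \<alpha>" "congruence Sg F \<beta>" "congruence Sg F \<gamma>"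
    unfolding \<alpha>_def \<beta>_def \<gamma>_def F_def
    by (intro agree_congruence[OF E(2)] subsetI; elim CollectE exE conjE; simp add: quad_def image_subset_iff)+
  have sub: "\<gamma> \<subseteq> \<beta>" unfolding \<gamma>_def \<beta>_def agree_def by blast
  define X :: "nat \<Rightarrow> (nat \<Rightarrow> 'a) \<Rightarrow> 'a" where "X i = (\<lambda>\<rho>\<in>vals A. \<rho> i)" for i
  have X: "X i \<in> univ F" for i unfolding F_def X_def by (rule proj_in_valuation_algebra)
  have Xq: "X i (quad a b c d) = quad a b c d i"
    if "a \<in> univ A" "b \<in> univ A" "c \<in> univ A" "d \<in> univ A" for i a b c d
    using quad_vals[OF that] by (simp add: X_def)
  \<comment> \<open>The path 0, 1, 2, 3 of generators alternates \<alpha>, \<gamma>, \<alpha>, while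
    \<beta> joins its two ends directly.\<close>
  have 1: "(X 0, X 1) \<in> \<alpha>" "(X 2, X 3) \<in> \<alpha>" "(X 1, X 2) \<in> \<gamma>" "(X 0, X 3) \<in> \<beta>"
    unfolding \<alpha>_def \<beta>_def \<gamma>_def agree_def using X by (auto simp: Xq)
  let ?J = "cong_join Sg F \<gamma> \<alpha>"
  have J: "congruence Sg F ?J" using cong E(2) by (intro congruence_join) (auto simp: F_def valuation_algebra_alg)
  have "(X 0, X 1) \<in> ?J" "(X 1, X 2) \<in> ?J" "(X 2, X 3) \<in> ?J"
    using 1 cong_join_upper(1)[of \<gamma> Sg F \<alpha>] cong_join_upper(2)[of \<alpha> Sg F \<gamma>] by auto
  then have "(X 0, X 3) \<in> ?J" using congruence_trans[OF J] by blast
  then have "(X 0, X 3) \<in> ?J \<inter> \<beta>" using 1 by simp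
  \<comment> \<open>The modular law, available because \<gamma> is contained in \<beta>. The join on
    the right is then resolved into a finite chain, whose members are the Day terms.\<close>
  also have "?J \<inter> \<beta> = cong_join Sg F \<gamma> (\<alpha> \<inter> \<beta>)"
    using mod cong sub unfolding modular_congruences_def by blast
  also have "\<dots> \<subseteq> (\<gamma> \<union> (\<alpha> \<inter> \<beta>))\<^sup>+"
    using cong by (intro cong_join_least congruence_trancl congruence_Int) auto
  finally show ?thesis unfolding X_def .
qed

text \<open>Follows the chain of Day terms \<open>m\<close>, translating it into ternary terms \<open>q\<close> for
  which \<open>q(x,y,y)\<close> tracks \<open>m(y,y,x,x)\<close>; this value is \<open>y\<close> at the start and \<open>x\<close> at the end.\<close>

lemma difference_term:
  fixes A :: "('f, 'a) alg"
  assumes V: "in_congruence_modular_variety Sg A"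
  obtains q where "q \<in> trms Sg UNIV"
    "\<And>x z. x \<in> univ A \<Longrightarrow> z \<in> univ A \<Longrightarrow> eval A (tri x x z) q = z"
    "\<And>\<theta> \<delta> x y. congruence Sg A \<theta> \<Longrightarrow> congruence Sg A \<delta> \<Longrightarrow> cent Sg A \<theta> \<delta> \<Longrightarrow> (x, y) \<in> \<theta> \<Longrightarrow>
      (eval A (tri x y y) q, x) \<in> \<delta>"
proof -
  have A: "algebra Sg A" using V by (auto simp: in_congruence_modular_variety_def)
  define F where "F \<equiv> valuation_algebra Sg A"
  define \<alpha> where "\<alpha> \<equiv> agree F {quad a a c c | a c. a \<in> univ A \<and> c \<in> univ A}"
  define \<beta> where "\<beta> \<equiv> agree F {quad a b b a | a b. a \<in> univ A \<and> b \<in> univ A}"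
  define \<gamma> where "\<gamma> \<equiv> agree F {quad a b b c | a b c. a \<in> univ A \<and> b \<in> univ A \<and> c \<in> univ A}"
  define X :: "nat \<Rightarrow> (nat \<Rightarrow> 'a) \<Rightarrow> 'a" where "X i = (\<lambda>\<rho>\<in>vals A. \<rho> i)" for i
  \<comment> \<open>The invariant along the chain: \<open>g\<close> is the Day operation reached so
    far and \<open>q\<close> a ternary term that imitates its value at \<open>quad y y x x\<close>
    modulo every admissible \<delta>.\<close>
  define good where "good g q \<longleftrightarrow> q \<in> trms Sg UNIV \<and>
     (\<forall>x\<in>univ A. \<forall>z\<in>univ A. eval A (tri x x z) q = z) \<and>
     (\<forall>\<theta> \<delta> x y. congruence Sg A \<theta> \<longrightarrow> congruence Sg A \<delta> \<longrightarrow> cent Sg A \<theta> \<delta> \<longrightarrow> (x, y) \<in> \<theta> \<longrightarrow>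
      (eval A (tri x y y) q, g (quad y y x x)) \<in> \<delta>)" for g q
  have gU: "g (quad a b c d) \<in> univ A"
    if "g \<in> univ F" "a \<in> univ A" "b \<in> univ A" "c \<in> univ A" "d \<in> univ A" for g a b c d
    using that quad_vals valuation_algebra_univ(1)[OF A] unfolding F_def by metis
  have chain: "(X 0, X 3) \<in> (\<gamma> \<union> (\<alpha> \<inter> \<beta>))\<^sup>+"
    using Day_chain[OF V] by (simp add: X_def F_def \<alpha>_def \<beta>_def \<gamma>_def)
  have X: "X i (quad a b c d) = quad a b c d i"
    if "a \<in> univ A" "b \<in> univ A" "c \<in> univ A" "d \<in> univ A" for i a b c d
    using quad_vals[OF that] by (simp add: X_def)
  have XF: "X 0 \<in> univ F" unfolding F_def X_def by (rule proj_in_valuation_algebra)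
  have "(X 0, g) \<in> \<beta> \<and> (\<exists>q. good g q)" if "(X 0, g) \<in> (\<gamma> \<union> (\<alpha> \<inter> \<beta>))\<^sup>*" for g
    using that
  proof (induction rule: rtrancl_induct)
    case base
    \<comment> \<open>The third projection starts the chain: at \<open>tri x y y\<close> it has the
      value \<open>y\<close>, as has \<open>X 0\<close> at \<open>quad y y x x\<close>.\<close>
    have "Var 2 \<in> trms Sg UNIV" by (rule trms.Var) simp
    moreover have "X 0 (quad y y x x) = y" "(y, y) \<in> \<delta>"
      if "congruence Sg A \<theta>" "congruence Sg A \<delta>" "(x, y) \<in> \<theta>" for \<theta> \<delta> x y
      using congruence_subset[OF that(1,3)] congruence_refl[OF that(2)] by (simp_all add: X)
    ultimately have "good (X 0) (Var 2)" unfolding good_def by simp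
    then show ?case using XF by (auto simp: \<beta>_def agree_def)
  next
    case (step g h)
    then obtain q where q: "good g q" by blast
    have gF: "g \<in> univ F" and hF: "h \<in> univ F" using step(2) by (auto simp: \<alpha>_def \<gamma>_def agree_def)
    have \<gamma>\<beta>: "\<gamma> \<subseteq> \<beta>" unfolding \<gamma>_def \<beta>_def agree_def by blast
    have h\<beta>: "(X 0, h) \<in> \<beta>"
    proof -
      have "(g, h) \<in> \<beta>" using step(2) \<gamma>\<beta> by blast
      then show ?thesis using step.IH unfolding \<beta>_def agree_def by auto
    qed
    have gb: "g (quad a b b a) = a" "h (quad a b b a) = a" if "a \<in> univ A" "b \<in> univ A" for a b
    proof -
      have "X 0 (quad a b b a) = g (quad a b b a)" "X 0 (quad a b b a) = h (quad a b b a)"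
        using step.IH h\<beta> that unfolding \<beta>_def agree_def by blast+
      then show "g (quad a b b a) = a" "h (quad a b b a) = a" using X that by simp_all
    qed
    obtain tg where tg: "tg \<in> trms Sg UNIV" "g = (\<lambda>\<rho>\<in>vals A. eval A \<rho> tg)"
      using gF unfolding F_def valuation_algebra_def by auto
    obtain th where th: "th \<in> trms Sg UNIV" "h = (\<lambda>\<rho>\<in>vals A. eval A \<rho> th)"
      using hF unfolding F_def valuation_algebra_def by auto
    have geval: "g (quad a b c d) = eval A (quad a b c d) tg" "h (quad a b c d) = eval A (quad a b c d) th"
      if "a \<in> univ A" "b \<in> univ A" "c \<in> univ A" "d \<in> univ A" for a b c d
      using quad_vals[OF that] unfolding tg(2) th(2) by simp_all
    consider "(g, h) \<in> \<alpha>" | "(g, h) \<in> \<gamma>" using step(2) by blast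
    then show ?case
    proof cases
      case 1
      then have "g (quad y y x x) = h (quad y y x x)" if "x \<in> univ A" "y \<in> univ A" for x y
        using that unfolding \<alpha>_def agree_def by blast
      then have "good h q" using q congruence_subset unfolding good_def by metis
      then show ?thesis using h\<beta> by blast
    next
      case 2
      then have gh: "g (quad a b b c) = h (quad a b b c)" if "a \<in> univ A" "b \<in> univ A" "c \<in> univ A" for a b c
        using that unfolding \<gamma>_def agree_def by blast
      \<comment> \<open>A \<gamma> step identifies \<open>g\<close> and \<open>h\<close> only where
        the two middle arguments agree. So the third argument is moved from \<open>x\<close> to
        \<open>y\<close> by \<open>q1\<close>, then \<open>g\<close> is exchanged for
        \<open>h\<close>, and \<open>q2\<close> moves the argument back.\<close>
      define q1 where "q1 = subst (quad q (Var 0) (Var 1) q) tg"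
      define q2 where "q2 = subst (quad q1 (Var 1) (Var 0) q1) th"
      have V: "Var i \<in> trms Sg UNIV" for i by (rule trms.Var) simp
      have qt: "q \<in> trms Sg UNIV" using q by (simp add: good_def)
      have q1t: "q1 \<in> trms Sg UNIV" unfolding q1_def
        by (intro subst_trms[OF tg(1)]) (simp add: quad_def qt V)
      have q2t: "q2 \<in> trms Sg UNIV" unfolding q2_def
        by (intro subst_trms[OF th(1)]) (simp add: quad_def q1t V)
      let ?e = "\<lambda>x y z. eval A (tri x y z)"
      have e1: "?e x y z q1 = g (quad (?e x y z q) x y (?e x y z q))"
        and e2: "?e x y z q2 = h (quad (?e x y z q1) y x (?e x y z q1))"
        and eU: "?e x y z q \<in> univ A" "?e x y z q1 \<in> univ A"
        if "x \<in> univ A" "y \<in> univ A" "z \<in> univ A" for x y z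
      proof -
        show e: "?e x y z q \<in> univ A" "?e x y z q1 \<in> univ A"
          using eval_in[OF A tri_vals[OF that]] qt q1t by auto
        show "?e x y z q1 = g (quad (?e x y z q) x y (?e x y z q))"
          using geval(1) e that by (simp add: q1_def eval_subst quad_app)
        show "?e x y z q2 = h (quad (?e x y z q1) y x (?e x y z q1))"
          using geval(2) e that by (simp add: q2_def eval_subst quad_app)
      qed
      have "good h q2" unfolding good_def
      proof (intro conjI ballI allI impI q2t)
        fix x z assume xz: "x \<in> univ A" "z \<in> univ A"
        then have "?e x x z q = z" using q by (simp add: good_def)
        then show "?e x x z q2 = z" using e1 e2 gb xz by simp
      next
        fix \<theta> \<delta> x y
        assume \<theta>: "congruence Sg A \<theta>" and \<delta>: "congruence Sg A \<delta>" and c: "cent Sg A \<theta> \<delta>" and xy: "(x, y) \<in> \<theta>"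
        have U: "x \<in> univ A" "y \<in> univ A" using congruence_subset[OF \<theta> xy] by auto
        define w where "w = ?e x y y q"
        define w1 where "w1 = ?e x y y q1"
        have wU: "w \<in> univ A" "w1 \<in> univ A" using eU U by (auto simp: w_def w1_def)
        have yx: "(y, x) \<in> \<theta>" "(x, x) \<in> \<theta>" "(y, y) \<in> \<theta>" using congruence_sym[OF \<theta> xy] congruence_refl[OF \<theta>] U by auto
        have qq: "(?e x y y t, ?e y y y t) \<in> \<theta>" if "t \<in> trms Sg UNIV" for t
          by (rule congruence_eval[OF A \<theta> _ that]) (auto simp: tri_def xy yx)
        have "(w, y) \<in> \<theta>" using qq[OF qt] q U by (simp add: w_def good_def)
        moreover have "?e y y y q1 = y" using e1 U q gb by (simp add: good_def)
        then have "(w1, y) \<in> \<theta>" using qq[OF q1t] by (simp add: w1_def)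
        ultimately have rel: "(w, y) \<in> \<theta>" "(w1, y) \<in> \<theta>" "(w, x) \<in> \<theta>" "(w1, x) \<in> \<theta>"
          using yx congruence_trans[OF \<theta>] by blast+
        have 0: "(w, g (quad y y x x)) \<in> \<delta>" using q \<theta> \<delta> c xy by (simp add: good_def w_def)
        \<comment> \<open>Between the rows only the third argument changes. The first row is
          \<open>w\<close> and \<open>g (quad y y x x)\<close>, which are \<delta>-related by the
          invariant; centrality carries this to the second row, which starts with
          \<open>w1\<close>.\<close>
        have "mtx Sg A \<theta> (eval A (quad w x x w) tg) (eval A (quad y y x x) tg)
          (eval A (quad w x y w) tg) (eval A (quad y y y x) tg)"
          by (rule mtx_eval[OF _ tg(1)])
            (use U rel xy yx in \<open>auto simp: quad_def intro: mtx.row mtx.col\<close>)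
        then have "mtx Sg A \<theta> w (g (quad y y x x)) w1 (g (quad y y y x))"
          using gb(1)[OF wU(1) U(1)] e1[OF U(1,2,2)] unfolding w_def[symmetric] w1_def[symmetric]
          by (simp only: geval(1)[OF wU(1) U(1,1) wU(1)] geval(1)[OF wU(1) U wU(1)]
            geval(1)[OF U(2,2,1,1)] geval(1)[OF U(2,2,2,1)])
        then have 1: "(w1, h (quad y y y x)) \<in> \<delta>" using centD[OF c] 0 gh U by metis
        \<comment> \<open>The same move backwards, with \<open>h\<close> in place of
          \<open>g\<close>: the first row is \<open>w1\<close> and
          \<open>h (quad y y y x)\<close>.\<close>
        have "mtx Sg A \<theta> (eval A (quad w1 y y w1) th) (eval A (quad y y y x) th)
          (eval A (quad w1 y x w1) th) (eval A (quad y y x x) th)"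
          by (rule mtx_eval[OF _ th(1)])
            (use U rel xy yx in \<open>auto simp: quad_def intro: mtx.row mtx.col\<close>)
        then have "mtx Sg A \<theta> w1 (h (quad y y y x)) (?e x y y q2) (h (quad y y x x))"
          using gb(2)[OF wU(2) U(2)] e2[OF U(1,2,2)] unfolding w1_def[symmetric]
          by (simp only: geval(2)[OF wU(2) U(2,2) wU(2)] geval(2)[OF wU(2) U(2,1) wU(2)]
            geval(2)[OF U(2,2,1,1)] geval(2)[OF U(2,2,2,1)])
        then show "(?e x y y q2, h (quad y y x x)) \<in> \<delta>" using centD[OF c] 1 by metis
      qed
      then show ?thesis using h\<beta> by blast
    qed
  qed
  then obtain q where "good (X 3) q" using chain trancl_into_rtrancl by metis
  moreover have "X 3 (quad y y x x) = x" if "congruence Sg A \<theta>" "(x, y) \<in> \<theta>" for \<theta> x y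
    using congruence_subset[OF that] by (simp add: X)
  ultimately show ?thesis by (intro that[of q]) (auto simp: good_def)
qed

section \<open>From a difference term to a Mal'cev term\<close>

definition malcev :: "'f signature \<Rightarrow> ('f, 'a) alg \<Rightarrow> 'f trm \<Rightarrow> bool" where
  "malcev Sg A q \<longleftrightarrow> q \<in> trms Sg UNIV \<and>
     (\<forall>x\<in>univ A. \<forall>y\<in>univ A. eval A (tri x x y) q = y \<and> eval A (tri x y y) q = x)"

text \<open>If \<open>q(x,y,y)\<close> equals \<open>x\<close> modulo \<theta>\<open>i\<close>, then
  \<open>d(x, q(x,y,y), q(x,y,z))\<close> does so one step further down: for \<open>z = y\<close>
  the last two arguments of \<open>d\<close> coincide and are \<theta>\<open>i\<close>-related to
  the first. The law for \<open>x = y\<close> is preserved exactly.\<close>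

lemma malcev_term:
  fixes A :: "('f, 'a) alg"
  assumes V: "in_congruence_modular_variety Sg A" and S: "central_series Sg A k \<theta>"
  obtains q where "malcev Sg A q"
proof -
  obtain d where d: "d \<in> trms Sg UNIV"
    "\<And>x z. x \<in> univ A \<Longrightarrow> z \<in> univ A \<Longrightarrow> eval A (tri x x z) d = z"
    "\<And>\<theta> \<delta> x y. congruence Sg A \<theta> \<Longrightarrow> congruence Sg A \<delta> \<Longrightarrow> cent Sg A \<theta> \<delta> \<Longrightarrow> (x, y) \<in> \<theta> \<Longrightarrow>
      (eval A (tri x y y) d, x) \<in> \<delta>"
    using difference_term[OF V] by metis
  have A: "algebra Sg A" using V by (auto simp: in_congruence_modular_variety_def)
  have \<theta>: "\<theta> 0 = univ A \<times> univ A" "\<theta> k = Id_on (univ A)" "\<And>i. congruence Sg A (\<theta> i)" "\<And>i. cent Sg A (\<theta> i) (\<theta> (Suc i))"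
    using S by (auto simp: central_series_def)
  have "\<exists>q\<in>trms Sg UNIV. \<forall>x\<in>univ A. \<forall>y\<in>univ A. eval A (tri x x y) q = y \<and> (eval A (tri x y y) q, x) \<in> \<theta> i" for i
  proof (induction i)
    case 0
    then show ?case using d \<theta>(1) eval_in[OF A tri_vals d(1)] by (intro bexI[of _ d]) auto
  next
    case (Suc i)
    then obtain q where q: "q \<in> trms Sg UNIV" "\<And>x y. x \<in> univ A \<Longrightarrow> y \<in> univ A \<Longrightarrow> eval A (tri x x y) q = y"
      "\<And>x y. x \<in> univ A \<Longrightarrow> y \<in> univ A \<Longrightarrow> (eval A (tri x y y) q, x) \<in> \<theta> i" by metis
    define r where "r = subst (tri (Var 0) (subst (tri (Var 0) (Var 1) (Var 1)) q) q) d"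
    have Vr: "Var j \<in> trms Sg UNIV" for j by (rule trms.Var) simp
    have "r \<in> trms Sg UNIV" unfolding r_def
      by (intro subst_trms[OF d(1)]) (auto simp: tri_def Vr q(1) intro!: subst_trms[OF q(1)])
    moreover have r: "eval A (tri x y z) r = eval A (tri x (eval A (tri x y y) q) (eval A (tri x y z) q)) d" for x y z
      by (simp add: r_def eval_subst tri_app)
    moreover have "(eval A (tri x y y) r, x) \<in> \<theta> (Suc i)" if "x \<in> univ A" "y \<in> univ A" for x y
      unfolding r using d(3)[OF \<theta>(3) \<theta>(3) \<theta>(4) congruence_sym[OF \<theta>(3) q(3)[OF that]]] .
    ultimately show ?case using q(2) d(2) by (intro bexI[of _ r]) auto
  qed
  from this[of k] obtain q where "malcev Sg A q" unfolding malcev_def \<theta>(2) by (auto simp: Id_on_iff)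
  then show ?thesis by (rule that)
qed

section \<open>Homomorphic images\<close>

definition hom_onto :: "'f signature \<Rightarrow> ('f, 'a) alg \<Rightarrow> ('f, 'b) alg \<Rightarrow> ('a \<Rightarrow> 'b) \<Rightarrow> bool" where
  "hom_onto Sg A B \<pi> \<longleftrightarrow> \<pi> ` univ A = univ B \<and>
     (\<forall>f\<in>syms Sg. \<forall>xs. length xs = arity Sg f \<longrightarrow> set xs \<subseteq> univ A \<longrightarrow>
        \<pi> (interp A f xs) = interp B f (map \<pi> xs))"

lemma hom_onto_interp:
  "hom_onto Sg A B \<pi> \<Longrightarrow> f \<in> syms Sg \<Longrightarrow> length xs = arity Sg f \<Longrightarrow> set xs \<subseteq> univ A \<Longrightarrow>
    \<pi> (interp A f xs) = interp B f (map \<pi> xs)"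
  by (auto simp: hom_onto_def)

lemma hom_onto_eval:
  assumes "algebra Sg A" "hom_onto Sg A B \<pi>" "\<rho> \<in> vals A" "t \<in> trms Sg X"
  shows "\<pi> (eval A \<rho> t) = eval B (\<lambda>i. \<pi> (\<rho> i)) t"
  using assms(4)
proof (induction rule: trms.induct)
  case (App f ts)
  then have "set (map (eval A \<rho>) ts) \<subseteq> univ A" using eval_in[OF assms(1,3)] by auto
  then have "\<pi> (eval A \<rho> (App f ts)) = interp B f (map \<pi> (map (eval A \<rho>) ts))"
    using hom_onto_interp[OF assms(2)] App by simp
  also have "map \<pi> (map (eval A \<rho>) ts) = map (eval B (\<lambda>i. \<pi> (\<rho> i))) ts" using App by simp
  finally show ?case by simp
qed simp

lemma hom_onto_malcev:
  assumes "algebra Sg A" "hom_onto Sg A B \<pi>" "malcev Sg A q"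
  shows "malcev Sg B q"
proof -
  have q: "q \<in> trms Sg UNIV" using assms(3) by (simp add: malcev_def)
  have "eval B (tri x x y) q = y \<and> eval B (tri x y y) q = x" if "x \<in> univ B" "y \<in> univ B" for x y
  proof -
    have "x \<in> \<pi> ` univ A" "y \<in> \<pi> ` univ A" using that assms(2) by (auto simp: hom_onto_def)
    then obtain x' y' where xy: "x' \<in> univ A" "y' \<in> univ A" "x = \<pi> x'" "y = \<pi> y'" by blast
    have "\<pi> (eval A (tri x' x' y') q) = eval B (tri x x y) q" "\<pi> (eval A (tri x' y' y') q) = eval B (tri x y y) q"
      using hom_onto_eval[OF assms(1,2) tri_vals q] xy by (simp_all add: tri_app)
    then show ?thesis using assms(3) xy by (simp add: malcev_def)
  qed
  then show ?thesis using q by (simp add: malcev_def)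
qed

locale malcev_algebra =
  fixes Sg :: "'f signature" and A :: "('f, 'a) alg" and q :: "'f trm"
  assumes alg: "algebra Sg A" and malc: "malcev Sg A q"
begin

definition P :: "'a \<Rightarrow> 'a \<Rightarrow> 'a \<Rightarrow> 'a" where "P x y z = eval A (tri x y z) q"

lemma q_trm: "q \<in> trms Sg UNIV" using malc by (simp add: malcev_def)

lemma P_in [simp]: "x \<in> univ A \<Longrightarrow> y \<in> univ A \<Longrightarrow> z \<in> univ A \<Longrightarrow> P x y z \<in> univ A"
  unfolding P_def by (rule eval_in[OF alg tri_vals q_trm])

lemma P_left [simp]: "x \<in> univ A \<Longrightarrow> y \<in> univ A \<Longrightarrow> P x x y = y"
  and P_right [simp]: "x \<in> univ A \<Longrightarrow> y \<in> univ A \<Longrightarrow> P x y y = x"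
  using malc by (auto simp: malcev_def P_def)

lemma P_congruence:
  assumes "congruence Sg A \<theta>" "(x, x') \<in> \<theta>" "(y, y') \<in> \<theta>" "(z, z') \<in> \<theta>"
  shows "(P x y z, P x' y' z') \<in> \<theta>"
  unfolding P_def by (rule congruence_eval[OF alg assms(1) _ q_trm]) (use assms in \<open>auto simp: tri_def\<close>)

lemma P_mtx:
  assumes "mtx Sg A \<theta> x1 x2 x3 x4" "mtx Sg A \<theta> y1 y2 y3 y4" "mtx Sg A \<theta> z1 z2 z3 z4"
  shows "mtx Sg A \<theta> (P x1 y1 z1) (P x2 y2 z2) (P x3 y3 z3) (P x4 y4 z4)"
  unfolding P_def by (rule mtx_eval[OF _ q_trm]) (use assms in \<open>auto simp: tri_def\<close>)

text \<open>Descend along the series: if \<open>x\<close> and \<open>x'\<close> are related at level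
  \<open>i\<close>, the matrix with first row \<open>P x a b\<close>, \<open>P x' a b\<close> has
  second row \<open>P x a a\<close>, \<open>P x' a a\<close>, that is \<open>x\<close>,
  \<open>x'\<close>.\<close>

lemma P_inj_central:
  assumes S: "central_series Sg A k \<theta>"
    and "x \<in> univ A" "x' \<in> univ A" "a \<in> univ A" "b \<in> univ A" "P x a b = P x' a b"
  shows "x = x'"
proof -
  have c: "congruence Sg A (\<theta> i)" "cent Sg A (\<theta> i) (\<theta> (Suc i))" for i
    using S by (auto simp: central_series_def)
  have "(x, x') \<in> \<theta> i" for i
  proof (induction i)
    case 0
    then show ?case using S assms by (simp add: central_series_def)
  next
    case (Suc i)
    have "mtx Sg A (\<theta> i) (P x a b) (P x' a b) (P x a a) (P x' a a)"
      using Suc assms by (intro P_mtx mtx.row mtx.col)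
    moreover have "(P x a b, P x' a b) \<in> \<theta> (Suc i)" using congruence_refl[OF c(1)] assms by simp
    ultimately show ?case using centD[OF c(2)] assms by fastforce
  qed
  from this[of k] show ?thesis using S by (simp add: central_series_def Id_on_iff)
qed

text \<open>Applying \<open>P\<close> entrywise to the two matrices and the constant matrix
  \<open>w'\<close> gives first row \<open>w'\<close>, \<open>w'\<close> and second row
  \<open>w'\<close>, \<open>w\<close>.\<close>

lemma cent_fourth_entry:
  assumes "congruence Sg A \<theta>" "congruence Sg A \<delta>" "cent Sg A \<theta> \<delta>"
    "mtx Sg A \<theta> x y z w" "mtx Sg A \<theta> x y z w'"
  shows "(w', w) \<in> \<delta>"
proof -
  have "\<theta> \<subseteq> univ A \<times> univ A" using congruence_subset[OF assms(1)] by auto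
  note U = mtx_in[OF alg this]
  have "mtx Sg A \<theta> (P x x w') (P y y w') (P z z w') (P w w' w')"
    using assms(4,5) U by (intro P_mtx mtx.row) auto
  then have "mtx Sg A \<theta> w' w' w' w" using U[OF assms(4)] U[OF assms(5)] by simp
  then show ?thesis using centD[OF assms(3)] congruence_refl[OF assms(2)] U[OF assms(5)] by blast
qed

lemma mtx_rel:
  assumes "congruence Sg A \<theta>" "mtx Sg A \<theta> x y z w"
  shows "(x, y) \<in> \<theta> \<and> (z, w) \<in> \<theta>"
  using assms(2)
proof (induction rule: mtx.induct)
  case (app f xs ys zs ws)
  then show ?case using congruence_interp[OF assms(1)] by blast
qed (use congruence_refl[OF assms(1)] in auto)

context
  fixes B :: "('f, 'b) alg" and \<pi> :: "'a \<Rightarrow> 'b"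
  assumes \<pi>: "hom_onto Sg A B \<pi>"
begin

lemma pi_P:
  assumes "x \<in> univ A" "y \<in> univ A" "z \<in> univ A"
  shows "\<pi> (P x y z) = eval B (tri (\<pi> x) (\<pi> y) (\<pi> z)) q"
  unfolding P_def using hom_onto_eval[OF alg \<pi> tri_vals[OF assms] q_trm] by (simp add: tri_app)

lemma pi_onto: "b \<in> univ B \<Longrightarrow> \<exists>a\<in>univ A. b = \<pi> a"
  using \<pi> by (auto simp: hom_onto_def)

lemma pi_in: "a \<in> univ A \<Longrightarrow> \<pi> a \<in> univ B"
  using \<pi> by (auto simp: hom_onto_def)

text \<open>Transitivity is where the Mal'cev term enters: for (a,b) and (b',c) in \<theta> with
  \<open>b\<close>, \<open>b'\<close> of equal image, the pair of \<open>P a b' b' = a\<close> and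
  \<open>P b b' c\<close> lies in \<theta>, and the latter has the image of
  \<open>c\<close>.\<close>

lemma image_congruence:
  assumes \<theta>: "congruence Sg A \<theta>"
  shows "congruence Sg B (map_prod \<pi> \<pi> ` \<theta>)" (is "congruence Sg B ?\<theta>")
proof (rule congruenceI)
  show "equiv (univ B) ?\<theta>"
  proof (rule equivI)
    show "?\<theta> \<subseteq> univ B \<times> univ B" using congruence_subset[OF \<theta>] pi_in by auto
    show "refl_on (univ B) ?\<theta>" unfolding refl_on_def
      using congruence_refl[OF \<theta>] pi_onto by force
    show "sym ?\<theta>" unfolding sym_def using congruence_sym[OF \<theta>] by force
    show "trans ?\<theta>"
    proof (rule transI)
      fix x y z assume "(x, y) \<in> ?\<theta>" "(y, z) \<in> ?\<theta>"
      then obtain a b b' c where *: "(a, b) \<in> \<theta>" "(b', c) \<in> \<theta>" "x = \<pi> a" "y = \<pi> b" "y = \<pi> b'" "z = \<pi> c" by auto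
      note U = congruence_subset[OF \<theta> *(1)] congruence_subset[OF \<theta> *(2)]
      have B: "malcev Sg B q" by (rule hom_onto_malcev[OF alg \<pi> malc])
      have "(P a b' b', P b b' c) \<in> \<theta>" using * U congruence_refl[OF \<theta>] by (intro P_congruence[OF \<theta>]) auto
      moreover have "\<pi> (P b b' c) = z" using B * U pi_in by (simp add: pi_P malcev_def)
      ultimately show "(x, z) \<in> ?\<theta>" using * U by force
    qed
  qed
  fix f xs ys assume *: "f \<in> syms Sg" "length xs = arity Sg f" "length ys = arity Sg f"
    "\<forall>i<arity Sg f. (xs ! i, ys ! i) \<in> ?\<theta>"
  then have "\<forall>i<arity Sg f. \<exists>u v. (u, v) \<in> \<theta> \<and> xs ! i = \<pi> u \<and> ys ! i = \<pi> v" by fastforce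
  then obtain u v where uv: "\<And>i. i < arity Sg f \<Longrightarrow> (u i, v i) \<in> \<theta> \<and> xs ! i = \<pi> (u i) \<and> ys ! i = \<pi> (v i)" by metis
  let ?us = "map u [0..<arity Sg f]" and ?vs = "map v [0..<arity Sg f]"
  have "xs = map \<pi> ?us" "ys = map \<pi> ?vs" using * uv by (auto intro!: nth_equalityI)
  moreover have "u i \<in> univ A \<and> v i \<in> univ A" if "i < arity Sg f" for i
    using uv[OF that] congruence_subset[OF \<theta>] by blast
  then have "set ?us \<subseteq> univ A" "set ?vs \<subseteq> univ A" by auto
  ultimately have "interp B f xs = \<pi> (interp A f ?us)" "interp B f ys = \<pi> (interp A f ?vs)"
    using hom_onto_interp[OF \<pi> *(1)] by auto
  moreover have "(interp A f ?us, interp A f ?vs) \<in> \<theta>"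
    using uv * by (intro congruence_interp[OF \<theta>]) auto
  ultimately show "(interp B f xs, interp B f ys) \<in> ?\<theta>" by force
qed

lemma mtx_lift:
  assumes "mtx Sg B (map_prod \<pi> \<pi> ` \<theta>) x y z w" and \<theta>: "congruence Sg A \<theta>"
  shows "\<exists>x' y' z' w'. mtx Sg A \<theta> x' y' z' w' \<and> x = \<pi> x' \<and> y = \<pi> y' \<and> z = \<pi> z' \<and> w = \<pi> w'"
proof -
  have \<theta>': "\<theta> \<subseteq> univ A \<times> univ A" using congruence_subset[OF \<theta>] by auto
  show ?thesis using assms(1)
  proof (induction rule: mtx.induct)
    case (row x z)
    then show ?case using pi_onto mtx.row by metis
  next
    case (col x y)
    then show ?case using mtx.col by fastforce
  next
    case (app f xs ys zs ws)
    let ?Q = "\<lambda>i x' y' z' w'. mtx Sg A \<theta> x' y' z' w' \<and> xs ! i = \<pi> x' \<and> ys ! i = \<pi> y' \<and> zs ! i = \<pi> z' \<and> ws ! i = \<pi> w'"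
    have "\<forall>i<arity Sg f. \<exists>x' y' z' w'. ?Q i x' y' z' w'" using app by blast
    then obtain x' y' z' w' where Q: "\<And>i. i < arity Sg f \<Longrightarrow> ?Q i (x' i) (y' i) (z' i) (w' i)" by metis
    let ?m = "\<lambda>g. map g [0..<arity Sg f]"
    have "xs = map \<pi> (?m x')" "ys = map \<pi> (?m y')" "zs = map \<pi> (?m z')" "ws = map \<pi> (?m w')"
      using app Q by (auto intro!: nth_equalityI)
    moreover have "x' i \<in> univ A \<and> y' i \<in> univ A \<and> z' i \<in> univ A \<and> w' i \<in> univ A" if "i < arity Sg f" for i
      using Q[OF that] mtx_in[OF alg] \<theta>' by blast
    then have "set (?m x') \<subseteq> univ A" "set (?m y') \<subseteq> univ A" "set (?m z') \<subseteq> univ A" "set (?m w') \<subseteq> univ A"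
      by auto
    ultimately have "interp B f xs = \<pi> (interp A f (?m x'))" "interp B f ys = \<pi> (interp A f (?m y'))"
      "interp B f zs = \<pi> (interp A f (?m z'))" "interp B f ws = \<pi> (interp A f (?m w'))"
      using hom_onto_interp[OF \<pi> app(1)] by auto
    moreover have "mtx Sg A \<theta> (interp A f (?m x')) (interp A f (?m y')) (interp A f (?m z')) (interp A f (?m w'))"
      using Q app by (intro mtx.app) auto
    ultimately show ?case by blast
  qed
qed

text \<open>A lifted matrix \<open>a b / c' d\<close> has its first row \<delta>-related only after
  projection. Its last entry is therefore replaced by \<open>P c' a b\<close>, which is
  \<delta>-related to \<open>d\<close> by uniqueness of the fourth entry; with a truly
  \<delta>-related pair (a',b') over the same images, \<open>P c' a' b'\<close> has the same image
  and is \<delta>-related to \<open>c'\<close>.\<close>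

lemma image_cent:
  assumes \<theta>: "congruence Sg A \<theta>" and \<delta>: "congruence Sg A \<delta>" and c: "cent Sg A \<theta> \<delta>"
  shows "cent Sg B (map_prod \<pi> \<pi> ` \<theta>) (map_prod \<pi> \<pi> ` \<delta>)" (is "cent Sg B ?\<theta> ?\<delta>")
  unfolding cent_def
proof (intro allI impI)
  fix x y z w assume m: "mtx Sg B ?\<theta> x y z w" and xy: "(x, y) \<in> ?\<delta>"
  have \<delta>': "congruence Sg B ?\<delta>" by (rule image_congruence[OF \<delta>])
  have B: "malcev Sg B q" by (rule hom_onto_malcev[OF alg \<pi> malc])
  obtain a b c' d where *: "mtx Sg A \<theta> a b c' d" "x = \<pi> a" "y = \<pi> b" "z = \<pi> c'" "w = \<pi> d"
    using mtx_lift[OF m \<theta>] by blast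
  have "\<theta> \<subseteq> univ A \<times> univ A" using congruence_subset[OF \<theta>] by auto
  note U = mtx_in[OF alg this *(1)]
  obtain a' b' where ab: "(a', b') \<in> \<delta>" "\<pi> a' = x" "\<pi> b' = y" using xy by auto
  note U' = congruence_subset[OF \<delta> ab(1)]
  have ab\<theta>: "(a, b) \<in> \<theta>" using mtx_rel[OF \<theta> *(1)] by simp
  have "mtx Sg A \<theta> (P a a a) (P a a b) (P c' a a) (P c' a b)"
    using U ab\<theta> by (intro P_mtx mtx.row mtx.col) auto
  then have "mtx Sg A \<theta> a b c' (P c' a b)" using U by simp
  then have 1: "(P c' a b, d) \<in> \<delta>" using cent_fourth_entry[OF \<theta> \<delta> c *(1)] by simp
  have "(P c' a' a', P c' a' b') \<in> \<delta>" using ab U U' congruence_refl[OF \<delta>] by (intro P_congruence[OF \<delta>]) auto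
  then have "(\<pi> (P c' a' a'), \<pi> (P c' a' b')) \<in> ?\<delta>" by force
  moreover have "\<pi> (P c' a' a') = z" "\<pi> (P c' a' b') = \<pi> (P c' a b)" 
  proof -
    show "\<pi> (P c' a' a') = z" using U U' * by simp
    show "\<pi> (P c' a' b') = \<pi> (P c' a b)" using U U' ab * by (simp add: pi_P)
  qed
  moreover have "(\<pi> (P c' a b), w) \<in> ?\<delta>" using 1 * by force
  ultimately show "(z, w) \<in> ?\<delta>" using congruence_trans[OF \<delta>'] by metis
qed

lemma image_central_series:
  assumes "central_series Sg A k \<theta>"
  shows "central_series Sg B k (\<lambda>i. map_prod \<pi> \<pi> ` \<theta> i)"
proof -
  have "map_prod \<pi> \<pi> ` (univ A \<times> univ A) = univ B \<times> univ B"
    using \<pi> by (simp add: hom_onto_def map_prod_surj_on)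
  moreover have "map_prod \<pi> \<pi> ` Id_on (univ A) = Id_on (\<pi> ` univ A)"
    by (auto simp: Id_on_def)
  then have "map_prod \<pi> \<pi> ` Id_on (univ A) = Id_on (univ B)"
    using \<pi> by (simp add: hom_onto_def)
  ultimately show ?thesis using assms image_congruence image_cent by (simp add: central_series_def)
qed

end

end

section \<open>The difference group of a central congruence\<close>

locale central_congruence = malcev_algebra Sg A q
  for Sg :: "'f signature" and A :: "('f, 'a) alg" and q :: "'f trm" +
  fixes \<zeta> :: "('a \<times> 'a) set" and e :: 'a
  assumes fin: "finite (univ A)" and \<zeta>: "congruence Sg A \<zeta>"
    and central: "cent Sg A \<zeta> (Id_on (univ A))" and e: "e \<in> univ A"
begin

text \<open>\<open>D x y\<close> stands for the difference \<open>x - y\<close>, transported into the class of \<open>e\<close>; \<open>L f k\<close> below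
  is the linear part of the operation \<open>f\<close> in its \<open>k\<close>-th argument.\<close>

definition D :: "'a \<Rightarrow> 'a \<Rightarrow> 'a" where "D x y = P x y e"

text \<open>The class of \<open>e\<close> with addition \<open>v - e + w\<close>.\<close>

definition G :: "'a monoid" where
  "G = \<lparr>carrier = {v. (v, e) \<in> \<zeta>}, mult = (\<lambda>v w. P v e w), one = e\<rparr>"

lemma G_simps [simp]: "v \<in> carrier G \<longleftrightarrow> (v, e) \<in> \<zeta>" "v \<otimes>\<^bsub>G\<^esub> w = P v e w" "\<one>\<^bsub>G\<^esub> = e"
  by (auto simp: G_def)

lemma U: "(x, y) \<in> \<zeta> \<Longrightarrow> x \<in> univ A" "(x, y) \<in> \<zeta> \<Longrightarrow> y \<in> univ A"
  using congruence_subset[OF \<zeta>] by auto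

lemma mtx_U:
  assumes "mtx Sg A \<zeta> x y z w"
  shows "x \<in> univ A" "y \<in> univ A" "z \<in> univ A" "w \<in> univ A"
proof -
  have "\<zeta> \<subseteq> univ A \<times> univ A" using U by auto
  then show "x \<in> univ A" "y \<in> univ A" "z \<in> univ A" "w \<in> univ A"
    using mtx_in[OF alg _ assms] by auto
qed

lemma mtx_eq: "mtx Sg A \<zeta> x x z w \<Longrightarrow> z = w"
  using centD[OF central, of x x z w] mtx_U[of x x z w] by (auto simp: Id_on_iff)

lemma mtx_unique: "mtx Sg A \<zeta> x y z w \<Longrightarrow> mtx Sg A \<zeta> x y z w' \<Longrightarrow> w = w'"
  using cent_fourth_entry[OF \<zeta> congruence_Id[OF alg] central, of x y z w' w] by (auto simp: Id_on_iff)

lemma \<zeta>_refl: "x \<in> univ A \<Longrightarrow> (x, x) \<in> \<zeta>" by (rule congruence_refl[OF \<zeta>])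
lemma \<zeta>_sym: "(x, y) \<in> \<zeta> \<Longrightarrow> (y, x) \<in> \<zeta>" by (rule congruence_sym[OF \<zeta>])

lemma D_self [simp]: "x \<in> univ A \<Longrightarrow> D x x = e"
  using e by (simp add: D_def)

lemma D_in: "(x, y) \<in> \<zeta> \<Longrightarrow> (D x y, e) \<in> \<zeta>"
  using P_congruence[OF \<zeta>, of x y y y e e] \<zeta>_refl U[of x y] e by (simp add: D_def)

text \<open>From the matrix of differences \<open>D x y\<close>, \<open>e\<close> over
  \<open>D z w\<close>, \<open>e\<close>, the matrix with both rows \<open>D x y\<close>,
  \<open>e\<close> is subtracted. The first row becomes constant, so by centrality the second row
  does too.\<close>

lemma D_mtx:
  assumes "mtx Sg A \<zeta> x y z w"
  shows "D x y = D z w"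
proof -
  note V = mtx_U[OF assms]
  have r: "(x, y) \<in> \<zeta>" using mtx_rel[OF \<zeta> assms] by simp
  note De = D_in[OF r]
  have "mtx Sg A \<zeta> (P x y e) (P y y e) (P z w e) (P w w e)"
    using assms V e by (intro P_mtx mtx.row)
  then have "mtx Sg A \<zeta> (D x y) e (D z w) e" using V e by (simp add: D_def)
  moreover have "mtx Sg A \<zeta> (D x y) e (D x y) e" using De by (rule mtx.col)
  ultimately have "mtx Sg A \<zeta> (P (D x y) (D x y) (D x y)) (P e e (D x y)) (P (D z w) (D x y) (D x y)) (P e e (D x y))"
    using U[OF De] by (intro P_mtx mtx.row)
  moreover have "D z w \<in> univ A" using V e by (simp add: D_def)
  ultimately have "mtx Sg A \<zeta> (D x y) (D x y) (D z w) (D x y)" using U[OF De] by simp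
  then show ?thesis using mtx_eq by metis
qed

lemma D_inj:
  assumes "(x, y) \<in> \<zeta>" "(x', y) \<in> \<zeta>" "D x y = D x' y"
  shows "x = x'"
proof -
  have xx: "(x, x') \<in> \<zeta>" using congruence_trans[OF \<zeta> assms(1) \<zeta>_sym[OF assms(2)]] .
  have "mtx Sg A \<zeta> (P x y e) (P x' y e) (P x y y) (P x' y y)"
    using assms U e xx by (intro P_mtx mtx.row mtx.col) auto
  then have "mtx Sg A \<zeta> (D x y) (D x y) x x'" using assms U by (simp add: D_def)
  then show ?thesis by (rule mtx_eq)
qed

text \<open>\<open>P v e x\<close> is the translate of \<open>x\<close> by \<open>v\<close>: it
  differs from \<open>x\<close> as \<open>v\<close> differs from \<open>e\<close>.\<close>

lemma mtx_translate:
  assumes "(v, e) \<in> \<zeta>" "x \<in> univ A"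
  shows "mtx Sg A \<zeta> v e (P v e x) x"
proof -
  have "mtx Sg A \<zeta> (P v e e) (P e e e) (P v e x) (P e e x)"
    using assms e by (intro P_mtx mtx.row mtx.col)
  then show ?thesis using assms U e by simp
qed

lemma D_e: "(v, e) \<in> \<zeta> \<Longrightarrow> D v e = v"
  using U e by (simp add: D_def)

lemma D_translate: "(v, e) \<in> \<zeta> \<Longrightarrow> x \<in> univ A \<Longrightarrow> D (P v e x) x = v"
  using D_mtx[OF mtx_translate] D_e by metis

lemma translate_rel: "(v, e) \<in> \<zeta> \<Longrightarrow> x \<in> univ A \<Longrightarrow> (P v e x, x) \<in> \<zeta>"
  using mtx_rel[OF \<zeta> mtx_translate] by blast

text \<open>For commutativity, associativity and inverses, both sides are fourth entries of matrices
  that share the other three entries. The inverse of \<open>x\<close> is \<open>P e x e\<close>, the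
  difference \<open>e - x\<close>.\<close>

lemma comm_group_G: "comm_group G"
proof (rule comm_groupI)
  show "x \<otimes>\<^bsub>G\<^esub> y \<in> carrier G" if "x \<in> carrier G" "y \<in> carrier G" for x y
    using that congruence_trans[OF \<zeta> translate_rel[of x y]] U[of y e] by simp
  show "\<one>\<^bsub>G\<^esub> \<in> carrier G" using \<zeta>_refl e by simp
  show "\<one>\<^bsub>G\<^esub> \<otimes>\<^bsub>G\<^esub> x = x" if "x \<in> carrier G" for x using that U e by simp
  show "x \<otimes>\<^bsub>G\<^esub> y = y \<otimes>\<^bsub>G\<^esub> x" if "x \<in> carrier G" "y \<in> carrier G" for x y
  proof -
    have xy: "(e, y) \<in> \<zeta>" "x \<in> univ A" "y \<in> univ A" using that U \<zeta>_sym by auto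
    have "mtx Sg A \<zeta> (P e e e) (P e e y) (P x e e) (P x e y)"
      "mtx Sg A \<zeta> (P e e e) (P y e e) (P e e x) (P y e x)"
      using xy e by - (rule P_mtx | (rule mtx.row, assumption+) | (rule mtx.col, assumption))+
    then have "mtx Sg A \<zeta> e y x (P x e y)" "mtx Sg A \<zeta> e y x (P y e x)" using xy e by simp_all
    then show ?thesis using mtx_unique by (metis G_simps(2))
  qed
  show "x \<otimes>\<^bsub>G\<^esub> y \<otimes>\<^bsub>G\<^esub> z = x \<otimes>\<^bsub>G\<^esub> (y \<otimes>\<^bsub>G\<^esub> z)"
    if "x \<in> carrier G" "y \<in> carrier G" "z \<in> carrier G" for x y z
  proof -
    have xyz: "(e, z) \<in> \<zeta>" "x \<in> univ A" "y \<in> univ A" "z \<in> univ A" using that U \<zeta>_sym by auto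
    have "mtx Sg A \<zeta> (P (P e e y) e e) (P (P e e y) e z) (P (P x e y) e e) (P (P x e y) e z)"
      "mtx Sg A \<zeta> (P e e (P y e e)) (P e e (P y e z)) (P x e (P y e e)) (P x e (P y e z))"
      using xyz e by - (rule P_mtx | (rule mtx.row, assumption+) | (rule mtx.col, assumption))+
    then have "mtx Sg A \<zeta> y (P y e z) (P x e y) (P (P x e y) e z)"
      "mtx Sg A \<zeta> y (P y e z) (P x e y) (P x e (P y e z))"
      using xyz e by simp_all
    then show ?thesis using mtx_unique by (metis G_simps(2))
  qed
  show "\<exists>y\<in>carrier G. y \<otimes>\<^bsub>G\<^esub> x = \<one>\<^bsub>G\<^esub>" if "x \<in> carrier G" for x
  proof
    have x: "x \<in> univ A" "(x, e) \<in> \<zeta>" "(e, x) \<in> \<zeta>" using that U \<zeta>_sym by auto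
    show "P e x e \<in> carrier G" using D_in[OF x(3)] by (simp add: D_def)
    have "mtx Sg A \<zeta> (P (P e e e) e e) (P (P e x e) e e) (P (P e e e) e x) (P (P e x e) e x)"
      "mtx Sg A \<zeta> (P e e e) (P e x e) (P x e e) (P x x e)"
      using x e by - (rule P_mtx | (rule mtx.row, assumption+) | (rule mtx.col, assumption))+
    then have "mtx Sg A \<zeta> e (P e x e) x (P (P e x e) e x)" "mtx Sg A \<zeta> e (P e x e) x e"
      using x e by simp_all
    then show "P e x e \<otimes>\<^bsub>G\<^esub> x = \<one>\<^bsub>G\<^esub>" using mtx_unique by (metis G_simps(2,3))
  qed
qed

sublocale G: comm_group G by (rule comm_group_G)

lemma finite_G: "finite (carrier G)"
  by (rule finite_subset[OF _ fin]) (use U in auto)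

text \<open>Again two matrices with three common entries: one moves \<open>y\<close> to
  \<open>z\<close> in the subtrahend, the other adds \<open>D y z\<close> in the group.\<close>

lemma D_add:
  assumes "(x, y) \<in> \<zeta>" "(y, z) \<in> \<zeta>"
  shows "D x z = D x y \<otimes>\<^bsub>G\<^esub> D y z"
proof -
  have V: "x \<in> univ A" "y \<in> univ A" "z \<in> univ A" "D x y \<in> univ A" "D y z \<in> univ A"
    using U assms D_in[OF assms(1)] D_in[OF assms(2)] by blast+
  have eD: "(e, D y z) \<in> \<zeta>" using D_in \<zeta>_sym assms by blast
  have "mtx Sg A \<zeta> (P y y e) (P y z e) (P x y e) (P x z e)"
    "mtx Sg A \<zeta> (P e e e) (P e e (D y z)) (P (D x y) e e) (P (D x y) e (D y z))"
    using assms V e eD by - (rule P_mtx | (rule mtx.row, assumption+) | (rule mtx.col, assumption))+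
  then have "mtx Sg A \<zeta> e (D y z) (D x y) (D x z)"
    "mtx Sg A \<zeta> e (D y z) (D x y) (P (D x y) e (D y z))"
    using V e by (simp_all add: D_e[OF D_in[OF assms(1)]] flip: D_def)
  then show ?thesis using mtx_unique by (metis G_simps(2))
qed

section \<open>Linear parts of the fundamental operations\<close>

definition L :: "'f \<Rightarrow> nat \<Rightarrow> 'a \<Rightarrow> 'a" where
  "L f k v = D (interp A f ((replicate (arity Sg f) e)[k := v])) (interp A f (replicate (arity Sg f) e))"

text \<open>Centrality makes the effect of changing one argument independent of the other arguments:
  in the matrix the first row has the surroundings \<open>zs\<close>, the second the surroundings
  \<open>e\<close>, and the changed argument runs from \<open>x\<close> to \<open>y\<close> or from
  \<open>e\<close> to \<open>D y x\<close>.\<close>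

lemma D_interp_update:
  assumes "f \<in> syms Sg" "length zs = arity Sg f" "set zs \<subseteq> univ A" "k < arity Sg f" "(y, x) \<in> \<zeta>"
  shows "D (interp A f (zs[k := y])) (interp A f (zs[k := x])) = L f k (D y x)"
    "(interp A f (zs[k := y]), interp A f (zs[k := x])) \<in> \<zeta>"
proof -
  have xy: "x \<in> univ A" "y \<in> univ A" using U assms by auto
  have "mtx Sg A \<zeta> (P y e e) (P x e e) (P y x e) (P x x e)"
    using assms xy e by (intro P_mtx mtx.row mtx.col)
  then have *: "mtx Sg A \<zeta> y x (D y x) e" using xy e by (simp add: D_def)
  have "mtx Sg A \<zeta> (interp A f (zs[k := y])) (interp A f (zs[k := x]))
     (interp A f ((replicate (arity Sg f) e)[k := D y x])) (interp A f ((replicate (arity Sg f) e)[k := e]))"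
    using assms e * by (intro mtx.app) (auto simp: nth_list_update subset_iff intro!: mtx.row)
  moreover have "(replicate (arity Sg f) e)[k := e] = replicate (arity Sg f) e"
    by (cases "k < arity Sg f") (simp_all add: list_update_same_conv list_update_beyond)
  ultimately have m: "mtx Sg A \<zeta> (interp A f (zs[k := y])) (interp A f (zs[k := x]))
     (interp A f ((replicate (arity Sg f) e)[k := D y x])) (interp A f (replicate (arity Sg f) e))" by simp
  show "D (interp A f (zs[k := y])) (interp A f (zs[k := x])) = L f k (D y x)"
    using D_mtx[OF m] by (simp add: L_def)
  show "(interp A f (zs[k := y]), interp A f (zs[k := x])) \<in> \<zeta>" using mtx_rel[OF \<zeta> m] by simp
qed

text \<open>Pass from \<open>v + w\<close> to \<open>w\<close> and then to \<open>e\<close> in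
  argument \<open>k\<close> and add the two differences; the first of them is
  \<open>L f k v\<close>, although it is taken at \<open>w\<close> and not at
  \<open>e\<close>.\<close>

lemma L_hom:
  assumes "f \<in> syms Sg" "k < arity Sg f"
  shows "L f k \<in> hom G G"
proof (rule homI)
  let ?r = "replicate (arity Sg f) e"
  have r: "length ?r = arity Sg f" "set ?r \<subseteq> univ A" using e by auto
  have re: "?r[k := e] = ?r" by (cases "k < arity Sg f") (simp_all add: list_update_same_conv list_update_beyond)
  show "L f k v \<in> carrier G" if "v \<in> carrier G" for v
    using D_in[OF D_interp_update(2)[OF assms(1) r assms(2), of v e]] that by (simp add: L_def re)
  fix v w assume "v \<in> carrier G" "w \<in> carrier G"
  then have vw: "(v, e) \<in> \<zeta>" "(w, e) \<in> \<zeta>" "w \<in> univ A" using U by auto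
  note t = translate_rel[OF vw(1,3)]
  have "L f k (P v e w) = D (interp A f (?r[k := P v e w])) (interp A f (?r[k := w])) \<otimes>\<^bsub>G\<^esub> L f k w"
    unfolding L_def
    using D_add[OF D_interp_update(2)[OF assms(1) r assms(2) t] D_interp_update(2)[OF assms(1) r assms(2) vw(2)]]
    by (simp only: re)
  also have "D (interp A f (?r[k := P v e w])) (interp A f (?r[k := w])) = L f k v"
    using D_interp_update(1)[OF assms(1) r assms(2) t] D_translate vw by simp
  finally show "L f k (v \<otimes>\<^bsub>G\<^esub> w) = L f k v \<otimes>\<^bsub>G\<^esub> L f k w" by simp
qed

text \<open>Pass from \<open>xs\<close> to \<open>ys\<close> one coordinate at a time.\<close>

lemma interp_hybrid:
  assumes f: "f \<in> syms Sg" and l: "length xs = arity Sg f" "length ys = arity Sg f"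
    and rel: "\<forall>i<arity Sg f. (ys ! i, xs ! i) \<in> \<zeta>" and k: "k < arity Sg f"
  shows "D (interp A f (take (Suc k) ys @ drop (Suc k) xs)) (interp A f (take k ys @ drop k xs)) = L f k (D (ys ! k) (xs ! k))"
    "(interp A f (take (Suc k) ys @ drop (Suc k) xs), interp A f (take k ys @ drop k xs)) \<in> \<zeta>"
proof -
  let ?z = "take k ys @ drop k xs"
  have "set xs \<subseteq> univ A" "set ys \<subseteq> univ A"
    using rel l U unfolding subset_iff in_set_conv_nth by metis+
  then have z: "length ?z = arity Sg f" "set ?z \<subseteq> univ A" using l k
    by (auto dest: in_set_takeD in_set_dropD)
  have "?z[k := xs ! k] = ?z" "?z[k := ys ! k] = take (Suc k) ys @ drop (Suc k) xs"
    using l k by (auto intro!: nth_equalityI simp: nth_list_update nth_append)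
  then show "D (interp A f (take (Suc k) ys @ drop (Suc k) xs)) (interp A f (take k ys @ drop k xs)) = L f k (D (ys ! k) (xs ! k))"
    "(interp A f (take (Suc k) ys @ drop (Suc k) xs), interp A f (take k ys @ drop k xs)) \<in> \<zeta>"
    using D_interp_update[OF f z k, of "ys ! k" "xs ! k"] rel k by auto
qed

text \<open>The differences of consecutive hybrids telescope, and each of them is a value of
  \<open>L\<close>. The invariant subgroup \<open>S\<close> is carried along because \<chi> is
  additive only there; the constant \<chi> = 0 yields the congruence property of
  \<open>sub_cong S\<close>.\<close>

lemma D_interp_sum:
  fixes \<chi> :: "'a \<Rightarrow> int"
  assumes f: "f \<in> syms Sg" and l: "length xs = arity Sg f" "length ys = arity Sg f"
    and S: "subgroup S G" and LS: "\<And>k v. k < arity Sg f \<Longrightarrow> v \<in> S \<Longrightarrow> L f k v \<in> S"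
    and rel: "\<forall>i<arity Sg f. (ys ! i, xs ! i) \<in> \<zeta> \<and> D (ys ! i) (xs ! i) \<in> S"
    and \<chi>: "\<And>v w. v \<in> S \<Longrightarrow> w \<in> S \<Longrightarrow> [\<chi> (v \<otimes>\<^bsub>G\<^esub> w) = \<chi> v + \<chi> w] (mod p)"
  shows "(interp A f ys, interp A f xs) \<in> \<zeta>" "D (interp A f ys) (interp A f xs) \<in> S"
    "[\<chi> (D (interp A f ys) (interp A f xs)) = (\<Sum>k<arity Sg f. \<chi> (L f k (D (ys ! k) (xs ! k))))] (mod p)"
proof -
  let ?z = "\<lambda>k. interp A f (take k ys @ drop k xs)"
  have rel': "\<forall>i<arity Sg f. (ys ! i, xs ! i) \<in> \<zeta>" using rel by simp
  have x: "interp A f xs \<in> univ A"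
    by (rule interp_in[OF alg f l(1)]) (use rel l U in \<open>unfold subset_iff in_set_conv_nth, metis\<close>)
  have eS: "e \<in> S" using subgroup.one_closed[OF S] by simp
  have \<chi>e: "[\<chi> e = 0] (mod p)"
  proof -
    have "[\<chi> e + 0 = \<chi> e + \<chi> e] (mod p)" using \<chi>[OF eS eS] e by simp
    then have "[0 = \<chi> e] (mod p)" unfolding cong_add_lcancel .
    then show ?thesis by (rule cong_sym)
  qed
  have "(?z k, interp A f xs) \<in> \<zeta> \<and> D (?z k) (interp A f xs) \<in> S \<and>
     [\<chi> (D (?z k) (interp A f xs)) = (\<Sum>k<k. \<chi> (L f k (D (ys ! k) (xs ! k))))] (mod p)"
    if "k \<le> arity Sg f" for k
    using that
  proof (induction k)
    case 0
    then show ?case using x \<zeta>_refl eS \<chi>e by simp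
  next
    case (Suc k)
    then have k: "k < arity Sg f" by simp
    note h = interp_hybrid[OF f l rel' k]
    have IH: "(?z k, interp A f xs) \<in> \<zeta>" "D (?z k) (interp A f xs) \<in> S"
      "[\<chi> (D (?z k) (interp A f xs)) = (\<Sum>k<k. \<chi> (L f k (D (ys ! k) (xs ! k))))] (mod p)"
      using Suc by auto
    have a: "D (?z (Suc k)) (interp A f xs) = L f k (D (ys ! k) (xs ! k)) \<otimes>\<^bsub>G\<^esub> D (?z k) (interp A f xs)"
      using D_add[OF h(2) IH(1)] h(1) by simp
    have b: "L f k (D (ys ! k) (xs ! k)) \<in> S" using LS k rel by simp
    have "D (?z (Suc k)) (interp A f xs) \<in> S" unfolding a using subgroup.m_closed[OF S b IH(2)] .
    moreover have "[\<chi> (D (?z (Suc k)) (interp A f xs)) =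
       \<chi> (L f k (D (ys ! k) (xs ! k))) + (\<Sum>k<k. \<chi> (L f k (D (ys ! k) (xs ! k))))] (mod p)"
      unfolding a using cong_trans[OF \<chi>[OF b IH(2)] cong_add[OF cong_refl IH(3)]] .
    ultimately show ?case using congruence_trans[OF \<zeta> h(2) IH(1)] by (simp add: add.commute)
  qed
  from this[of "arity Sg f"] show "(interp A f ys, interp A f xs) \<in> \<zeta>" "D (interp A f ys) (interp A f xs) \<in> S"
    "[\<chi> (D (interp A f ys) (interp A f xs)) = (\<Sum>k<arity Sg f. \<chi> (L f k (D (ys ! k) (xs ! k))))] (mod p)"
    using l by auto
qed

section \<open>The congruence belonging to an invariant subgroup\<close>

definition sub_cong :: "'a set \<Rightarrow> ('a \<times> 'a) set" where
  "sub_cong S = {(x, y) \<in> \<zeta>. D x y \<in> S}"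

lemma sub_cong_congruence:
  assumes S: "subgroup S G" and LS: "\<And>f k v. f \<in> syms Sg \<Longrightarrow> k < arity Sg f \<Longrightarrow> v \<in> S \<Longrightarrow> L f k v \<in> S"
  shows "congruence Sg A (sub_cong S)"
proof (rule congruenceI)
  show "equiv (univ A) (sub_cong S)"
  proof (rule equivI)
    show "sub_cong S \<subseteq> univ A \<times> univ A" using U by (auto simp: sub_cong_def)
    show "refl_on (univ A) (sub_cong S)"
      using \<zeta>_refl subgroup.one_closed[OF S] by (auto simp: refl_on_def sub_cong_def)
    show "sym (sub_cong S)"
    proof (rule symI)
      fix x y assume "(x, y) \<in> sub_cong S"
      then have xy: "(x, y) \<in> \<zeta>" "D x y \<in> S" by (auto simp: sub_cong_def)
      have "D y x \<otimes>\<^bsub>G\<^esub> D x y = \<one>\<^bsub>G\<^esub>" using D_add[OF \<zeta>_sym[OF xy(1)] xy(1)] U(2)[OF xy(1)] by simp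
      then have "D y x = inv\<^bsub>G\<^esub> D x y"
        using D_in[OF xy(1)] D_in[OF \<zeta>_sym[OF xy(1)]] by (intro G.inv_equality[symmetric]) auto
      then show "(y, x) \<in> sub_cong S"
        using subgroup.m_inv_closed[OF S xy(2)] \<zeta>_sym[OF xy(1)] by (simp add: sub_cong_def)
    qed
    show "trans (sub_cong S)"
    proof (rule transI)
      fix x y z assume "(x, y) \<in> sub_cong S" "(y, z) \<in> sub_cong S"
      then show "(x, z) \<in> sub_cong S"
        using D_add subgroup.m_closed[OF S] congruence_trans[OF \<zeta>] by (auto simp: sub_cong_def)
    qed
  qed
  fix f xs ys assume *: "f \<in> syms Sg" "length xs = arity Sg f" "length ys = arity Sg f"
    "\<forall>i<arity Sg f. (xs ! i, ys ! i) \<in> sub_cong S"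
  then show "(interp A f xs, interp A f ys) \<in> sub_cong S"
    using D_interp_sum(1,2)[OF *(1,3,2) S LS[OF *(1)], of "\<lambda>_. 0" 0] by (simp add: sub_cong_def)
qed

text \<open>Every class of \<open>sub_cong S\<close> is a translate of \<open>S\<close>.\<close>

lemma card_sub_cong:
  assumes S: "subgroup S G" and E: "congruence Sg A (sub_cong S)"
  shows "card (univ A) = card S * card (univ A // sub_cong S)"
proof -
  let ?R = "sub_cong S"
  have eq: "equiv (univ A) ?R" using E by (rule congruence_equiv)
  have "card X = card S" if XR: "X \<in> univ A // ?R" for X
  proof -
    obtain x where x: "x \<in> univ A" "X = ?R `` {x}" using XR unfolding quotient_def by blast
    have X: "y \<in> X \<longleftrightarrow> (y, x) \<in> \<zeta> \<and> D y x \<in> S" for y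
    proof -
      have "y \<in> X \<longleftrightarrow> (y, x) \<in> ?R" unfolding x(2) using congruence_sym[OF E] by blast
      then show ?thesis by (simp add: sub_cong_def)
    qed
    have "bij_betw (\<lambda>y. D y x) X S"
      unfolding bij_betw_def
    proof
      show "inj_on (\<lambda>y. D y x) X" unfolding inj_on_def using X D_inj by blast
      show "(\<lambda>y. D y x) ` X = S"
      proof
        show "(\<lambda>y. D y x) ` X \<subseteq> S" using X by auto
        show "S \<subseteq> (\<lambda>y. D y x) ` X"
        proof
          fix v assume v: "v \<in> S"
          then have "(v, e) \<in> \<zeta>" using subgroup.subset[OF S] by auto
          then have "D (P v e x) x = v" "(P v e x, x) \<in> \<zeta>"
            using D_translate translate_rel x by auto
          then show "v \<in> (\<lambda>y. D y x) ` X" using v X by force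
        qed
      qed
    qed
    then show ?thesis by (rule bij_betw_same_card)
  qed
  moreover have "finite (univ A // ?R)" by (rule finite_quotient[OF fin])
      (use congruence_subset[OF E] in auto)
  moreover have "X \<inter> Y = {}" if "X \<in> univ A // ?R" "Y \<in> univ A // ?R" "X \<noteq> Y" for X Y
    using quotient_disj[OF eq that(1,2)] that(3) by blast
  ultimately have "card S * card (univ A // ?R) = card (\<Union>(univ A // ?R))"
    using fin by (intro card_partition) (simp_all add: Union_quotient[OF eq])
  then show ?thesis by (simp add: Union_quotient[OF eq])
qed

end

section \<open>Characters of elementary abelian groups\<close>

lemma (in monoid) nat_pow_one': "x \<in> carrier G \<Longrightarrow> x [^] (1::nat) = x"
  by simp

lemma (in group) nat_pow_mod_exponent:
  assumes "x \<in> carrier G" "x [^] (p::nat) = \<one>"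
  shows "x [^] (n mod p) = x [^] n"
proof -
  have "x [^] n = x [^] (p * (n div p) + n mod p)" by simp
  also have "\<dots> = (x [^] p) [^] (n div p) \<otimes> x [^] (n mod p)"
    using assms(1) by (simp only: nat_pow_mult[symmetric] nat_pow_pow)
  finally show ?thesis using assms by simp
qed

text \<open>Modulo \<open>p\<close> the exponent \<open>m\<close> has an inverse \<open>k\<close>,
  so \<open>w\<close> is the power \<open>k\<close> of an element of \<open>H\<close>.\<close>

lemma (in group) pow_prime_not_dvd:
  assumes H: "subgroup H G" and w: "w \<in> carrier G" "w [^] (p::nat) = \<one>" and p: "prime p"
    and m: "\<not> p dvd m" "w [^] m \<in> H"
  shows "w \<in> H"
proof -
  have "coprime m p" using p m(1) by (metis coprime_commute prime_imp_coprime)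
  then obtain k where "[m * k = Suc 0] (mod p)" using cong_solve_coprime_nat by blast
  then have "(m * k) mod p = 1 mod p" by (simp add: cong_def)
  then have "w [^] (m * k) = w" by (metis nat_pow_mod_exponent[OF w] nat_pow_one' w(1))
  moreover have "(w [^] m) [^] k \<in> H"
    using m(2) by (induction k) (auto intro: subgroup.one_closed[OF H] subgroup.m_closed[OF H])
  ultimately show ?thesis using nat_pow_pow[OF w(1)] by simp
qed

lemma (in comm_group) mult_inv_cancel:
  assumes "v \<in> carrier G" "x \<in> carrier G" "y \<in> carrier G"
  shows "(v \<otimes> x) \<otimes> inv (v \<otimes> y) = x \<otimes> inv y"
proof -
  have "(v \<otimes> x) \<otimes> inv (v \<otimes> y) = (x \<otimes> v) \<otimes> (inv v \<otimes> inv y)"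
    using assms by (simp only: inv_mult m_comm)
  also have "\<dots> = x \<otimes> ((v \<otimes> inv v) \<otimes> inv y)"
    using assms by (simp only: m_assoc inv_closed m_closed)
  finally show ?thesis using assms by simp
qed

text \<open>For a subgroup \<open>H\<close> maximal among those avoiding \<open>w\<close>, the
  quotient by \<open>H\<close> is cyclic of order \<open>p\<close>, generated by \<open>w\<close>.
  The coordinate along \<open>w\<close> is the character.\<close>

lemma (in comm_group) separating_character:
  assumes fin: "finite (carrier G)" and p: "prime p" and ex: "\<And>x. x \<in> carrier G \<Longrightarrow> x [^] (p::nat) = \<one>"
    and w: "w \<in> carrier G" "w \<noteq> \<one>"
  obtains \<chi> :: "'a \<Rightarrow> int" where
    "\<And>x y. x \<in> carrier G \<Longrightarrow> y \<in> carrier G \<Longrightarrow> [\<chi> (x \<otimes> y) = \<chi> x + \<chi> y] (mod int p)"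
    "\<not> [\<chi> w = 0] (mod int p)"
proof -
  have p1: "p \<ge> 1" using p prime_ge_1_nat by blast
  \<comment> \<open>Inverses become powers with natural exponents, so that exponents can be compared
    modulo \<open>p\<close>.\<close>
  have inv_pow: "inv (x [^] k) = x [^] ((p - 1) * k)" if "x \<in> carrier G" for x and k :: nat
  proof -
    have "p * k = (p - 1) * k + k" using p1 by (metis add.commute add_mult_distrib le_add_diff_inverse mult_1)
    moreover have "x [^] (p * k) = \<one>" using ex[OF that] that by (simp flip: nat_pow_pow)
    ultimately have "x [^] ((p - 1) * k) \<otimes> x [^] k = \<one>" using that by (metis nat_pow_mult)
    then show ?thesis using that by (intro inv_equality) auto
  qed
  define M where "M = {H. subgroup H G \<and> w \<notin> H}"
  have "finite M" by (rule finite_subset[of _ "Pow (carrier G)"]) (use fin in \<open>auto simp: M_def dest: subgroup.subset\<close>)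
  moreover have "{\<one>} \<in> M" using w triv_subgroup by (auto simp: M_def)
  ultimately obtain H where "H \<in> M" and Hmax: "\<And>K. K \<in> M \<Longrightarrow> H \<subseteq> K \<Longrightarrow> H = K"
    using finite_has_maximal[of M] by blast
  then have H: "subgroup H G" "w \<notin> H" by (auto simp: M_def)
  note Hc = subgroup.mem_carrier[OF H(1)]
  have H_pow: "h [^] k \<in> H" if "h \<in> H" for h and k :: nat
    using that by (induction k) (auto intro: subgroup.one_closed[OF H(1)] subgroup.m_closed[OF H(1)])
  \<comment> \<open>If \<open>v\<close> is outside \<open>H\<close>, maximality puts
    \<open>w\<close> into the subgroup generated by \<open>H\<close> and \<open>v\<close>. In
    \<open>w = h v^j\<close> the exponent \<open>j\<close> is invertible modulo \<open>p\<close>,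
    which expresses \<open>v\<close> through \<open>H\<close> and \<open>w\<close>.\<close>
  have key: "\<exists>k::nat. v \<otimes> w [^] k \<in> H" if v: "v \<in> carrier G" for v
  proof (cases "v \<in> H")
    case True
    then show ?thesis using v by (intro exI[of _ 0]) simp
  next
    case False
    define K where "K = {h \<otimes> v [^] j | h j. h \<in> H \<and> (j::nat) \<in> UNIV}"
    have "subgroup K G"
    proof (rule subgroupI)
      show "K \<subseteq> carrier G" using Hc v by (auto simp: K_def)
      show "K \<noteq> {}" using subgroup.one_closed[OF H(1)] by (auto simp: K_def)
      fix a b assume "a \<in> K" "b \<in> K"
      then obtain h i g j where *: "a = h \<otimes> v [^] (i::nat)" "b = g \<otimes> v [^] (j::nat)" "h \<in> H" "g \<in> H"
        by (auto simp: K_def)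
      have "inv a = inv h \<otimes> v [^] ((p - 1) * i)"
        using * v Hc by (simp add: inv_mult inv_pow)
      then show "inv a \<in> K" using subgroup.m_inv_closed[OF H(1) *(3)] by (auto simp: K_def)
      have "a \<otimes> b = (h \<otimes> g) \<otimes> v [^] (i + j)"
        using * v Hc by (simp add: nat_pow_mult[symmetric] m_ac)
      then show "a \<otimes> b \<in> K" using subgroup.m_closed[OF H(1) *(3,4)] by (auto simp: K_def)
    qed
    moreover have "H \<subseteq> K"
    proof
      fix h assume "h \<in> H"
      then have "h = h \<otimes> v [^] (0::nat)" using Hc by simp
      then show "h \<in> K" using \<open>h \<in> H\<close> unfolding K_def by blast
    qed
    moreover have "v \<in> K"
    proof -
      have "v = \<one> \<otimes> v [^] (1::nat)" using v by simp
      then show ?thesis using subgroup.one_closed[OF H(1)] unfolding K_def by blast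
    qed
    ultimately have "w \<in> K" using Hmax[of K] False by (auto simp: M_def)
    then obtain h j where hj: "h \<in> H" "w = h \<otimes> v [^] (j::nat)" by (auto simp: K_def)
    have "\<not> p dvd j"
    proof
      assume "p dvd j"
      then have "v [^] j = \<one>" using ex[OF v] v by (auto simp: nat_pow_pow[symmetric] elim!: dvdE)
      then show False using hj H(2) Hc by simp
    qed
    then have "coprime j p" using p by (metis coprime_commute prime_imp_coprime)
    then obtain k where "[j * k = Suc 0] (mod p)" using cong_solve_coprime_nat by blast
    then have "(j * k) mod p = 1 mod p" by (simp add: cong_def)
    then have vjk: "v [^] (j * k) = v" by (metis nat_pow_mod_exponent[OF v ex[OF v]] nat_pow_one' v)
    have "w [^] k = h [^] k \<otimes> v"
      using hj Hc v by (simp add: nat_pow_distrib nat_pow_pow vjk)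
    then have "v \<otimes> w [^] ((p - 1) * k) = v \<otimes> (inv (h [^] k) \<otimes> inv v)"
      using inv_pow[OF w(1), of k] Hc hj v by (simp add: inv_mult)
    also have "\<dots> = (v \<otimes> inv v) \<otimes> inv (h [^] k)"
      using Hc[OF hj(1)] v by (metis inv_closed m_assoc m_comm nat_pow_closed)
    also have "\<dots> = inv (h [^] k)" using Hc hj v by simp
    also have "\<dots> \<in> H" using subgroup.m_inv_closed[OF H(1)] H_pow hj by blast
    finally show ?thesis by blast
  qed
  \<comment> \<open>Two exponents that both bring \<open>v\<close> into \<open>H\<close> differ by
    one that brings \<open>w\<close> into \<open>H\<close>, hence by a multiple of
    \<open>p\<close>.\<close>
  have uniq: "[int k = int l] (mod int p)" if "v \<in> carrier G" "v \<otimes> w [^] (k::nat) \<in> H" "v \<otimes> w [^] (l::nat) \<in> H" for v k l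
  proof -
    have "w [^] (l + (p - 1) * k) = w [^] l \<otimes> inv (w [^] k)"
      using w by (simp add: nat_pow_mult[symmetric] inv_pow)
    also have "\<dots> = (v \<otimes> w [^] l) \<otimes> inv (v \<otimes> w [^] k)"
      using that(1) w by (simp add: mult_inv_cancel)
    finally have "w [^] (l + (p - 1) * k) = (v \<otimes> w [^] l) \<otimes> inv (v \<otimes> w [^] k)" .
    then have "w [^] (l + (p - 1) * k) \<in> H"
      using subgroup.m_closed[OF H(1)] subgroup.m_inv_closed[OF H(1)] that by metis
    then have "p dvd l + (p - 1) * k" using pow_prime_not_dvd[OF H(1) w(1) ex[OF w(1)] p] H(2) by blast
    then have "int p dvd int l + (int p - 1) * int k" using p1
      by (metis of_nat_1 of_nat_add of_nat_diff of_nat_dvd_iff of_nat_mult)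
    moreover have "int l + (int p - 1) * int k = (int l - int k) + int p * int k"
      by (simp add: algebra_simps)
    ultimately have "int p dvd int l - int k" by (simp add: dvd_add_left_iff)
    then show ?thesis by (simp add: cong_iff_dvd_diff dvd_diff_commute)
  qed
  \<comment> \<open>\<open>f v\<close> moves \<open>v\<close> into \<open>H\<close>, so
    \<open>- f v\<close> is the coordinate of \<open>v\<close> along \<open>w\<close>.\<close>
  define f where "f v = (SOME k::nat. v \<otimes> w [^] k \<in> H)" for v
  have f: "v \<otimes> w [^] f v \<in> H" if "v \<in> carrier G" for v
    unfolding f_def by (rule someI_ex[OF key[OF that]])
  show ?thesis
  proof (rule that[of "\<lambda>v. - int (f v)"])
    fix x y assume xy: "x \<in> carrier G" "y \<in> carrier G"
    have "(x \<otimes> y) \<otimes> w [^] (f x + f y) = (x \<otimes> w [^] f x) \<otimes> (y \<otimes> w [^] f y)"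
      unfolding nat_pow_mult[OF w(1), symmetric]
      using xy w(1) by (simp only: m_ac nat_pow_closed m_closed)
    then have "(x \<otimes> y) \<otimes> w [^] (f x + f y) \<in> H" using subgroup.m_closed[OF H(1) f f] xy by simp
    then have "[int (f (x \<otimes> y)) = int (f x + f y)] (mod int p)"
      using uniq[OF _ f] xy by blast
    then show "[- int (f (x \<otimes> y)) = - int (f x) + - int (f y)] (mod int p)"
      using cong_minus_minus_iff[of "int (f (x \<otimes> y))" "int (f x + f y)" "int p"] by simp
  next
    show "\<not> [- int (f w) = 0] (mod int p)"
    proof
      assume "[- int (f w) = 0] (mod int p)"
      then have "p dvd f w" by (simp add: cong_0_iff)
      then have "w [^] f w = \<one>" using ex[OF w(1)] w(1) by (auto simp: nat_pow_pow[symmetric] elim!: dvdE)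
      then show False using f[OF w(1)] w H(2) by simp
    qed
  qed
qed

lemma (in comm_group) torsion_subgroup: "subgroup {x \<in> carrier G. x [^] (p::nat) = \<one>} G"
  by (rule subgroupI) (auto simp: nat_pow_distrib nat_pow_inv)

text \<open>Among the iterated \<open>p\<close>-th powers of \<open>x\<close>, take the last one
  that is not trivial.\<close>

lemma (in comm_group) exists_order_prime:
  assumes "finite (carrier G)" "card (carrier G) = p ^ j" "x \<in> carrier G" "x \<noteq> \<one>"
  obtains y where "y \<in> carrier G" "y \<noteq> \<one>" "y [^] (p::nat) = \<one>"
proof -
  define i where "i = (LEAST i. x [^] (p ^ i) = \<one>)"
  have "x [^] (p ^ j) = \<one>" using power_order_eq_one[OF assms(1,3)] assms(2) by simp
  then have i: "x [^] (p ^ i) = \<one>" unfolding i_def by (rule LeastI)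
  have "i \<noteq> 0" using i assms(3,4) nat_pow_one' by (metis power_0)
  then obtain k where k: "i = Suc k" by (cases i) auto
  have "x [^] (p ^ k) \<noteq> \<one>" using not_less_Least[of k "\<lambda>i. x [^] (p ^ i) = \<one>"] k i_def by simp
  moreover have "(x [^] (p ^ k)) [^] p = \<one>" using i k assms by (simp add: nat_pow_pow mult.commute)
  ultimately show ?thesis using that[of "x [^] (p ^ k)"] assms by simp
qed


section \<open>Polynomial functions modulo a prime\<close>

text \<open>Integer polynomials in the coordinates \<open>c (\<rho> i)\<close>, with
  \<open>d\<close> as an upper bound for the total degree. The prime enters only through congruence
  in \<open>deg_le\<close>, so no type of residues depending on \<open>p\<close> has to be
  formed.\<close>

inductive pol :: "('a \<Rightarrow> int) set \<Rightarrow> nat \<Rightarrow> ((nat \<Rightarrow> 'a) \<Rightarrow> int) \<Rightarrow> bool" for C where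
  const: "pol C d (\<lambda>\<rho>. k)"
| coord: "c \<in> C \<Longrightarrow> pol C (Suc d) (\<lambda>\<rho>. c (\<rho> i))"
| add: "pol C d F \<Longrightarrow> pol C d G \<Longrightarrow> pol C d (\<lambda>\<rho>. F \<rho> + G \<rho>)"
| mult: "pol C d F \<Longrightarrow> pol C e G \<Longrightarrow> pol C (d + e) (\<lambda>\<rho>. F \<rho> * G \<rho>)"

lemma pol_mono:
  assumes "pol C d F" "d \<le> e"
  shows "pol C e F"
  using pol.mult[OF assms(1) pol.const[of C "e - d" 1]] assms(2) by simp

definition deg_le :: "('a \<Rightarrow> int) set \<Rightarrow> nat \<Rightarrow> nat \<Rightarrow> (nat \<Rightarrow> 'a) set \<Rightarrow> ((nat \<Rightarrow> 'a) \<Rightarrow> int) \<Rightarrow> bool" where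
  "deg_le C p d X F \<longleftrightarrow> (\<exists>G. pol C d G \<and> (\<forall>\<rho>\<in>X. [F \<rho> = G \<rho>] (mod int p)))"

lemma deg_leI: "pol C d F \<Longrightarrow> deg_le C p d X F"
  by (auto simp: deg_le_def)

lemma deg_le_mono: "deg_le C p d X F \<Longrightarrow> d \<le> e \<Longrightarrow> deg_le C p e X F"
  unfolding deg_le_def using pol_mono by blast

lemma deg_le_cong:
  "deg_le C p d X F \<Longrightarrow> (\<And>\<rho>. \<rho> \<in> X \<Longrightarrow> [G \<rho> = F \<rho>] (mod int p)) \<Longrightarrow> deg_le C p d X G"
  unfolding deg_le_def using cong_trans by blast

lemma deg_le_add: "deg_le C p d X F \<Longrightarrow> deg_le C p d X G \<Longrightarrow> deg_le C p d X (\<lambda>\<rho>. F \<rho> + G \<rho>)"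
  unfolding deg_le_def
proof (elim exE conjE)
  fix F' G' assume "pol C d F'" "pol C d G'" "\<forall>\<rho>\<in>X. [F \<rho> = F' \<rho>] (mod int p)" "\<forall>\<rho>\<in>X. [G \<rho> = G' \<rho>] (mod int p)"
  then show "\<exists>H. pol C d H \<and> (\<forall>\<rho>\<in>X. [F \<rho> + G \<rho> = H \<rho>] (mod int p))"
    by (intro exI[of _ "\<lambda>\<rho>. F' \<rho> + G' \<rho>"] conjI pol.add ballI cong_add) auto
qed

lemma deg_le_mult: "deg_le C p d X F \<Longrightarrow> deg_le C p e X G \<Longrightarrow> deg_le C p (d + e) X (\<lambda>\<rho>. F \<rho> * G \<rho>)"
  unfolding deg_le_def
proof (elim exE conjE)
  fix F' G' assume "pol C d F'" "pol C e G'" "\<forall>\<rho>\<in>X. [F \<rho> = F' \<rho>] (mod int p)" "\<forall>\<rho>\<in>X. [G \<rho> = G' \<rho>] (mod int p)"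
  then show "\<exists>H. pol C (d + e) H \<and> (\<forall>\<rho>\<in>X. [F \<rho> * G \<rho> = H \<rho>] (mod int p))"
    by (intro exI[of _ "\<lambda>\<rho>. F' \<rho> * G' \<rho>"] conjI pol.mult ballI cong_mult) auto
qed

lemma deg_le_sum:
  "finite I \<Longrightarrow> (\<And>i. i \<in> I \<Longrightarrow> deg_le C p d X (F i)) \<Longrightarrow> deg_le C p d X (\<lambda>\<rho>. \<Sum>i\<in>I. F i \<rho>)"
  by (induction I rule: finite_induct) (auto intro: deg_leI pol.const deg_le_add)

lemma deg_le_prod:
  "finite I \<Longrightarrow> (\<And>i. i \<in> I \<Longrightarrow> deg_le C p d X (F i)) \<Longrightarrow> deg_le C p (card I * d) X (\<lambda>\<rho>. \<Prod>i\<in>I. F i \<rho>)"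
  by (induction I rule: finite_induct) (auto intro: deg_leI pol.const deg_le_mult)

lemma pol_comp:
  assumes "pol C' d F" "\<And>c. c \<in> C' \<Longrightarrow> c \<circ> r \<in> C"
  shows "pol C d (\<lambda>\<rho>. F (\<lambda>i. r (\<rho> i)))"
  using assms(1)
proof (induction rule: pol.induct)
  case (coord c d i)
  then show ?case using pol.coord[of "c \<circ> r" C d i] assms(2) by simp
qed (auto intro: pol.intros)

definition separates :: "('a \<Rightarrow> int) set \<Rightarrow> nat \<Rightarrow> 'a set \<Rightarrow> bool" where
  "separates C p S \<longleftrightarrow> (\<forall>x\<in>S. \<forall>y\<in>S. x \<noteq> y \<longrightarrow> (\<exists>c\<in>C. \<not> [c x = c y] (mod int p)))"

text \<open>The indicator function of a point of \<open>S\<close> is a product of \<open>card S - 1\<close> functions that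
  are affine in separating coordinates.\<close>

lemma deg_le_arbitrary:
  fixes T :: "nat \<Rightarrow> (nat \<Rightarrow> 'a) \<Rightarrow> 'b" and g :: "'b list \<Rightarrow> int"
  assumes p: "prime p" and S: "finite S" "separates C' p S"
    and T: "\<And>j \<rho>. j < n \<Longrightarrow> \<rho> \<in> X \<Longrightarrow> T j \<rho> \<in> S"
    and d: "\<And>c j. c \<in> C' \<Longrightarrow> j < n \<Longrightarrow> deg_le C p d X (\<lambda>\<rho>. c (T j \<rho>))"
  shows "deg_le C p (n * ((card S - 1) * d)) X (\<lambda>\<rho>. g (map (\<lambda>j. T j \<rho>) [0..<n]))"
proof -
  have "\<exists>c u. c \<in> C' \<and> [(c x - c y) * u = 1] (mod int p)" if xy: "x \<in> S" "y \<in> S" "x \<noteq> y" for x y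
  proof -
    obtain c where c: "c \<in> C'" "\<not> [c x = c y] (mod int p)" using xy S(2) unfolding separates_def by blast
    then have "\<not> int p dvd c x - c y" by (simp add: cong_iff_dvd_diff)
    then have "coprime (c x - c y) (int p)" using p by (metis coprime_commute prime_imp_coprime prime_int_nat_transfer nat_int of_nat_0_le_iff prime_nat_int_transfer)
    then show ?thesis using cong_solve_coprime_int c(1) by blast
  qed
  then obtain c u where cu: "\<And>x y. x \<in> S \<Longrightarrow> y \<in> S \<Longrightarrow> x \<noteq> y \<Longrightarrow> c x y \<in> C' \<and> [(c x y x - c x y y) * u x y = 1] (mod int p)"
    by metis
  define ind where "ind x z = (\<Prod>y\<in>S - {x}. (c x y z - c x y y) * u x y)" for x z
  have ind1: "[ind x x = 1] (mod int p)" if "x \<in> S" for x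
  proof -
    have "[ind x x = (\<Prod>y\<in>S - {x}. 1)] (mod int p)"
      unfolding ind_def using cu that by (intro cong_prod) auto
    then show ?thesis by simp
  qed
  have ind0: "ind x z = 0" if "z \<in> S" "x \<noteq> z" for x z
    unfolding ind_def using S(1) that by (intro prod_zero) auto
  have degind: "deg_le C p ((card S - 1) * d) X (\<lambda>\<rho>. ind x (T j \<rho>))" if x: "x \<in> S" and j: "j < n" for x j
  proof -
    have "deg_le C p d X (\<lambda>\<rho>. (c x y (T j \<rho>) - c x y y) * u x y)" if "y \<in> S - {x}" for y
    proof -
      have "deg_le C p d X (\<lambda>\<rho>. c x y (T j \<rho>))" using d[OF _ j] cu[OF x, of y] that by auto
      then have "deg_le C p d X (\<lambda>\<rho>. c x y (T j \<rho>) + (- c x y y))" by (intro deg_le_add deg_leI[OF pol.const])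
      then have "deg_le C p (d + 0) X (\<lambda>\<rho>. (c x y (T j \<rho>) + (- c x y y)) * u x y)"
        by (intro deg_le_mult deg_leI[OF pol.const])
      then show ?thesis by simp
    qed
    then have "deg_le C p (card (S - {x}) * d) X (\<lambda>\<rho>. ind x (T j \<rho>))"
      unfolding ind_def using S(1) by (intro deg_le_prod) auto
    then show ?thesis using x S(1) by simp
  qed
  have fin: "finite (nlists n S)" 
    using finite_lists_length_eq[OF S(1), of n] by (simp add: nlists_def conj_commute)
  \<comment> \<open>Interpolation: \<open>g l\<close> is multiplied by the indicators of
    \<open>T j = l ! j\<close>, that is by \<open>n\<close> factors of degree at most
    \<open>(card S - 1) * d\<close> each.\<close>
  have "deg_le C p (n * ((card S - 1) * d)) X (\<lambda>\<rho>. \<Sum>l\<in>nlists n S. g l * (\<Prod>j<n. ind (l ! j) (T j \<rho>)))"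
  proof (rule deg_le_sum[OF fin])
    fix l assume "l \<in> nlists n S"
    then have "l ! j \<in> S" if "j < n" for j using that by (auto simp: nlists_def subset_iff)
    then have "deg_le C p (card {..<n} * ((card S - 1) * d)) X (\<lambda>\<rho>. \<Prod>j<n. ind (l ! j) (T j \<rho>))"
      using degind by (intro deg_le_prod) auto
    then have "deg_le C p (0 + n * ((card S - 1) * d)) X (\<lambda>\<rho>. g l * (\<Prod>j<n. ind (l ! j) (T j \<rho>)))"
      by (intro deg_le_mult deg_leI[OF pol.const]) simp
    then show "deg_le C p (n * ((card S - 1) * d)) X (\<lambda>\<rho>. g l * (\<Prod>j<n. ind (l ! j) (T j \<rho>)))" by simp
  qed
  then show ?thesis
  proof (rule deg_le_cong)
    fix \<rho> assume \<rho>: "\<rho> \<in> X"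
    let ?l = "map (\<lambda>j. T j \<rho>) [0..<n]"
    have l: "?l \<in> nlists n S" using T \<rho> by (auto simp: nlists_def)
    have zero: "(\<Prod>j<n. ind (k ! j) (T j \<rho>)) = 0" if k: "k \<in> nlists n S - {?l}" for k
    proof -
      have "\<exists>j<n. k ! j \<noteq> T j \<rho>"
      proof (rule ccontr)
        assume "\<not> ?thesis"
        then have "k = ?l" using nlistsE_length[of k n S] k by (intro nth_equalityI) simp_all
        then show False using k by blast
      qed
      then obtain j where "j < n" "k ! j \<noteq> T j \<rho>" by blast
      moreover from this have "ind (k ! j) (T j \<rho>) = 0" using ind0 T \<rho> by blast
      ultimately show ?thesis using prod_zero[of "{..<n}" "\<lambda>j. ind (k ! j) (T j \<rho>)"] by blast
    qed
    then have eq: "(\<Sum>l\<in>nlists n S. g l * (\<Prod>j<n. ind (l ! j) (T j \<rho>))) = g ?l * (\<Prod>j<n. ind (?l ! j) (T j \<rho>))"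
      by (subst sum.remove[OF fin l], subst sum.neutral) (use zero in auto)
    have "[(\<Prod>j<n. ind (?l ! j) (T j \<rho>)) = (\<Prod>j<n. 1)] (mod int p)"
      using T \<rho> ind1 by (intro cong_prod) auto
    from cong_sym[OF cong_scalar_left[OF this, of "g ?l"]] show "[g ?l = (\<Sum>l\<in>nlists n S. g l * (\<Prod>j<n. ind (l ! j) (T j \<rho>)))] (mod int p)"
      unfolding eq by simp
  qed
qed

section \<open>Polynomial coordinates of nilpotent algebras of prime power order\<close>

lemma (in comm_group) subgroup_comm_group: "subgroup H G \<Longrightarrow> comm_group (G\<lparr>carrier := H\<rparr>)"
  by (rule group.group_comm_groupI[OF subgroup_imp_group]) (auto intro: m_comm subgroup.mem_carrier)

text \<open>Arguments and values are measured in the same coordinates, and \<open>d\<close> bounds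
  the terms of all arities at once; this uniformity turns it into a supernilpotency degree.\<close>

definition deg_coords :: "'f signature \<Rightarrow> ('f, 'a) alg \<Rightarrow> nat \<Rightarrow> nat \<Rightarrow> ('a \<Rightarrow> int) set \<Rightarrow> bool" where
  "deg_coords Sg A p d C \<longleftrightarrow> separates C p (univ A) \<and>
     (\<forall>t\<in>trms Sg UNIV. \<forall>c\<in>C. deg_le C p d (vals A) (\<lambda>\<rho>. c (eval A \<rho> t)))"

text \<open>The quotient lives on representatives, so it has the carrier type of \<open>A\<close>
  and an induction over algebras of one type can descend to it.\<close>

definition quot :: "('f, 'a) alg \<Rightarrow> ('a \<Rightarrow> 'a) \<Rightarrow> ('f, 'a) alg" where
  "quot A r = \<lparr>univ = r ` univ A, interp = (\<lambda>f xs. r (interp A f xs))\<rparr>"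

lemma quot_hom:
  assumes A: "algebra Sg A" and \<beta>: "congruence Sg A \<beta>"
    and r: "\<And>x. x \<in> univ A \<Longrightarrow> (x, r x) \<in> \<beta>" "\<And>x y. (x, y) \<in> \<beta> \<Longrightarrow> r x = r y"
  shows "algebra Sg (quot A r)" "hom_onto Sg A (quot A r) r"
proof -
  have rin: "r x \<in> univ A" if "x \<in> univ A" for x using congruence_subset[OF \<beta> r(1)[OF that]] by simp
  then have sub: "r ` univ A \<subseteq> univ A" by auto
  show "algebra Sg (quot A r)" unfolding algebra_def
  proof (intro conjI ballI)
    show "univ (quot A r) \<noteq> {}" using A by (auto simp: algebra_def quot_def)
    fix f xs assume "f \<in> syms Sg" "xs \<in> nlists (arity Sg f) (univ (quot A r))"
    then have "interp A f xs \<in> univ A" using sub by (intro interp_in[OF A]) (auto simp: nlists_def quot_def)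
    then show "interp (quot A r) f xs \<in> univ (quot A r)" by (simp add: quot_def)
  qed
  show "hom_onto Sg A (quot A r) r" unfolding hom_onto_def
  proof (intro conjI ballI allI impI)
    show "r ` univ A = univ (quot A r)" by (simp add: quot_def)
    fix f xs assume *: "f \<in> syms Sg" "length xs = arity Sg f" "set xs \<subseteq> univ A"
    then have "(interp A f xs, interp A f (map r xs)) \<in> \<beta>"
      using r(1) by (intro congruence_interp[OF \<beta>]) (auto simp: subset_iff)
    then show "r (interp A f xs) = interp (quot A r) f (map r xs)" using r(2) by (simp add: quot_def)
  qed
qed

lemma congruence_representatives:
  assumes \<beta>: "congruence Sg A \<beta>"
  obtains r where "\<And>x. x \<in> univ A \<Longrightarrow> (x, r x) \<in> \<beta>" "\<And>x y. (x, y) \<in> \<beta> \<Longrightarrow> r x = r y"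
    "card (r ` univ A) = card (univ A // \<beta>)"
proof -
  define r where "r x = (SOME y. (x, y) \<in> \<beta>)" for x
  have r1: "(x, r x) \<in> \<beta>" if "x \<in> univ A" for x
    unfolding r_def by (rule someI[of _ x]) (rule congruence_refl[OF \<beta> that])
  have r2: "r x = r y" if "(x, y) \<in> \<beta>" for x y
  proof -
    have "(x, z) \<in> \<beta> \<longleftrightarrow> (y, z) \<in> \<beta>" for z
      using that congruence_sym[OF \<beta>] congruence_trans[OF \<beta>] by blast
    then show ?thesis by (simp add: r_def)
  qed
  note E = congruence_equiv[OF \<beta>]
  have cl: "\<beta> `` {r x} = \<beta> `` {x}" if "x \<in> univ A" for x
    using equiv_class_eq[OF E r1[OF that]] by simp
  have "bij_betw (\<lambda>y. \<beta> `` {y}) (r ` univ A) (univ A // \<beta>)"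
    unfolding bij_betw_def
  proof
    show "inj_on (\<lambda>y. \<beta> `` {y}) (r ` univ A)"
    proof (rule inj_onI)
      fix x y assume "x \<in> r ` univ A" "y \<in> r ` univ A" "\<beta> `` {x} = \<beta> `` {y}"
      then obtain a b where ab: "a \<in> univ A" "b \<in> univ A" "x = r a" "y = r b" by auto
      then have "\<beta> `` {a} = \<beta> `` {b}" using cl \<open>\<beta> `` {x} = \<beta> `` {y}\<close> by simp
      then have "(a, b) \<in> \<beta>" using eq_equiv_class[OF _ E ab(2)] by simp
      then show "x = y" using r2 ab by simp
    qed
    show "(\<lambda>y. \<beta> `` {y}) ` (r ` univ A) = univ A // \<beta>"
      unfolding quotient_def image_image using cl by auto
  qed
  then show ?thesis using that[of r] r1 r2 bij_betw_same_card by blast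
qed

context central_congruence
begin

text \<open>The coordinates are those of the quotient and all characters of \<open>W\<close> applied
  to the displacement \<open>w x\<close> of \<open>x\<close> from its representative. The
  displacement of \<open>f\<close> at \<open>ys\<close> is its linear part in the displacements of
  \<open>ys\<close> plus a function of the representatives, which is interpolated in the coordinates
  of the quotient.\<close>

lemma extend_coords:
  assumes p: "prime p" and W: "subgroup W G" "\<And>v. v \<in> W \<Longrightarrow> v [^]\<^bsub>G\<^esub> p = e"
    and LW: "\<And>f k v. f \<in> syms Sg \<Longrightarrow> k < arity Sg f \<Longrightarrow> v \<in> W \<Longrightarrow> L f k v \<in> W"
    and r: "\<And>x. x \<in> univ A \<Longrightarrow> (x, r x) \<in> sub_cong W" "\<And>x y. (x, y) \<in> sub_cong W \<Longrightarrow> r x = r y"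
    and C': "deg_coords Sg (quot A r) p d' C'" and m: "\<forall>f\<in>syms Sg. arity Sg f \<le> m"
    and d: "1 \<le> d" "d' \<le> d" "m * ((card (r ` univ A) - 1) * d') \<le> d"
  shows "\<exists>C. deg_coords Sg A p d C"
proof -
  let ?Q = "quot A r"
  define w where "w x = D x (r x)" for x
  define H where "H = {\<chi>::'a \<Rightarrow> int. \<forall>u\<in>W. \<forall>v\<in>W. [\<chi> (u \<otimes>\<^bsub>G\<^esub> v) = \<chi> u + \<chi> v] (mod int p)}"
  define C where "C = (\<lambda>c. c \<circ> r) ` C' \<union> (\<lambda>\<chi>. \<chi> \<circ> w) ` H"
  have \<beta>: "congruence Sg A (sub_cong W)" by (rule sub_cong_congruence[OF W(1) LW])
  note Q = quot_hom[OF alg \<beta> r]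
  have rU: "r x \<in> univ A" if "x \<in> univ A" for x using congruence_subset[OF \<beta> r(1)[OF that]] by simp
  have xr: "(x, r x) \<in> \<zeta>" "w x \<in> W" if "x \<in> univ A" for x
    using r(1)[OF that] by (auto simp: sub_cong_def w_def)
  have WG: "v \<in> W \<Longrightarrow> v \<in> carrier G" for v using subgroup.subset[OF W(1)] by blast
  have "separates C p (univ A)" unfolding separates_def
  proof (intro ballI impI)
    fix x y assume xy: "x \<in> univ A" "y \<in> univ A" "x \<noteq> y"
    show "\<exists>c\<in>C. \<not> [c x = c y] (mod int p)"
    proof (cases "r x = r y")
      case False
      have "r x \<in> univ ?Q" "r y \<in> univ ?Q" using xy by (auto simp: quot_def)
      then obtain c where "c \<in> C'" "\<not> [c (r x) = c (r y)] (mod int p)"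
        using C' False unfolding deg_coords_def separates_def by blast
      then show ?thesis by (intro bexI[of _ "c \<circ> r"]) (auto simp: C_def)
    next
      case True
      \<comment> \<open>Points of one class are separated by their displacements; the nontrivial
        group difference of these is detected by a character of \<open>W\<close>.\<close>
      then have ne: "w x \<noteq> w y" using D_inj xr xy unfolding w_def by metis
      interpret W: comm_group "G\<lparr>carrier := W\<rparr>" by (rule G.subgroup_comm_group[OF W(1)])
      let ?u = "w x \<otimes>\<^bsub>G\<^esub> inv\<^bsub>G\<^esub> w y"
      have u: "?u \<in> W" using subgroup.m_closed[OF W(1)] subgroup.m_inv_closed[OF W(1)] xr xy by blast
      have wy: "?u \<otimes>\<^bsub>G\<^esub> w y = w x" using xr(2) WG xy by (simp only: G.m_assoc G.inv_closed G.l_inv G.r_one)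
      have "?u \<noteq> e"
      proof
        assume "?u = e"
        then have "w x = \<one>\<^bsub>G\<^esub> \<otimes>\<^bsub>G\<^esub> w y" using wy by simp
        then show False using ne G.l_one[OF WG[OF xr(2)[OF xy(2)]]] by simp
      qed
      moreover have "finite W" using finite_subset[OF subgroup.subset[OF W(1)] finite_G] .
      moreover have "v [^]\<^bsub>G\<lparr>carrier := W\<rparr>\<^esub> p = e" if "v \<in> W" for v
        using W(2)[OF that] G.nat_pow_consistent by metis
      ultimately obtain \<chi> :: "'a \<Rightarrow> int" where \<chi>: "\<And>u v. u \<in> W \<Longrightarrow> v \<in> W \<Longrightarrow> [\<chi> (u \<otimes>\<^bsub>G\<^esub> v) = \<chi> u + \<chi> v] (mod int p)"
        "\<not> [\<chi> ?u = 0] (mod int p)"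
        using W.separating_character[OF _ p _, of ?u] u by auto
      have "[\<chi> (w x) = \<chi> ?u + \<chi> (w y)] (mod int p)" using \<chi>(1)[OF u xr(2)[OF xy(2)]] unfolding wy .
      then have "\<not> [\<chi> (w x) = \<chi> (w y)] (mod int p)"
        using \<chi>(2) by (metis cong_add_rcancel_0 cong_sym cong_trans)
      then show ?thesis using \<chi>(1) by (intro bexI[of _ "\<chi> \<circ> w"]) (auto simp: C_def H_def)
    qed
  qed
  moreover have "deg_le C p d (vals A) (\<lambda>\<rho>. c (eval A \<rho> t))" if t: "t \<in> trms Sg UNIV" and c: "c \<in> C" for t c
  proof -
    have rv: "(\<lambda>i. r (\<rho> i)) \<in> vals ?Q" if "\<rho> \<in> vals A" for \<rho>
      using that by (auto simp: quot_def)
    have Qdeg: "deg_le C p d' (vals A) (\<lambda>\<rho>. c (r (eval A \<rho> t)))" if c: "c \<in> C'" and t: "t \<in> trms Sg UNIV" for c t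
    proof -
      obtain F where F: "pol C' d' F" "\<And>\<rho>. \<rho> \<in> vals ?Q \<Longrightarrow> [c (eval ?Q \<rho> t) = F \<rho>] (mod int p)"
        using C' t c unfolding deg_coords_def deg_le_def by blast
      have "pol C d' (\<lambda>\<rho>. F (\<lambda>i. r (\<rho> i)))" by (rule pol_comp[OF F(1)]) (simp add: C_def)
      moreover have "[c (r (eval A \<rho> t)) = F (\<lambda>i. r (\<rho> i))] (mod int p)" if "\<rho> \<in> vals A" for \<rho>
        using F(2)[OF rv[OF that]] hom_onto_eval[OF alg Q(2) that t] by simp
      ultimately show ?thesis unfolding deg_le_def by blast
    qed
    from c consider c' where "c' \<in> C'" "c = c' \<circ> r" | \<chi> where "\<chi> \<in> H" "c = \<chi> \<circ> w"
      by (auto simp: C_def)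
    then show ?thesis
    proof cases
      case 1
      then show ?thesis using deg_le_mono[OF Qdeg[OF 1(1) t] d(2)] by simp
    next
      case 2
      \<comment> \<open>The character is generalised, because the hypothesis for the arguments is
        applied to \<chi> composed with \<open>L f k\<close>.\<close>
      have "deg_le C p d (vals A) (\<lambda>\<rho>. \<chi> (w (eval A \<rho> t)))" using t 2(1)
      proof (induction arbitrary: \<chi> rule: trms.induct)
        case (Var i)
        then have "\<chi> \<circ> w \<in> C" by (auto simp: C_def)
        then have "pol C (Suc 0) (\<lambda>\<rho>. (\<chi> \<circ> w) (\<rho> i))" by (rule pol.coord)
        then show ?case using d(1) by (auto intro!: deg_leI elim: pol_mono)
      next
        case (App f ts)
        let ?n = "arity Sg f"
        define g where "g xs = \<chi> (D (interp A f xs) (r (interp A f xs)))" for xs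
        have tj: "ts ! j \<in> trms Sg UNIV" if "j < ?n" for j using App that by simp
        have \<chi>: "\<And>u v. u \<in> W \<Longrightarrow> v \<in> W \<Longrightarrow> [\<chi> (u \<otimes>\<^bsub>G\<^esub> v) = \<chi> u + \<chi> v] (mod int p)"
          using App.prems by (simp add: H_def)
        have \<chi>L: "\<chi> \<circ> L f k \<in> H" if k: "k < ?n" for k
        proof -
          have "L f k (u \<otimes>\<^bsub>G\<^esub> v) = L f k u \<otimes>\<^bsub>G\<^esub> L f k v" if "u \<in> W" "v \<in> W" for u v
            using hom_mult[OF L_hom[OF App(1) k]] WG that by blast
          then show ?thesis using \<chi> LW[OF App(1) k] by (simp add: H_def del: G_simps)
        qed
        have 1: "deg_le C p d (vals A) (\<lambda>\<rho>. \<Sum>k<?n. (\<chi> \<circ> L f k) (w (eval A \<rho> (ts ! k))))"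
        proof (rule deg_le_sum)
          fix k assume "k \<in> {..<?n}"
          then have "ts ! k \<in> set ts" "\<chi> \<circ> L f k \<in> H" using App(2) \<chi>L by auto
          then show "deg_le C p d (vals A) (\<lambda>\<rho>. (\<chi> \<circ> L f k) (w (eval A \<rho> (ts ! k))))"
            using App(3) by blast
        qed simp
        have "deg_le C p (?n * ((card (r ` univ A) - 1) * d')) (vals A)
            (\<lambda>\<rho>. g (map (\<lambda>j. r (eval A \<rho> (ts ! j))) [0..<?n]))"
        proof (rule deg_le_arbitrary[OF p, where C' = C'])
          show "finite (r ` univ A)" using fin by simp
          show "separates C' p (r ` univ A)" using C' by (simp add: deg_coords_def quot_def)
          show "r (eval A \<rho> (ts ! j)) \<in> r ` univ A" if "j < ?n" "\<rho> \<in> vals A" for j \<rho>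
            using eval_in[OF alg that(2) tj[OF that(1)]] by blast
          show "deg_le C p d' (vals A) (\<lambda>\<rho>. c (r (eval A \<rho> (ts ! j))))" if "c \<in> C'" "j < ?n" for c j
            using Qdeg that tj by blast
        qed
        moreover have "?n * ((card (r ` univ A) - 1) * d') \<le> d"
          using m App(1) d(3) le_trans mult_le_mono1 by blast
        ultimately have 2: "deg_le C p d (vals A) (\<lambda>\<rho>. g (map (\<lambda>j. r (eval A \<rho> (ts ! j))) [0..<?n]))"
          by (rule deg_le_mono)
        show ?case
        proof (rule deg_le_cong[OF deg_le_add[OF 1 2]])
          fix \<rho> assume \<rho>: "\<rho> \<in> vals A"
          define ys where "ys = map (eval A \<rho>) ts"
          define xs where "xs = map r ys"
          have ys: "length ys = ?n" "set ys \<subseteq> univ A"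
            using App eval_in[OF alg \<rho>] by (auto simp: ys_def)
          have xs: "length xs = ?n" "set xs \<subseteq> univ A" using ys rU by (auto simp: xs_def)
          have yn: "ys ! j \<in> univ A" if "j < ?n" for j using ys that by (auto simp: subset_iff)
          have xn: "xs ! j = r (ys ! j)" if "j < ?n" for j using ys that by (simp add: xs_def)
          have rel: "\<forall>i<?n. (ys ! i, xs ! i) \<in> \<zeta> \<and> D (ys ! i) (xs ! i) \<in> W"
            using xr yn xn by (auto simp: w_def)
          note S = D_interp_sum[OF App(1) xs(1) ys(1) W(1) LW[OF App(1)] rel \<chi>]
          let ?y = "interp A f ys" and ?x = "interp A f xs"
          have x: "?x \<in> univ A" using interp_in[OF alg App(1) xs] .
          \<comment> \<open>Both values lie in one class of \<open>sub_cong W\<close> and share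
            their representative, so the displacement of \<open>?y\<close> splits as
            \<open>D ?y ?x\<close> plus the displacement of \<open>?x\<close>.\<close>
          have rr: "r ?y = r ?x" using S(1,2) r(2) by (simp add: sub_cong_def)
          have "w ?y = D ?y ?x \<otimes>\<^bsub>G\<^esub> D ?x (r ?x)"
            unfolding w_def rr by (rule D_add[OF S(1) xr(1)[OF x]])
          then have "[\<chi> (w ?y) = \<chi> (D ?y ?x) + g xs] (mod int p)"
            using \<chi>[OF S(2) xr(2)[OF x]] by (simp add: g_def w_def del: G_simps)
          then have "[\<chi> (w ?y) = (\<Sum>k<?n. \<chi> (L f k (D (ys ! k) (xs ! k)))) + g xs] (mod int p)"
            using cong_trans cong_add[OF S(3) cong_refl] by blast
          moreover have "(\<Sum>k<?n. \<chi> (L f k (D (ys ! k) (xs ! k)))) = (\<Sum>k<?n. (\<chi> \<circ> L f k) (w (eval A \<rho> (ts ! k))))"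
            using App ys xn by (intro sum.cong) (auto simp: w_def ys_def)
          moreover have "xs = map (\<lambda>j. r (eval A \<rho> (ts ! j))) [0..<?n]"
            using App by (auto simp: xs_def ys_def intro!: nth_equalityI)
          ultimately show "[\<chi> (w (eval A \<rho> (App f ts))) = (\<Sum>k<?n. (\<chi> \<circ> L f k) (w (eval A \<rho> (ts ! k))))
             + g (map (\<lambda>j. r (eval A \<rho> (ts ! j))) [0..<?n])] (mod int p)"
            by (simp add: ys_def)
        qed
      qed
      then show ?thesis using 2 by simp
    qed
  qed
  ultimately show ?thesis unfolding deg_coords_def by blast
qed

end

text \<open>Each layer \<open>W\<close> at least halves the order, which pays for a further factor 2
  in \<open>2 ^ h\<close>. For \<open>m > 0\<close>, each layer after the first multiplies the
  degree by at most \<open>m * (card (univ A) - 1)\<close>, whence the exponent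
  \<open>h - 1\<close>. The witness \<open>h\<close> stands in for the logarithm and keeps the
  induction inside the natural numbers.\<close>

lemma prime_power_deg_coords:
  fixes A :: "('f, 'a) alg"
  assumes p: "prime p" and m: "\<forall>f\<in>syms Sg. arity Sg f \<le> m"
  shows "algebra Sg A \<Longrightarrow> finite (univ A) \<Longrightarrow> malcev Sg A q \<Longrightarrow> central_series Sg A n \<theta> \<Longrightarrow>
    card (univ A) = p ^ a \<Longrightarrow>
    \<exists>C d h. deg_coords Sg A p d C \<and> 1 \<le> d \<and> 2 ^ h \<le> card (univ A) \<and> d \<le> (m * (card (univ A) - 1)) ^ (h - 1)"
proof (induction "card (univ A)" arbitrary: A a \<theta> rule: less_induct)
  case less
  note alg = less.prems(1) and fin = less.prems(2)
  obtain e where e: "e \<in> univ A" using alg by (auto simp: algebra_def)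
  have pos: "card (univ A) \<ge> 1" using e fin by (metis One_nat_def Suc_leI card_gt_0_iff empty_iff)
  show ?case
  proof (cases "card (univ A) = 1")
    case True
    then obtain b where "univ A = {b}" using card_1_singletonE by blast
    then have "deg_coords Sg A p 1 {}" by (simp add: deg_coords_def separates_def)
    \<comment> \<open>With \<open>h = 0\<close> the truncated exponent \<open>h - 1\<close> is 0, so
      the bound is 1.\<close>
    then show ?thesis using True by (intro exI[of _ "{}"] exI[of _ 1] exI[of _ 0]) simp
  next
    case False
    have S: "\<theta> 0 = univ A \<times> univ A" "\<theta> n = Id_on (univ A)" "\<And>i. congruence Sg A (\<theta> i)"
      "\<And>i. cent Sg A (\<theta> i) (\<theta> (Suc i))" using less.prems(4) by (auto simp: central_series_def)
    have "\<theta> 0 \<noteq> Id_on (univ A)"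
    proof
      assume "\<theta> 0 = Id_on (univ A)"
      then have "univ A \<subseteq> {e}" using e S(1) by (auto simp: Id_on_def)
      then have "card (univ A) \<le> card {e}" by (intro card_mono) auto
      then show False using False pos by simp
    qed
    \<comment> \<open>The last nontrivial member of the series is central, since the next one is
      equality.\<close>
    then have "\<exists>i. \<theta> i \<noteq> Id_on (univ A) \<and> \<theta> (Suc i) = Id_on (univ A)"
      using S(2) nat_induct[of "\<lambda>i. \<theta> i \<noteq> Id_on (univ A)" n] by blast
    then obtain i where i: "\<theta> i \<noteq> Id_on (univ A)" "\<theta> (Suc i) = Id_on (univ A)" by blast
    interpret central_congruence Sg A q "\<theta> i" e
      using alg less.prems(3) fin S(3) S(4)[of i] e unfolding i(2) by unfold_locales
    \<comment> \<open>The \<open>p\<close>-torsion is elementary abelian and, being preserved by all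
      endomorphisms of the group, invariant under \<open>L\<close>.\<close>
    define W where "W = {v \<in> carrier G. v [^]\<^bsub>G\<^esub> p = \<one>\<^bsub>G\<^esub>}"
    have W: "subgroup W G" unfolding W_def by (rule G.torsion_subgroup)
    have LW: "L f k v \<in> W" if "f \<in> syms Sg" "k < arity Sg f" "v \<in> W" for f k v
    proof -
      have h: "group_hom G G (L f k)"
        using L_hom[OF that(1,2)] G.is_group by (simp add: group_hom_def group_hom_axioms_def)
      have v: "v \<in> carrier G" "v [^]\<^bsub>G\<^esub> p = \<one>\<^bsub>G\<^esub>" using that(3) by (auto simp: W_def)
      then have "L f k v [^]\<^bsub>G\<^esub> p = \<one>\<^bsub>G\<^esub>"
        using group_hom.hom_nat_pow[OF h v(1), of p] group_hom.hom_one[OF h] by metis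
      then show ?thesis using group_hom.hom_closed[OF h v(1)] by (simp add: W_def del: G_simps)
    qed
    have \<beta>: "congruence Sg A (sub_cong W)" by (rule sub_cong_congruence[OF W LW])
    have cW: "card (univ A) = card W * card (univ A // sub_cong W)" by (rule card_sub_cong[OF W \<beta>])
    \<comment> \<open>All classes of \<theta>\<open>i\<close> have the size of the group, which
      therefore divides a power of \<open>p\<close>. So the nontrivial group contains an element of
      order \<open>p\<close>.\<close>
    have "card W \<ge> 2"
    proof -
      obtain x y where xy: "(x, y) \<in> \<theta> i" "x \<noteq> y"
      proof -
        have "Id_on (univ A) \<subseteq> \<theta> i" using congruence_refl[OF S(3)] by auto
        then have "\<not> \<theta> i \<subseteq> Id_on (univ A)" using i(1) by blast
        then show ?thesis using that U by (auto simp: Id_on_iff)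
      qed
      have "sub_cong (carrier G) = \<theta> i" using D_in by (auto simp: sub_cong_def)
      then have "card (univ A) = card (carrier G) * card (univ A // \<theta> i)"
        using card_sub_cong[OF G.subgroup_self] S(3) by simp
      then have "card (carrier G) dvd p ^ a" using less.prems(5) by (metis dvd_triv_left)
      then obtain j where j: "card (carrier G) = p ^ j" using p divides_primepow_nat by blast
      have "D x y \<noteq> \<one>\<^bsub>G\<^esub>" using D_inj[OF xy(1), of y] xy U by (auto simp: \<zeta>_refl)
      then obtain z where "z \<in> carrier G" "z \<noteq> \<one>\<^bsub>G\<^esub>" "z [^]\<^bsub>G\<^esub> p = \<one>\<^bsub>G\<^esub>"
        using G.exists_order_prime[OF finite_G j, of "D x y"] D_in[OF xy(1)] by auto
      then have "{z, \<one>\<^bsub>G\<^esub>} \<subseteq> W" using subgroup.one_closed[OF W] by (simp add: W_def del: G_simps)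
      moreover have "finite W" by (rule finite_subset[OF subgroup.subset[OF W] finite_G])
      ultimately have "card {z, \<one>\<^bsub>G\<^esub>} \<le> card W" by (intro card_mono)
      then show ?thesis using \<open>z \<noteq> \<one>\<^bsub>G\<^esub>\<close> by simp
    qed
    obtain r where r: "\<And>x. x \<in> univ A \<Longrightarrow> (x, r x) \<in> sub_cong W" "\<And>x y. (x, y) \<in> sub_cong W \<Longrightarrow> r x = r y"
      "card (r ` univ A) = card (univ A // sub_cong W)" using congruence_representatives[OF \<beta>] by blast
    let ?Q = "quot A r"
    note Q = quot_hom[OF alg \<beta> r(1,2)]
    have cQ: "card (univ ?Q) = card (univ A // sub_cong W)" using r(3) by (simp add: quot_def)
    have two: "2 * card (univ ?Q) \<le> card (univ A)" using cW cQ \<open>card W \<ge> 2\<close> by simp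
    have Qpos: "card (univ ?Q) \<ge> 1" using cW pos cQ by (cases "card (univ ?Q)") auto
    have "card (univ ?Q) dvd p ^ a" using cW cQ less.prems(5) by (metis dvd_triv_right)
    then obtain b where b: "card (univ ?Q) = p ^ b" using p divides_primepow_nat by blast
    have "\<exists>C d h. deg_coords Sg ?Q p d C \<and> 1 \<le> d \<and> 2 ^ h \<le> card (univ ?Q) \<and> d \<le> (m * (card (univ ?Q) - 1)) ^ (h - 1)"
    proof (rule less.hyps)
      show "card (univ ?Q) < card (univ A)" using two Qpos by linarith
      show "finite (univ ?Q)" using fin by (simp add: quot_def)
      show "malcev Sg ?Q q" by (rule hom_onto_malcev[OF alg Q(2) malc])
      show "central_series Sg ?Q n (\<lambda>i. map_prod r r ` \<theta> i)" by (rule image_central_series[OF Q(2) less.prems(4)])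
      show "algebra Sg ?Q" by (rule Q(1))
      show "card (univ ?Q) = p ^ b" by (rule b)
    qed
    then obtain C' d' h' where C': "deg_coords Sg ?Q p d' C'" and d': "1 \<le> d'"
      "2 ^ h' \<le> card (univ ?Q)" "d' \<le> (m * (card (univ ?Q) - 1)) ^ (h' - 1)" by blast
    have Wp: "v [^]\<^bsub>G\<^esub> p = e" if "v \<in> W" for v using that by (simp add: W_def)
    \<comment> \<open>The first bound serves the coordinates pulled back from the quotient, the
      second the interpolated part of the operations.\<close>
    define d where "d = max d' (m * ((card (univ ?Q) - 1) * d'))"
    have "\<exists>C. deg_coords Sg A p d C"
      by (rule extend_coords[OF p W Wp LW r(1,2) C' m]) (use d' in \<open>auto simp: d_def quot_def\<close>)
    moreover have "\<exists>h. 2 ^ h \<le> card (univ A) \<and> d \<le> (m * (card (univ A) - 1)) ^ (h - 1)"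
    proof (cases "card (univ ?Q) = 1 \<or> m = 0")
      case True
      \<comment> \<open>Here no factor is incurred: \<open>d\<close> stays 1, which is the bound for
        \<open>h = 1\<close>.\<close>
      then have "d' \<le> 1" using d' by (cases "h' - 1") auto
      then show ?thesis using True two Qpos by (intro exI[of _ 1]) (auto simp: d_def)
    next
      case False
      \<comment> \<open>Truncated subtraction gives \<open>h' = 0\<close> and \<open>h' = 1\<close>
        the same exponent; starting from at least 1 ensures that the step to \<open>Suc h\<close>
        really gains a factor.\<close>
      define h where "h = max 1 h'"
      have Q2: "2 \<le> card (univ ?Q)" using False Qpos by simp
      let ?M = "m * (card (univ ?Q) - 1)"
      have M: "1 \<le> ?M" using False Q2 by simp
      have "2 ^ h \<le> card (univ ?Q)" using d'(2) Q2 by (auto simp: h_def max_def)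
      then have "2 ^ Suc h \<le> card (univ A)" using two by simp
      moreover have "d \<le> ?M * d'" using M by (simp add: d_def mult.assoc)
      then have "d \<le> ?M * ?M ^ (h - 1)" using d'(3) order_trans mult_le_mono2 unfolding h_def by (cases h') fastforce+
      then have "d \<le> ?M ^ h" by (cases h) (auto simp: h_def)
      moreover have "?M ^ h \<le> (m * (card (univ A) - 1)) ^ h" using two by (intro power_mono mult_le_mono) auto
      ultimately show ?thesis by (intro exI[of _ "Suc h"]) auto
    qed
    moreover have "1 \<le> d" using d' by (simp add: d_def)
    ultimately show ?thesis by blast
  qed
qed

section \<open>Functions on cubes and supernilpotency\<close>

text \<open>A vertex of the cube is the set \<open>E\<close> of directions in which the second value
  is chosen. Each summand depends on at most \<open>d\<close> directions, as a monomial of degree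
  \<open>d\<close> does.\<close>

inductive cube_fun :: "nat \<Rightarrow> (nat set \<Rightarrow> int) \<Rightarrow> bool" for d where
  dep: "finite T \<Longrightarrow> card T \<le> d \<Longrightarrow> (\<And>E. g E = g (E \<inter> T)) \<Longrightarrow> cube_fun d g"
| add: "cube_fun d g \<Longrightarrow> cube_fun d h \<Longrightarrow> cube_fun d (\<lambda>E. g E + h E)"

lemma cube_fun_mult:
  assumes "cube_fun d g" "cube_fun e h"
  shows "cube_fun (d + e) (\<lambda>E. g E * h E)"
  using assms(1)
proof (induction rule: cube_fun.induct)
  case (dep T g)
  note g = dep
  show ?case using assms(2)
  proof (induction rule: cube_fun.induct)
    case (dep S h)
    show ?case
    proof (rule cube_fun.dep[of "T \<union> S"])
      show "finite (T \<union> S)" using g dep by simp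
      show "card (T \<union> S) \<le> d + e" using card_Un_le[of T S] g(2) dep(2) by linarith
      fix E
      have "g (E \<inter> (T \<union> S)) = g E" using g(3)[of E] g(3)[of "E \<inter> (T \<union> S)"] by (metis Int_assoc Int_Un_eq(3) Un_Int_eq(1) inf_commute)
      moreover have "h (E \<inter> (T \<union> S)) = h E" using dep(3)[of E] dep(3)[of "E \<inter> (T \<union> S)"] by (metis Int_assoc Un_Int_eq(2))
      ultimately show "g E * h E = g (E \<inter> (T \<union> S)) * h (E \<inter> (T \<union> S))" by simp
    qed
  next
    case (add h1 h2)
    then show ?case using cube_fun.add by (simp add: distrib_left)
  qed
next
  case (add g1 g2)
  then show ?case using cube_fun.add by (simp add: distrib_right)
qed

lemma sum_Pow_insert:
  fixes \<phi> :: "'b set \<Rightarrow> int"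
  assumes "finite J" "j \<notin> J"
  shows "(\<Sum>E\<in>Pow (insert j J). (- 1) ^ card E * \<phi> E) = (\<Sum>E\<in>Pow J. (- 1) ^ card E * (\<phi> E - \<phi> (insert j E)))"
proof -
  have inj: "inj_on (insert j) (Pow J)" using assms(2) by (auto simp: inj_on_def)
  have "(\<Sum>E\<in>Pow (insert j J). (- 1) ^ card E * \<phi> E) =
    (\<Sum>E\<in>Pow J. (- 1) ^ card E * \<phi> E) + (\<Sum>E\<in>insert j ` Pow J. (- 1) ^ card E * \<phi> E)"
    unfolding Pow_insert using assms by (intro sum.union_disjoint) auto
  also have "(\<Sum>E\<in>insert j ` Pow J. (- 1) ^ card E * \<phi> E) = (\<Sum>E\<in>Pow J. - ((- 1) ^ card E * \<phi> (insert j E)))"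
    unfolding sum.reindex[OF inj] o_def
  proof (rule sum.cong)
    fix E assume "E \<in> Pow J"
    then have "finite E" "j \<notin> E" using assms finite_subset by auto
    then show "(- 1) ^ card (insert j E) * \<phi> (insert j E) = - ((- 1) ^ card E * \<phi> (insert j E))" by simp
  qed simp
  finally show ?thesis by (simp add: sum.distrib[symmetric] right_diff_distrib)
qed

text \<open>A summand depending on at most \<open>d\<close> directions ignores some \<open>j\<close>
  in \<open>J\<close>; its values at \<open>E\<close> and \<open>insert j E\<close> then
  cancel.\<close>

lemma cube_fun_alternating:
  assumes "cube_fun d g" "finite J" "d < card J"
  shows "(\<Sum>E\<in>Pow J. (- 1) ^ card E * g E) = 0"
  using assms(1)
proof (induction rule: cube_fun.induct)
  case (dep T g)
  then have "\<not> J \<subseteq> T" using assms card_mono by (metis leD le_trans)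
  then obtain j where j: "j \<in> J" "j \<notin> T" by blast
  have "g (insert j E) = g E" for E
    using dep(3)[of E] dep(3)[of "insert j E"] j(2) by simp
  then show ?case using sum_Pow_insert[of "J - {j}" j g] assms(2) j(1) by (simp add: insert_absorb)
next
  case (add g h)
  then show ?case by (simp add: distrib_left sum.distrib)
qed

text \<open>Each variable moves in one direction at most, so a coordinate depends on one membership
  and a product of \<open>d\<close> coordinates on at most \<open>d\<close>.\<close>

lemma pol_cube:
  assumes "pol C d F" and \<rho>: "\<And>i. \<exists>j. \<forall>E E'. (j \<in> E \<longleftrightarrow> j \<in> E') \<longrightarrow> \<rho> E i = \<rho> E' i"
  shows "cube_fun d (\<lambda>E. F (\<rho> E))"
  using assms(1)
proof (induction rule: pol.induct)
  case (const d k)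
  then show ?case by (intro cube_fun.dep[of "{}"]) auto
next
  case (coord c d i)
  obtain j where j: "\<And>E E'. (j \<in> E \<longleftrightarrow> j \<in> E') \<Longrightarrow> \<rho> E i = \<rho> E' i" using \<rho> by metis
  have "\<rho> E i = \<rho> (E \<inter> {j}) i" for E by (rule j) simp
  then show ?case by (intro cube_fun.dep[of "{j}"]) auto
next
  case (add d F G)
  then show ?case using cube_fun.add by blast
next
  case (mult d F e G)
  then show ?case using cube_fun_mult by blast
qed

text \<open>The alternating sum over the cube of dimension \<open>k + 1\<close> vanishes. Grouped
  along direction \<open>k + 1\<close> it is an alternating sum of differences, all of which vanish
  modulo \<open>p\<close> by assumption except the one at \<open>{1..k}\<close>; so this one
  vanishes as well.\<close>

lemma deg_le_cube_top:
  assumes F: "deg_le C p d X F" and d: "d \<le> k" and \<rho>X: "\<And>E. \<rho> E \<in> X"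
    and \<rho>: "\<And>i. \<exists>j. \<forall>E E'. (j \<in> E \<longleftrightarrow> j \<in> E') \<longrightarrow> \<rho> E i = \<rho> E' i"
    and eq: "\<And>E. E \<subset> {1..k} \<Longrightarrow> [F (\<rho> E) = F (\<rho> (insert (k + 1) E))] (mod int p)"
  shows "[F (\<rho> {1..k}) = F (\<rho> (insert (k + 1) {1..k}))] (mod int p)"
proof -
  obtain G where G: "pol C d G" "\<And>\<sigma>. \<sigma> \<in> X \<Longrightarrow> [F \<sigma> = G \<sigma>] (mod int p)"
    using F by (auto simp: deg_le_def)
  have FG: "[F (\<rho> E) = G (\<rho> E)] (mod int p)" for E using G(2) \<rho>X by blast
  let ?\<Delta> = "\<lambda>E. G (\<rho> E) - G (\<rho> (insert (k + 1) E))"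
  have "(\<Sum>E\<in>Pow (insert (k + 1) {1..k}). (- 1) ^ card E * G (\<rho> E)) = 0"
    using d by (intro cube_fun_alternating[OF pol_cube[OF G(1) \<rho>]]) auto
  then have "0 = (\<Sum>E\<in>Pow {1..k}. (- 1) ^ card E * ?\<Delta> E)"
    by (subst (asm) sum_Pow_insert) auto
  also have "\<dots> = (- 1) ^ k * ?\<Delta> {1..k} + (\<Sum>E\<in>Pow {1..k} - {{1..k}}. (- 1) ^ card E * ?\<Delta> E)"
    by (subst sum.remove[of _ "{1..k}"]) auto
  finally have 0: "0 = (- 1) ^ k * ?\<Delta> {1..k} + (\<Sum>E\<in>Pow {1..k} - {{1..k}}. (- 1) ^ card E * ?\<Delta> E)" .
  have "int p dvd ?\<Delta> E" if "E \<in> Pow {1..k} - {{1..k}}" for E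
  proof -
    have "[G (\<rho> E) = G (\<rho> (insert (k + 1) E))] (mod int p)"
      using cong_trans[OF cong_trans[OF cong_sym[OF FG] eq[of E]] FG] that by blast
    then show ?thesis by (simp add: cong_iff_dvd_diff)
  qed
  then have "int p dvd (\<Sum>E\<in>Pow {1..k} - {{1..k}}. (- 1) ^ card E * ?\<Delta> E)"
    by (intro dvd_sum dvd_mult)
  moreover have "(- 1) ^ k * ?\<Delta> {1..k} = - (\<Sum>E\<in>Pow {1..k} - {{1..k}}. (- 1) ^ card E * ?\<Delta> E)"
    using 0 by linarith
  ultimately have "int p dvd (- 1) ^ k * ?\<Delta> {1..k}" by (simp only: dvd_minus_iff)
  then have "int p dvd ?\<Delta> {1..k}" by (cases "even k") (auto simp: dvd_diff_commute)
  then have "[G (\<rho> {1..k}) = G (\<rho> (insert (k + 1) {1..k}))] (mod int p)" by (simp add: cong_iff_dvd_diff)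
  from cong_trans[OF cong_trans[OF FG this] cong_sym[OF FG]] show ?thesis .
qed

section \<open>Supernilpotency from bounded degree\<close>

abbreviation choice :: "nat set \<Rightarrow> nat \<Rightarrow> nat" where
  "choice E i \<equiv> if i \<in> E then 2 else 1"

text \<open>A fixed position lies in one block, and only the choice made for this block affects its
  entry.\<close>

lemma concat_nth_depends:
  assumes "\<And>i E. i \<in> set js \<Longrightarrow> length (a i (choice E i)) = n i" "l < sum_list (map n js)"
  shows "\<exists>j. \<forall>E E'. (j \<in> E \<longleftrightarrow> j \<in> E') \<longrightarrow>
    concat (map (\<lambda>i. a i (choice E i)) js) ! l = concat (map (\<lambda>i. a i (choice E' i)) js) ! l"
  using assms
proof (induction js arbitrary: l)
  case (Cons j js)
  have len: "length (a j (choice E j)) = n j" for E using Cons.prems(1) by simp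
  show ?case
  proof (cases "l < n j")
    case True
    then show ?thesis using len by (intro exI[of _ j]) (simp add: nth_append)
  next
    case False
    have "l - n j < sum_list (map n js)" using Cons.prems(2) False by simp
    moreover have "length (a i (choice E i)) = n i" if "i \<in> set js" for i E
      using Cons.prems(1) that by simp
    ultimately obtain j' where j': "\<forall>E E'. (j' \<in> E \<longleftrightarrow> j' \<in> E') \<longrightarrow>
      concat (map (\<lambda>i. a i (choice E i)) js) ! (l - n j) = concat (map (\<lambda>i. a i (choice E' i)) js) ! (l - n j)"
      using Cons.IH[of "l - n j"] by blast
    have tl: "concat (map (\<lambda>i. a i (choice E i)) (j # js)) ! l =
      concat (map (\<lambda>i. a i (choice E i)) js) ! (l - n j)" for E
      using False len[of E] by (simp only: list.map concat.simps nth_append if_False)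
    show ?thesis unfolding tl using j' by blast
  qed
qed simp

text \<open>The \<open>k + 1\<close> blocks of arguments are the directions of a cube. Equality in
  \<open>A\<close> is tested in the factors, in each by coordinates modulo its own prime, so the
  primes never interact.\<close>

lemma deg_coords_supernilpotent:
  fixes A :: "('f, 'a) alg" and B :: "nat \<Rightarrow> ('f, 'b) alg"
  assumes A: "algebra Sg A" and \<pi>: "\<And>i. i < r \<Longrightarrow> hom_onto Sg A (B i) (\<pi> i)"
    and inj: "\<And>x y. x \<in> univ A \<Longrightarrow> y \<in> univ A \<Longrightarrow> (\<And>i. i < r \<Longrightarrow> \<pi> i x = \<pi> i y) \<Longrightarrow> x = y"
    and C: "\<And>i. i < r \<Longrightarrow> deg_coords Sg (B i) (p i) (d i) (C i)" and d: "\<And>i. i < r \<Longrightarrow> d i \<le> k"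
  shows "supernilpotent k Sg A"
  unfolding supernilpotent_def
proof (intro allI impI ballI)
  fix n :: "nat \<Rightarrow> nat" and a :: "nat \<Rightarrow> nat \<Rightarrow> 'a list" and t
  assume a: "\<forall>i\<in>{1..k + 1}. \<forall>j\<in>{1, 2}. a i j \<in> nlists (n i) (univ A)"
    and t: "t \<in> term_funs Sg A (\<Sum>i = 1..k + 1. n i)"
    and hyp: "\<forall>f\<in>{1..k} \<rightarrow> {1, 2}. (\<exists>i\<in>{1..k}. f i \<noteq> 2) \<longrightarrow>
              t (concat (map (\<lambda>i. a i (f i)) [1..<k + 1]) @ a (k + 1) 1)
            = t (concat (map (\<lambda>i. a i (f i)) [1..<k + 1]) @ a (k + 1) 2)"
  define N where "N = (\<Sum>i = 1..k + 1. n i)"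
  obtain s where s: "s \<in> trms Sg {..<N}" "t = (\<lambda>xs\<in>nlists N (univ A). eval A (\<lambda>i. xs ! i) s)"
    using t unfolding term_funs_def N_def by blast
  obtain e where e: "e \<in> univ A" using A by (auto simp: algebra_def)
  define X where "X E = concat (map (\<lambda>i. a i (choice E i)) [1..<k + 2])" for E
  define \<rho> where "\<rho> E l = (if l < N then X E ! l else e)" for E l
  have X_split: "X E = concat (map (\<lambda>i. a i (choice E i)) [1..<k + 1]) @ a (k + 1) (choice E (k + 1))" for E
    by (simp add: X_def)
  have ai: "length (a i (choice E i)) = n i" "set (a i (choice E i)) \<subseteq> univ A" if "i \<in> set [1..<k + 2]" for i E
    using a that by (auto simp: nlists_def)
  have sumn: "sum_list (map n [1..<k + 2]) = N"
    unfolding N_def interv_sum_list_conv_sum_set_nat by (rule sum.cong) auto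
  have X: "X E \<in> nlists N (univ A)" for E
  proof -
    have "length (X E) = sum_list (map n [1..<k + 2])"
      unfolding X_def length_concat map_map o_def
      by (rule arg_cong[where f = sum_list], rule map_cong[OF refl ai(1)])
    moreover have "set (X E) \<subseteq> univ A" using ai(2) unfolding X_def set_concat by fastforce
    ultimately show ?thesis using sumn by (simp add: nlists_def)
  qed
  have \<rho>: "\<rho> E \<in> vals A" for E
    using X[of E] e by (auto simp: \<rho>_def nlists_def)
  have \<rho>_dep: "\<exists>j. \<forall>E E'. (j \<in> E \<longleftrightarrow> j \<in> E') \<longrightarrow> \<rho> E l = \<rho> E' l" for l
  proof (cases "l < N")
    case True
    then show ?thesis
      using concat_nth_depends[of "[1..<k + 2]" a n l] ai(1) sumn by (auto simp: \<rho>_def X_def)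
  qed (simp add: \<rho>_def)
  have tX: "t (X E) = eval A (\<rho> E) s" for E
    using X[of E] eval_cong_vars[OF s(1), of "\<lambda>i. X E ! i" "\<rho> E" A] by (simp add: s(2) \<rho>_def)
  have sU: "eval A (\<rho> E) s \<in> univ A" for E using eval_in[OF A \<rho> s(1)] .
  \<comment> \<open>A proper subset of \<open>{1..k}\<close> is a choice of tuples that is not
    constantly 2, and inserting \<open>k + 1\<close> switches the last block.\<close>
  have step: "eval A (\<rho> E) s = eval A (\<rho> (insert (k + 1) E)) s" if E: "E \<subset> {1..k}" for E
  proof -
    define f where "f = choice E"
    have f: "f \<in> {1..k} \<rightarrow> {1, 2}" by (simp add: f_def)
    have f2: "\<exists>i\<in>{1..k}. f i \<noteq> 2" using E by (auto simp: f_def)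
    have X1: "X E = concat (map (\<lambda>i. a i (f i)) [1..<k + 1]) @ a (k + 1) 1"
      using E unfolding X_split by (auto simp: f_def)
    have X2: "X (insert (k + 1) E) = concat (map (\<lambda>i. a i (f i)) [1..<k + 1]) @ a (k + 1) 2"
    proof -
      have "map (\<lambda>i. a i (choice (insert (k + 1) E) i)) [1..<k + 1] = map (\<lambda>i. a i (f i)) [1..<k + 1]"
        by (rule map_cong) (auto simp: f_def)
      then show ?thesis unfolding X_split by (simp only: insertI1 if_True)
    qed
    have "t (X E) = t (X (insert (k + 1) E))" unfolding X1 X2 using hyp f f2 by blast
    then show ?thesis by (simp add: tX)
  qed
  have "eval A (\<rho> {1..k}) s = eval A (\<rho> (insert (k + 1) {1..k})) s"
  proof (rule inj[OF sU sU])
    fix i assume i: "i < r"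
    have su: "s \<in> trms Sg UNIV" using trms_UNIV[OF s(1)] .
    have \<pi>s: "\<pi> i (eval A \<sigma> s) = eval (B i) (\<lambda>j. \<pi> i (\<sigma> j)) s" if "\<sigma> \<in> vals A" for \<sigma>
      by (rule hom_onto_eval[OF A \<pi>[OF i] that s(1)])
    have \<pi>v: "(\<lambda>j. \<pi> i (\<rho> E j)) \<in> vals (B i)" for E
      using \<rho>[of E] \<pi>[OF i] by (auto simp: hom_onto_def)
    have "[c (\<pi> i (eval A (\<rho> {1..k}) s)) = c (\<pi> i (eval A (\<rho> (insert (k + 1) {1..k})) s))] (mod int (p i))"
      if "c \<in> C i" for c
    proof -
      have "deg_le (C i) (p i) (d i) (vals (B i)) (\<lambda>\<sigma>. c (eval (B i) \<sigma> s))"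
        using C[OF i] su that by (auto simp: deg_coords_def)
      note top = deg_le_cube_top[OF this d[OF i], of "\<lambda>E j. \<pi> i (\<rho> E j)", OF \<pi>v]
      show ?thesis unfolding \<pi>s[OF \<rho>]
      proof (rule top)
        fix l show "\<exists>j. \<forall>E E'. (j \<in> E \<longleftrightarrow> j \<in> E') \<longrightarrow> \<pi> i (\<rho> E l) = \<pi> i (\<rho> E' l)"
          using \<rho>_dep[of l] by metis
      next
        fix E :: "nat set" assume "E \<subset> {1..k}"
        then show "[c (eval (B i) (\<lambda>j. \<pi> i (\<rho> E j)) s) =
          c (eval (B i) (\<lambda>j. \<pi> i (\<rho> (insert (k + 1) E) j)) s)] (mod int (p i))"
          unfolding \<pi>s[OF \<rho>, symmetric] by (simp only: step cong_refl)
      qed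
    qed
    moreover have "\<pi> i (eval A (\<rho> E) s) \<in> univ (B i)" for E
      using sU \<pi>[OF i] by (auto simp: hom_onto_def)
    ultimately show "\<pi> i (eval A (\<rho> {1..k}) s) = \<pi> i (eval A (\<rho> (insert (k + 1) {1..k})) s)"
      using C[OF i] unfolding deg_coords_def separates_def by blast
  qed
  then have "t (X {1..k}) = t (X (insert (k + 1) {1..k}))" by (simp add: tX)
  moreover have "map (\<lambda>i. a i (choice {1..k} i)) [1..<k + 1] = map (\<lambda>i. a i 2) [1..<k + 1]"
    "map (\<lambda>i. a i (choice (insert (k + 1) {1..k}) i)) [1..<k + 1] = map (\<lambda>i. a i 2) [1..<k + 1]"
    by (rule map_cong; auto)+
  moreover have "choice {1..k} (k + 1) = 1" "choice (insert (k + 1) {1..k}) (k + 1) = 2" by auto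
  ultimately show "t (concat (map (\<lambda>i. a i 2) [1..<k + 1]) @ a (k + 1) 1)
         = t (concat (map (\<lambda>i. a i 2) [1..<k + 1]) @ a (k + 1) 2)"
    by (simp only: X_split)
qed

section \<open>Counting term functions\<close>

text \<open>Term functions on valuations instead of lists, so that arbitrary sets of variables can
  be renamed, enlarged and compared.\<close>

definition tf :: "'f signature \<Rightarrow> ('f, 'a) alg \<Rightarrow> nat set \<Rightarrow> ((nat \<Rightarrow> 'a) \<Rightarrow> 'a) set" where
  "tf Sg A X = (\<lambda>t. \<lambda>\<rho>\<in>vals A. eval A \<rho> t) ` trms Sg X"

lemma tfI: "t \<in> trms Sg X \<Longrightarrow> (\<And>\<rho>. \<rho> \<in> vals A \<Longrightarrow> g \<rho> = eval A \<rho> t) \<Longrightarrow> restrict g (vals A) \<in> tf Sg A X"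
  unfolding tf_def by (rule image_eqI[of _ _ t]) (auto simp: restrict_def fun_eq_iff)

lemma tfE:
  assumes "g \<in> tf Sg A X"
  obtains t where "t \<in> trms Sg X" "g = (\<lambda>\<rho>\<in>vals A. eval A \<rho> t)"
  using assms unfolding tf_def by blast

lemma trms_mono: "t \<in> trms Sg X \<Longrightarrow> X \<subseteq> Y \<Longrightarrow> t \<in> trms Sg Y"
  by (induction rule: trms.induct) (auto intro: trms.intros)

lemma tf_mono: "X \<subseteq> Y \<Longrightarrow> tf Sg A X \<subseteq> tf Sg A Y"
  unfolding tf_def using trms_mono by blast

lemma tf_cong:
  assumes "g \<in> tf Sg A X" "\<rho> \<in> vals A" "\<sigma> \<in> vals A" "\<And>i. i \<in> X \<Longrightarrow> \<rho> i = \<sigma> i"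
  shows "g \<rho> = g \<sigma>"
proof -
  obtain t where t: "t \<in> trms Sg X" "g = (\<lambda>\<rho>\<in>vals A. eval A \<rho> t)" using assms(1) by (rule tfE)
  then show ?thesis using assms eval_cong_vars[OF t(1), of \<rho> \<sigma> A] by simp
qed

lemma tf_ext:
  assumes "g \<in> tf Sg A X" "h \<in> tf Sg A Y" "\<And>\<rho>. \<rho> \<in> vals A \<Longrightarrow> g \<rho> = h \<rho>"
  shows "g = h"
  using assms by (auto elim!: tfE intro!: restrict_ext)

lemma tf_in: "algebra Sg A \<Longrightarrow> g \<in> tf Sg A X \<Longrightarrow> \<rho> \<in> vals A \<Longrightarrow> g \<rho> \<in> univ A"
  using eval_in[of Sg A \<rho>] by (auto elim!: tfE simp del: mem_Collect_eq)

lemma tf_rename: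
  assumes "g \<in> tf Sg A X" "h ` X \<subseteq> Y"
  shows "(\<lambda>\<rho>\<in>vals A. g (\<lambda>i. \<rho> (h i))) \<in> tf Sg A Y"
proof -
  obtain t where t: "t \<in> trms Sg X" "g = (\<lambda>\<rho>\<in>vals A. eval A \<rho> t)" using assms(1) by (rule tfE)
  have "subst (\<lambda>i. Var (h i)) t \<in> trms Sg Y"
    by (rule subst_trms[OF t(1)], rule trms.Var) (use assms(2) in auto)
  then show ?thesis
  proof (rule tfI)
    fix \<rho> assume "\<rho> \<in> vals A"
    then have "(\<lambda>i. \<rho> (h i)) \<in> vals A" by auto
    then show "g (\<lambda>i. \<rho> (h i)) = eval A \<rho> (subst (\<lambda>i. Var (h i)) t)" by (simp add: t(2) eval_subst)
  qed
qed

lemma tf_proj: "i \<in> X \<Longrightarrow> (\<lambda>\<rho>\<in>vals A. \<rho> i) \<in> tf Sg A X"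
  by (rule tfI[of "Var i"]) (auto intro: trms.Var)

lemma tf_term_funs:
  assumes "algebra Sg A"
  shows "bij_betw (\<lambda>g. \<lambda>\<rho>\<in>vals A. g (map \<rho> [0..<n])) (term_funs Sg A n) (tf Sg A {..<n})"
proof -
  let ?\<Phi> = "\<lambda>g. \<lambda>\<rho>\<in>vals A. g (map \<rho> [0..<n])"
  obtain e where e: "e \<in> univ A" using assms by (auto simp: algebra_def)
  have map_in: "map \<rho> [0..<n] \<in> nlists n (univ A)" if "\<rho> \<in> vals A" for \<rho>
    using that by (auto simp: nlists_def)
  have \<Phi>: "?\<Phi> (\<lambda>xs\<in>nlists n (univ A). eval A (\<lambda>i. xs ! i) t) = (\<lambda>\<rho>\<in>vals A. eval A \<rho> t)"
    if "t \<in> trms Sg {..<n}" for t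
  proof (rule restrict_ext)
    fix \<rho> assume "\<rho> \<in> vals A"
    moreover have "eval A (\<lambda>i. map \<rho> [0..<n] ! i) t = eval A \<rho> t" by (rule eval_cong_vars[OF that]) simp
    ultimately show "(\<lambda>xs\<in>nlists n (univ A). eval A (\<lambda>i. xs ! i) t) (map \<rho> [0..<n]) = eval A \<rho> t"
      using map_in by simp
  qed
  have "inj_on ?\<Phi> (term_funs Sg A n)"
  proof (rule inj_onI)
    fix g h assume g: "g \<in> term_funs Sg A n" and h: "h \<in> term_funs Sg A n" and eq: "?\<Phi> g = ?\<Phi> h"
    show "g = h"
    proof
      fix xs
      show "g xs = h xs"
      proof (cases "xs \<in> nlists n (univ A)")
        case True
        define \<rho> where "\<rho> i = (if i < n then xs ! i else e)" for i
        have "\<rho> \<in> vals A" "map \<rho> [0..<n] = xs"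
          using True e by (auto simp: \<rho>_def nlists_def intro!: nth_equalityI)
        then show ?thesis using fun_cong[OF eq, of \<rho>] by simp
      next
        case False
        then show ?thesis using g h by (auto simp: term_funs_def)
      qed
    qed
  qed
  moreover have "?\<Phi> ` term_funs Sg A n = tf Sg A {..<n}"
    unfolding term_funs_def tf_def image_image using \<Phi> by (intro image_cong) auto
  ultimately show ?thesis by (simp add: bij_betw_def)
qed

lemma finite_tf:
  assumes A: "algebra Sg A" "finite (univ A)" and X: "finite X"
  shows "finite (tf Sg A X)"
proof -
  obtain n where n: "X \<subseteq> {..<n}" using X finite_nat_iff_bounded by blast
  have "finite (nlists n (univ A))"
    using finite_lists_length_eq[OF A(2), of n] by (simp add: nlists_def conj_commute)
  then have "finite (nlists n (univ A) \<rightarrow>\<^sub>E univ A)" using A(2) by (intro finite_PiE) auto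
  moreover have "term_funs Sg A n \<subseteq> nlists n (univ A) \<rightarrow>\<^sub>E univ A"
  proof
    fix g assume g: "g \<in> term_funs Sg A n"
    then obtain t where t: "t \<in> trms Sg {..<n}" "g = (\<lambda>xs\<in>nlists n (univ A). eval A (\<lambda>i. xs ! i) t)"
      unfolding term_funs_def by blast
    obtain e where e: "e \<in> univ A" using A(1) by (auto simp: algebra_def)
    have "eval A (\<lambda>i. xs ! i) t \<in> univ A" if "xs \<in> nlists n (univ A)" for xs
    proof -
      have "eval A (\<lambda>i. if i < n then xs ! i else e) t \<in> univ A"
        using that e by (intro eval_in[OF A(1) _ t(1)]) (auto simp: nlists_def)
      also have "eval A (\<lambda>i. if i < n then xs ! i else e) t = eval A (\<lambda>i. xs ! i) t"
        by (rule eval_cong_vars[OF t(1)]) simp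
      finally show ?thesis .
    qed
    then show "g \<in> nlists n (univ A) \<rightarrow>\<^sub>E univ A" by (auto simp: t(2))
  qed
  ultimately have "finite (term_funs Sg A n)" by (rule finite_subset[rotated])
  then have "finite (tf Sg A {..<n})" using bij_betw_finite[OF tf_term_funs[OF A(1)]] by blast
  then show ?thesis by (rule finite_subset[OF tf_mono[OF n]])
qed

text \<open>Variable \<open>0\<close> plays the role of a zero element.\<close>

definition absorbing :: "'f signature \<Rightarrow> ('f, 'a) alg \<Rightarrow> nat set \<Rightarrow> nat set \<Rightarrow> ((nat \<Rightarrow> 'a) \<Rightarrow> 'a) set" where
  "absorbing Sg A S X = {g \<in> tf Sg A ({0} \<union> S \<union> X). \<forall>s\<in>S. \<forall>\<rho>\<in>vals A. \<rho> s = \<rho> 0 \<longrightarrow> g \<rho> = \<rho> 0}"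

lemma card_absorbing_le:
  fixes A :: "('f, 'a) alg"
  assumes A: "algebra Sg A" "finite (univ A)" and T: "finite T'" "bij_betw h T T'" "0 \<notin> T" "0 \<notin> T'"
  shows "card (absorbing Sg A T {}) \<le> card (absorbing Sg A T' {})"
proof -
  define h' where "h' i = (if i \<in> T then h i else 0)" for i
  define k' where "k' i = (if i \<in> T' then inv_into T h i else 0)" for i
  define \<Psi> where "\<Psi> g = (\<lambda>\<rho>\<in>vals A. g (\<lambda>i. \<rho> (h' i)))" for g :: "(nat \<Rightarrow> 'a) \<Rightarrow> 'a"
  have h: "h ` T = T'" "inj_on h T" using T(2) by (auto simp: bij_betw_def)
  have kh: "k' (h' i) = i" if "i \<in> {0} \<union> T" for i
    using that h T(3,4) by (auto simp: k'_def h'_def)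
  show ?thesis
  proof (rule card_inj_on_le)
    show "finite (absorbing Sg A T' {})"
      by (rule finite_subset[OF _ finite_tf[OF A, of "{0} \<union> T'"]]) (use T(1) in \<open>auto simp: absorbing_def\<close>)
    show "\<Psi> ` absorbing Sg A T {} \<subseteq> absorbing Sg A T' {}"
    proof (intro image_subsetI)
      fix g assume g: "g \<in> absorbing Sg A T {}"
      have "\<Psi> g \<in> tf Sg A ({0} \<union> T')" unfolding \<Psi>_def
        by (rule tf_rename[of _ _ _ "{0} \<union> T"]) (use g h in \<open>auto simp: absorbing_def h'_def\<close>)
      moreover have "\<Psi> g \<rho> = \<rho> 0" if s': "s' \<in> T'" "\<rho> \<in> vals A" "\<rho> s' = \<rho> 0" for s' \<rho>
      proof -
        obtain s where s: "s \<in> T" "s' = h s" using h s'(1) by blast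
        let ?\<sigma> = "\<lambda>i. \<rho> (h' i)"
        have "?\<sigma> \<in> vals A" "?\<sigma> s = ?\<sigma> 0" "?\<sigma> 0 = \<rho> 0" using s' s T(3) by (auto simp: h'_def)
        then have "g ?\<sigma> = \<rho> 0" using g s(1) unfolding absorbing_def by fastforce
        then show ?thesis using s'(2) by (simp add: \<Psi>_def)
      qed
      ultimately show "\<Psi> g \<in> absorbing Sg A T' {}" by (simp add: absorbing_def)
    qed
    show "inj_on \<Psi> (absorbing Sg A T {})"
    proof (rule inj_onI)
      fix g g' assume g: "g \<in> absorbing Sg A T {}" "g' \<in> absorbing Sg A T {}" and eq: "\<Psi> g = \<Psi> g'"
      have tf: "g \<in> tf Sg A ({0} \<union> T)" "g' \<in> tf Sg A ({0} \<union> T)" using g by (auto simp: absorbing_def)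
      show "g = g'"
      proof (rule tf_ext[OF tf])
        fix \<rho> assume \<rho>: "\<rho> \<in> vals A"
        let ?\<sigma> = "\<lambda>i. \<rho> (k' i)"
        have \<sigma>: "?\<sigma> \<in> vals A" "(\<lambda>i. ?\<sigma> (h' i)) \<in> vals A" using \<rho> by auto
        have "g \<rho> = g (\<lambda>i. ?\<sigma> (h' i))" "g' \<rho> = g' (\<lambda>i. ?\<sigma> (h' i))"
          by (rule tf_cong[OF _ \<rho> \<sigma>(2)], rule tf, simp add: kh)+
        moreover have "g (\<lambda>i. ?\<sigma> (h' i)) = g' (\<lambda>i. ?\<sigma> (h' i))"
          using fun_cong[OF eq, of ?\<sigma>] \<sigma>(1) by (simp add: \<Psi>_def)
        ultimately show "g \<rho> = g' \<rho>" by simp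
      qed
    qed
  qed
qed

lemma card_absorbing_eq:
  assumes A: "algebra Sg A" "finite (univ A)" and T: "finite T" "finite T'" "card T = card T'" "0 \<notin> T" "0 \<notin> T'"
  shows "card (absorbing Sg A T {}) = card (absorbing Sg A T' {})"
proof -
  obtain h where h: "bij_betw h T T'" using T finite_same_card_bij by blast
  show ?thesis
    using card_absorbing_le[OF A T(2) h T(4,5)] card_absorbing_le[OF A T(1) bij_betw_inv_into[OF h] T(5,4)]
    by simp
qed

section \<open>Factoring the number of term functions\<close>

context malcev_algebra
begin

lemma tf_P:
  assumes "g \<in> tf Sg A X" "h \<in> tf Sg A X" "k \<in> tf Sg A X"
  shows "(\<lambda>\<rho>\<in>vals A. P (g \<rho>) (h \<rho>) (k \<rho>)) \<in> tf Sg A X"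
proof -
  obtain t where t: "t \<in> trms Sg X" "g = (\<lambda>\<rho>\<in>vals A. eval A \<rho> t)" using assms(1) by (rule tfE)
  obtain u where u: "u \<in> trms Sg X" "h = (\<lambda>\<rho>\<in>vals A. eval A \<rho> u)" using assms(2) by (rule tfE)
  obtain v where v: "v \<in> trms Sg X" "k = (\<lambda>\<rho>\<in>vals A. eval A \<rho> v)" using assms(3) by (rule tfE)
  have "subst (tri t u v) q \<in> trms Sg X"
    by (rule subst_trms[OF q_trm]) (auto simp: tri_def t u v)
  then show ?thesis
    by (rule tfI) (simp add: t u v P_def eval_subst tri_app)
qed

text \<open>Replacing \<open>v\<close> by variable 0 (\<open>er\<close>) retracts the functions onto
  those without \<open>v\<close>. The fibre over the projection to variable 0 consists of the
  functions absorbing at \<open>v\<close>, and all fibres have the same size by translation, which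
  is injective because the algebra has a central series.\<close>

lemma card_absorbing_insert:
  assumes fin: "finite (univ A)" and S: "central_series Sg A k \<theta>"
    and X: "finite X" "finite S" "v \<notin> X" "v \<notin> S" "v \<noteq> 0"
  shows "card (absorbing Sg A S (insert v X)) = card (absorbing Sg A S X) * card (absorbing Sg A (insert v S) X)"
proof -
  let ?V = "{0} \<union> S \<union> insert v X"
  define T where "T = absorbing Sg A S (insert v X)"
  define er where "er g = (\<lambda>\<rho>\<in>vals A. g (\<rho>(v := \<rho> 0)))" for g :: "(nat \<Rightarrow> 'a) \<Rightarrow> 'a"
  define z :: "(nat \<Rightarrow> 'a) \<Rightarrow> 'a" where "z = (\<lambda>\<rho>\<in>vals A. \<rho> 0)"
  define F where "F r = {g \<in> T. er g = r}" for r
  have upd: "\<rho>(v := \<rho> 0) \<in> vals A" if "\<rho> \<in> vals A" for \<rho> using that by auto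
  have Ttf: "g \<in> tf Sg A ?V" if "g \<in> T" for g using that by (simp add: T_def absorbing_def)
  have Tabs: "g \<rho> = \<rho> 0" if "g \<in> T" "s \<in> S" "\<rho> \<in> vals A" "\<rho> s = \<rho> 0" for g s \<rho>
    using that by (auto simp: T_def absorbing_def)
  have finT: "finite T" using finite_tf[OF alg fin, of ?V] X by (rule_tac finite_subset[of _ "tf Sg A ?V"]) (use Ttf in auto)
  have sub: "absorbing Sg A S X \<subseteq> T"
    using tf_mono[of "{0} \<union> S \<union> X" ?V Sg A] by (auto simp: T_def absorbing_def)
  have er_id: "er r = r" if "r \<in> absorbing Sg A S X" for r
  proof -
    have r: "r \<in> tf Sg A ({0} \<union> S \<union> X)" using that by (simp add: absorbing_def)
    then obtain t where "r = (\<lambda>\<rho>\<in>vals A. eval A \<rho> t)" by (rule tfE)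
    then have "r = restrict r (vals A)" by simp
    moreover have "er r = restrict r (vals A)" unfolding er_def
      by (rule restrict_ext, rule tf_cong[OF r upd]) (use X in auto)
    ultimately show ?thesis by simp
  qed
  have er_in: "er g \<in> absorbing Sg A S X" if g: "g \<in> T" for g
  proof -
    have "(\<lambda>\<rho>\<in>vals A. g (\<lambda>i. \<rho> ((id(v := 0)) i))) \<in> tf Sg A ({0} \<union> S \<union> X)"
      by (rule tf_rename[OF Ttf[OF g]]) auto
    moreover have "(\<lambda>i. \<rho> ((id(v := 0)) i)) = \<rho>(v := \<rho> 0)" for \<rho> :: "nat \<Rightarrow> 'a" by auto
    ultimately have "er g \<in> tf Sg A ({0} \<union> S \<union> X)" by (simp only: er_def)
    moreover have "er g \<rho> = \<rho> 0" if "s \<in> S" "\<rho> \<in> vals A" "\<rho> s = \<rho> 0" for s \<rho>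
    proof -
      have "g (\<rho>(v := \<rho> 0)) = (\<rho>(v := \<rho> 0)) 0"
        by (rule Tabs[OF g that(1) upd[OF that(2)]]) (use that X in auto)
      then show ?thesis using that X by (simp add: er_def)
    qed
    ultimately show ?thesis by (simp add: absorbing_def)
  qed
  have er_T: "er ` T = absorbing Sg A S X" using er_in er_id sub by force
  have Fz: "F z = absorbing Sg A (insert v S) X"
  proof
    show "F z \<subseteq> absorbing Sg A (insert v S) X"
    proof
      fix g assume "g \<in> F z"
      then have g: "g \<in> T" "er g = z" by (auto simp: F_def)
      have "g \<rho> = \<rho> 0" if "\<rho> \<in> vals A" "\<rho> v = \<rho> 0" for \<rho>
      proof -
        have "\<rho>(v := \<rho> 0) = \<rho>" using that(2) by (metis fun_upd_triv)
        then show ?thesis using fun_cong[OF g(2), of \<rho>] that(1) by (simp add: er_def z_def)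
      qed
      moreover have "{0} \<union> insert v S \<union> X = ?V" by auto
      ultimately show "g \<in> absorbing Sg A (insert v S) X"
        using Ttf[OF g(1)] Tabs[OF g(1)] by (auto simp only: absorbing_def mem_Collect_eq insert_iff)
    qed
    show "absorbing Sg A (insert v S) X \<subseteq> F z"
    proof
      fix g assume g: "g \<in> absorbing Sg A (insert v S) X"
      have V: "{0} \<union> insert v S \<union> X = ?V" by auto
      have "g \<in> T" using g unfolding T_def absorbing_def V by blast
      moreover have "er g = z" unfolding er_def z_def
      proof (rule restrict_ext)
        fix \<rho> assume "\<rho> \<in> vals A"
        then have "g (\<rho>(v := \<rho> 0)) = (\<rho>(v := \<rho> 0)) 0" using g upd X unfolding absorbing_def by auto
        then show "g (\<rho>(v := \<rho> 0)) = \<rho> 0" using X by simp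
      qed
      ultimately show "g \<in> F z" by (simp add: F_def)
    qed
  qed
  have z: "z \<in> absorbing Sg A S X"
    unfolding absorbing_def z_def using tf_proj[of 0 "{0} \<union> S \<union> X"] by simp
  note tin = tf_in[OF alg]
  \<comment> \<open>Translations embed any two fibres of \<open>er\<close> into each other.\<close>
  have trans: "(\<lambda>\<rho>\<in>vals A. P (g \<rho>) (r \<rho>) (r' \<rho>)) \<in> F r'"
    if r: "r \<in> absorbing Sg A S X" "r' \<in> absorbing Sg A S X" and g: "g \<in> F r" for r r' g
  proof -
    have gT: "g \<in> T" and eg: "er g = r" using g by (auto simp: F_def)
    have rT: "r \<in> T" "r' \<in> T" using r sub by auto
    let ?g = "\<lambda>\<rho>\<in>vals A. P (g \<rho>) (r \<rho>) (r' \<rho>)"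
    have "?g \<in> tf Sg A ?V" by (rule tf_P[OF Ttf[OF gT] Ttf[OF rT(1)] Ttf[OF rT(2)]])
    moreover have "?g \<rho> = \<rho> 0" if "s \<in> S" "\<rho> \<in> vals A" "\<rho> s = \<rho> 0" for s \<rho>
    proof -
      have "\<rho> 0 \<in> univ A" using that(2) by auto
      then show ?thesis using Tabs[OF gT that] Tabs[OF rT(1) that] Tabs[OF rT(2) that] that(2) by simp
    qed
    ultimately have "?g \<in> T" by (simp add: T_def absorbing_def)
    moreover have "er ?g = er r'" unfolding er_def
    proof (rule restrict_ext)
      fix \<rho> assume \<rho>: "\<rho> \<in> vals A"
      have "g (\<rho>(v := \<rho> 0)) = r \<rho>" using fun_cong[OF eg, of \<rho>] \<rho> by (simp add: er_def)
      moreover have "r (\<rho>(v := \<rho> 0)) = r \<rho>" using fun_cong[OF er_id[OF r(1)], of \<rho>] \<rho> by (simp add: er_def)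
      moreover have "r \<rho> \<in> univ A" "r' (\<rho>(v := \<rho> 0)) \<in> univ A"
        using tin[OF Ttf[OF rT(1)] \<rho>] tin[OF Ttf[OF rT(2)] upd[OF \<rho>]] .
      ultimately show "?g (\<rho>(v := \<rho> 0)) = r' (\<rho>(v := \<rho> 0))" using upd[OF \<rho>] by simp
    qed
    ultimately show ?thesis using er_id[OF r(2)] by (simp add: F_def)
  qed
  have le: "card (F r) \<le> card (F r')" if r: "r \<in> absorbing Sg A S X" "r' \<in> absorbing Sg A S X" for r r'
  proof (rule card_inj_on_le)
    show "finite (F r')" using finT by (simp add: F_def)
    show "(\<lambda>g. \<lambda>\<rho>\<in>vals A. P (g \<rho>) (r \<rho>) (r' \<rho>)) ` F r \<subseteq> F r'" using trans[OF r] by blast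
    show "inj_on (\<lambda>g. \<lambda>\<rho>\<in>vals A. P (g \<rho>) (r \<rho>) (r' \<rho>)) (F r)"
    proof (rule inj_onI)
      fix g h assume gh: "g \<in> F r" "h \<in> F r"
        and eq: "(\<lambda>\<rho>\<in>vals A. P (g \<rho>) (r \<rho>) (r' \<rho>)) = (\<lambda>\<rho>\<in>vals A. P (h \<rho>) (r \<rho>) (r' \<rho>))"
      have T: "g \<in> T" "h \<in> T" "r \<in> T" "r' \<in> T" using gh r sub by (auto simp: F_def)
      show "g = h"
      proof (rule tf_ext[OF Ttf[OF T(1)] Ttf[OF T(2)]])
        fix \<rho> assume \<rho>: "\<rho> \<in> vals A"
        have "P (g \<rho>) (r \<rho>) (r' \<rho>) = P (h \<rho>) (r \<rho>) (r' \<rho>)" using fun_cong[OF eq, of \<rho>] \<rho> by simp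
        then show "g \<rho> = h \<rho>" by (rule P_inj_central[OF S, rotated -1]) (rule tin[OF Ttf \<rho>], rule T)+
      qed
    qed
  qed
  have "card T = (\<Sum>r\<in>er ` T. card (F r))"
    using sum.image_gen[OF finT, of "\<lambda>_. 1::nat" er] by (simp add: F_def)
  also have "\<dots> = (\<Sum>r\<in>absorbing Sg A S X. card (F z))"
    unfolding er_T using le z by (intro sum.cong) (auto intro: antisym)
  finally show ?thesis by (simp add: T_def Fz)
qed

text \<open>Repeated splitting decides for every variable of \<open>X\<close> whether it is
  absorbing; \<open>Y\<close> collects those that are.\<close>

lemma card_absorbing_prod:
  assumes fin: "finite (univ A)" and S: "central_series Sg A k \<theta>"
    and X: "finite X" "finite T" "T \<inter> X = {}" "0 \<notin> T \<union> X"
  shows "card (absorbing Sg A T X) = (\<Prod>Y\<in>Pow X. card (absorbing Sg A (T \<union> Y) {}))"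
  using X
proof (induction X arbitrary: T rule: finite_induct)
  case (insert v X)
  have inj: "inj_on (insert v) (Pow X)" using insert.hyps by (auto simp: inj_on_def)
  have "card (absorbing Sg A T (insert v X)) = card (absorbing Sg A T X) * card (absorbing Sg A (insert v T) X)"
    using insert by (intro card_absorbing_insert[OF fin S]) auto
  also have "card (absorbing Sg A T X) = (\<Prod>Y\<in>Pow X. card (absorbing Sg A (T \<union> Y) {}))"
    using insert by (intro insert.IH) auto
  also have "card (absorbing Sg A (insert v T) X) = (\<Prod>Y\<in>Pow X. card (absorbing Sg A (insert v T \<union> Y) {}))"
    using insert by (intro insert.IH) auto
  also have "\<dots> = (\<Prod>Y\<in>insert v ` Pow X. card (absorbing Sg A (T \<union> Y) {}))"
    by (simp add: prod.reindex[OF inj])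
  also have "(\<Prod>Y\<in>Pow X. card (absorbing Sg A (T \<union> Y) {})) * (\<Prod>Y\<in>insert v ` Pow X. card (absorbing Sg A (T \<union> Y) {}))
     = (\<Prod>Y\<in>Pow (insert v X). card (absorbing Sg A (T \<union> Y) {}))"
    unfolding Pow_insert using insert.hyps by (intro prod.union_disjoint[symmetric]) auto
  finally show ?case .
qed simp

end

text \<open>The blocks are the single variables \<open>1\<close> to \<open>k\<close> and, as the last block, variable
  \<open>0\<close> together with all remaining variables.\<close>

lemma supernilpotent_absorbing:
  assumes A: "algebra Sg A" and sn: "supernilpotent k Sg A" and N: "k < N"
    and g: "g \<in> absorbing Sg A {1..N} {}" and \<rho>: "\<rho> \<in> vals A"
  shows "g \<rho> = \<rho> 0"
proof -
  obtain t where t: "t \<in> trms Sg ({0} \<union> {1..N})" "g = (\<lambda>\<rho>\<in>vals A. eval A \<rho> t)"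
    using g by (auto simp: absorbing_def elim: tfE)
  have abs: "eval A \<sigma> t = \<sigma> 0" if "\<sigma> \<in> vals A" "s \<in> {1..N}" "\<sigma> s = \<sigma> 0" for \<sigma> s
  proof -
    have "g \<sigma> = \<sigma> 0" using g that unfolding absorbing_def by blast
    then show ?thesis using that(1) by (simp add: t(2))
  qed
  \<comment> \<open>The place of each variable in the concatenated tuple: variable 0 opens the last
    block at position \<open>k\<close>, the variables 1 to \<open>k\<close> move down by one, and
    the others keep their index.\<close>
  define pos where "pos i = (if i = 0 then k else if i \<le> k then i - 1 else i)" for i
  define u where "u = subst (\<lambda>i. Var (pos i)) t"
  have u: "u \<in> trms Sg {..<N + 1}" unfolding u_def
    by (rule subst_trms[OF t(1)], rule trms.Var) (use N in \<open>auto simp: pos_def\<close>)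
  define n where "n i = (if i = k + 1 then N + 1 - k else 1)" for i :: nat
  \<comment> \<open>The first tuple of each block sets its variables to the zero element
    \<open>\<rho> 0\<close>, the second gives them their values under \<rho>.\<close>
  define a where "a i j = (if i = k + 1 then \<rho> 0 # map (\<lambda>l. if j = 2 then \<rho> l else \<rho> 0) [k + 1..<N + 1]
     else [if j = 2 then \<rho> i else \<rho> 0])" for i j :: nat
  have \<rho>U: "\<rho> i \<in> univ A" for i using \<rho> by auto
  have an: "\<forall>i\<in>{1..k + 1}. \<forall>j\<in>{1, 2}. a i j \<in> nlists (n i) (univ A)"
    using \<rho>U N by (auto simp: a_def n_def nlists_def)
  have sn': "(\<Sum>i = 1..k + 1. n i) = N + 1"
  proof -
    have "(\<Sum>i = 1..k + 1. n i) = (\<Sum>i = 1..k. n i) + n (k + 1)" by simp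
    also have "(\<Sum>i = 1..k. n i) = (\<Sum>i = 1..k. 1)" by (rule sum.cong) (auto simp: n_def)
    finally show ?thesis using N by (simp add: n_def)
  qed
  define tt where "tt = (\<lambda>xs\<in>nlists (N + 1) (univ A). eval A (\<lambda>i. xs ! i) u)"
  have tt: "tt \<in> term_funs Sg A (\<Sum>i = 1..k + 1. n i)"
    unfolding sn' term_funs_def tt_def using u by blast
  have conc: "concat (map (\<lambda>i. a i (f i)) [1..<k + 1]) @ a (k + 1) j =
     map (\<lambda>i. if f i = 2 then \<rho> i else \<rho> 0) [1..<k + 1] @ \<rho> 0 # map (\<lambda>l. if j = 2 then \<rho> l else \<rho> 0) [k + 1..<N + 1]" for f j
  proof -
    have "map (\<lambda>i. a i (f i)) [1..<k + 1] = map (\<lambda>i. [if f i = 2 then \<rho> i else \<rho> 0]) [1..<k + 1]"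
      by (rule map_cong) (auto simp: a_def)
    then have "concat (map (\<lambda>i. a i (f i)) [1..<k + 1]) = map (\<lambda>i. if f i = 2 then \<rho> i else \<rho> 0) [1..<k + 1]"
      by (simp only: concat_map_singleton)
    then show ?thesis by (simp only: a_def if_True refl)
  qed
  define \<tau> where "\<tau> f j i = (if i \<in> {1..k} \<and> f i \<noteq> 2 \<or> i \<in> {k + 1..N} \<and> j \<noteq> 2 then \<rho> 0 else \<rho> i)" for f :: "nat \<Rightarrow> nat" and j i :: nat
  have \<tau>: "\<tau> f j \<in> vals A" "\<tau> f j 0 = \<rho> 0" for f j using \<rho>U by (auto simp: \<tau>_def)
  have val: "tt (concat (map (\<lambda>i. a i (f i)) [1..<k + 1]) @ a (k + 1) j) = eval A (\<tau> f j) t" for f j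
  proof -
    let ?l = "map (\<lambda>i. if f i = 2 then \<rho> i else \<rho> 0) [1..<k + 1] @ \<rho> 0 # map (\<lambda>l. if j = 2 then \<rho> l else \<rho> 0) [k + 1..<N + 1]"
    have "?l \<in> nlists (N + 1) (univ A)" using \<rho>U N by (auto simp: nlists_def)
    then have "tt ?l = eval A (\<lambda>i. ?l ! pos i) t" by (simp only: tt_def u_def eval_subst eval.simps restrict_apply if_True)
    also have "\<dots> = eval A (\<tau> f j) t"
    proof (rule eval_cong_vars[OF t(1)])
      fix i assume i: "i \<in> {0} \<union> {1..N}"
      consider "i = 0" | "1 \<le> i" "i \<le> k" | "k < i" by linarith
      then show "?l ! pos i = \<tau> f j i"
      proof cases
        case 1
        then show ?thesis by (simp add: pos_def nth_append \<tau>_def del: upt_Suc)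
      next
        case 2
        then have "?l ! pos i = (if f i = 2 then \<rho> i else \<rho> 0)"
          using 2 by (cases i) (simp_all add: pos_def nth_append del: upt_Suc)
        then show ?thesis using 2 by (simp add: \<tau>_def)
      next
        case 3
        then obtain d where d: "i = k + Suc d" using less_iff_Suc_add by auto
        have "?l ! pos i = (if j = 2 then \<rho> i else \<rho> 0)"
          using i d by (simp add: pos_def nth_append del: upt_Suc)
        then show ?thesis using 3 i by (simp add: \<tau>_def)
      qed
    qed
    finally show ?thesis unfolding conc .
  qed
  have "eval A (\<tau> (\<lambda>_. 2) 1) t = eval A (\<tau> (\<lambda>_. 2) 2) t"
  proof -
    have "\<forall>f\<in>{1..k} \<rightarrow> {1, 2}. (\<exists>i\<in>{1..k}. f i \<noteq> 2) \<longrightarrow>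
        tt (concat (map (\<lambda>i. a i (f i)) [1..<k + 1]) @ a (k + 1) 1)
      = tt (concat (map (\<lambda>i. a i (f i)) [1..<k + 1]) @ a (k + 1) 2)"
    proof (intro ballI impI)
      fix f :: "nat \<Rightarrow> nat" assume "\<exists>i\<in>{1..k}. f i \<noteq> 2"
      then obtain i where i: "i \<in> {1..k}" "f i \<noteq> 2" by blast
      have "eval A (\<tau> f j) t = \<rho> 0" for j
        using abs[OF \<tau>(1), of i f j] i N \<tau>(2) by (auto simp: \<tau>_def)
      then show "tt (concat (map (\<lambda>i. a i (f i)) [1..<k + 1]) @ a (k + 1) 1)
        = tt (concat (map (\<lambda>i. a i (f i)) [1..<k + 1]) @ a (k + 1) 2)" unfolding val by simp
    qed
    then have "tt (concat (map (\<lambda>i. a i 2) [1..<k + 1]) @ a (k + 1) 1)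
      = tt (concat (map (\<lambda>i. a i 2) [1..<k + 1]) @ a (k + 1) 2)"
      using sn an tt unfolding supernilpotent_def by blast
    then show ?thesis using val[of "\<lambda>_. 2"] by simp
  qed
  \<comment> \<open>As \<open>k < N\<close>, the last block contains variable \<open>k + 1\<close>,
    which its first tuple sets to the zero element; so the term absorbs.\<close>
  moreover have "eval A (\<tau> (\<lambda>_. 2) 1) t = \<rho> 0"
    using abs[OF \<tau>(1), of "k + 1" "\<lambda>_. 2" 1] N \<tau>(2) by (auto simp: \<tau>_def)
  moreover have "\<tau> (\<lambda>_. 2) 2 = \<rho>" by (auto simp: \<tau>_def)
  ultimately show ?thesis using \<rho> by (simp add: t(2))
qed

lemma card_absorbing_supernilpotent:
  assumes A: "algebra Sg A" and sn: "supernilpotent k Sg A" and N: "k < N"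
  shows "card (absorbing Sg A {1..N} {}) = 1"
proof -
  have "absorbing Sg A {1..N} {} = {\<lambda>\<rho>\<in>vals A. \<rho> 0}"
  proof
    show "absorbing Sg A {1..N} {} \<subseteq> {\<lambda>\<rho>\<in>vals A. \<rho> 0}"
    proof
      fix g assume g: "g \<in> absorbing Sg A {1..N} {}"
      have "g = (\<lambda>\<rho>\<in>vals A. \<rho> 0)"
        by (rule tf_ext[of _ Sg A "{0} \<union> {1..N}" _ "{0}"])
          (use g supernilpotent_absorbing[OF A sn N g] tf_proj[of 0 "{0}"] in \<open>auto simp: absorbing_def\<close>)
      then show "g \<in> {\<lambda>\<rho>\<in>vals A. \<rho> 0}" by simp
    qed
    show "{\<lambda>\<rho>\<in>vals A. \<rho> 0} \<subseteq> absorbing Sg A {1..N} {}"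
      unfolding absorbing_def using tf_proj[of 0 "{0} \<union> {1..N}"] by auto
  qed
  then show ?thesis by simp
qed

section \<open>The free spectrum as a power of two\<close>

lemma sum_Pow_card:
  fixes g :: "nat \<Rightarrow> real"
  assumes "finite X"
  shows "(\<Sum>Y\<in>Pow X. g (card Y)) = (\<Sum>i\<le>card X. real (card X choose i) * g i)"
proof -
  have "(\<Sum>Y\<in>Pow X. g (card Y)) = (\<Sum>i\<le>card X. \<Sum>Y\<in>{Y\<in>Pow X. card Y = i}. g (card Y))"
    by (rule sum.group[symmetric]) (use assms in \<open>auto intro: card_mono\<close>)
  also have "\<dots> = (\<Sum>i\<le>card X. real (card X choose i) * g i)"
  proof (rule sum.cong)
    fix i
    have "(\<Sum>Y\<in>{Y\<in>Pow X. card Y = i}. g (card Y)) = (\<Sum>Y\<in>{Y\<in>Pow X. card Y = i}. g i)"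
      by (rule sum.cong) auto
    also have "\<dots> = real (card {Y. Y \<subseteq> X \<and> card Y = i}) * g i" by simp
    finally show "(\<Sum>Y\<in>{Y\<in>Pow X. card Y = i}. g (card Y)) = real (card X choose i) * g i"
      unfolding n_subsets[OF assms] .
  qed simp
  finally show ?thesis .
qed

text \<open>The binomial coefficient of \<open>n - 1\<close> over \<open>i\<close> as a polynomial
  in \<open>n\<close>: one of the \<open>n\<close> variables is spent on the zero element, hence the
  shift by one in the roots.\<close>

definition binomial_poly :: "nat \<Rightarrow> real poly" where
  "binomial_poly i = smult (1 / fact i) (\<Prod>j<i. [:- real (j + 1), 1:])"

lemma degree_binomial_poly: "degree (binomial_poly i) \<le> i"
proof -
  have "degree (\<Prod>j<i. [:- real (j + 1), 1:]) \<le> i"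
    using degree_prod_sum_le[of "{..<i}" "\<lambda>j. [:- real (j + 1), 1:]"] by simp
  then show ?thesis unfolding binomial_poly_def using degree_smult_le le_trans by blast
qed

lemma poly_binomial_poly:
  assumes "n \<ge> 1"
  shows "poly (binomial_poly i) (real n) = real (n - 1 choose i)"
proof -
  have "real (n - 1 choose i) = real (n - 1) gchoose i" by (simp add: binomial_gbinomial)
  also have "\<dots> = (\<Prod>j<i. real (n - 1) - real j) / fact i"
    by (simp add: gbinomial_prod_rev lessThan_atLeast0)
  also have "(\<Prod>j<i. real (n - 1) - real j) = (\<Prod>j<i. - real (j + 1) + real n)"
    using assms by (intro prod.cong) (auto simp: of_nat_diff)
  finally show ?thesis by (simp add: binomial_poly_def poly_prod)
qed

text \<open>With \<open>c i\<close> the number of absorbing term functions in \<open>i\<close>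
  variables, each \<open>i\<close>-element set of nonzero variables contributes a factor
  \<open>c i\<close>. The logarithm is a combination of binomial coefficients, and it stops at
  \<open>k\<close> since \<open>c i = 1\<close> beyond.\<close>

lemma (in malcev_algebra) free_spectrum_polynomial:
  assumes fin: "finite (univ A)" and S: "central_series Sg A l \<theta>" and sn: "supernilpotent k Sg A"
  obtains p :: "real poly" where "degree p \<le> k" "\<And>n. n \<ge> 1 \<Longrightarrow> real (free_spectrum Sg A n) = 2 powr poly p (real n)"
proof -
  define c where "c i = card (absorbing Sg A {1..i} {})" for i
  have c1: "c i \<ge> 1" for i
  proof -
    have "(\<lambda>\<rho>\<in>vals A. \<rho> 0) \<in> absorbing Sg A {1..i} {}"
      unfolding absorbing_def using tf_proj[of 0 "{0} \<union> {1..i}"] by auto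
    moreover have "finite (absorbing Sg A {1..i} {})"
      by (rule finite_subset[OF _ finite_tf[OF alg fin, of "{0} \<union> {1..i}"]]) (auto simp: absorbing_def)
    ultimately have "card (absorbing Sg A {1..i} {}) > 0" by (metis card_gt_0_iff empty_iff)
    then show ?thesis by (simp add: c_def)
  qed
  have ck: "c i = 1" if "k < i" for i
    using card_absorbing_supernilpotent[OF alg sn that] by (simp add: c_def)
  define p where "p = (\<Sum>i\<le>k. smult (log 2 (real (c i))) (binomial_poly i))"
  have "degree p \<le> k" unfolding p_def
    by (rule degree_sum_le) (auto intro: order_trans[OF degree_smult_le] order_trans[OF degree_binomial_poly])
  moreover have "real (free_spectrum Sg A n) = 2 powr poly p (real n)" if n: "n \<ge> 1" for n
  proof -
    have "{..<n} = {0} \<union> {} \<union> {1..<n}" using n by auto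
    then have "tf Sg A {..<n} = absorbing Sg A {} {1..<n}" by (simp add: absorbing_def)
    then have "free_spectrum Sg A n = card (absorbing Sg A {} {1..<n})"
      using bij_betw_same_card[OF tf_term_funs[OF alg, of n]] by (simp add: free_spectrum_def)
    also have "\<dots> = (\<Prod>Y\<in>Pow {1..<n}. card (absorbing Sg A ({} \<union> Y) {}))"
      by (rule card_absorbing_prod[OF fin S]) auto
    also have "\<dots> = (\<Prod>Y\<in>Pow {1..<n}. c (card Y))"
    proof (rule prod.cong)
      fix Y assume "Y \<in> Pow {1..<n}"
      then have "finite Y" "0 \<notin> Y" using finite_subset by auto
      then show "card (absorbing Sg A ({} \<union> Y) {}) = c (card Y)"
        unfolding c_def using card_absorbing_eq[OF alg fin, of Y "{1..card Y}"] by simp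
    qed simp
    finally have f: "free_spectrum Sg A n = (\<Prod>Y\<in>Pow {1..<n}. c (card Y))" .
    have pos: "0 < free_spectrum Sg A n" unfolding f using c1 by (intro prod_pos) (simp add: Suc_le_eq)
    have "log 2 (real (free_spectrum Sg A n)) = (\<Sum>Y\<in>Pow {1..<n}. log 2 (real (c (card Y))))"
    proof -
      have "real (c i) \<noteq> 0" for i using c1[of i] by simp
      then show ?thesis unfolding f of_nat_prod log_def by (subst ln_prod) (simp_all add: sum_divide_distrib)
    qed
    also have "\<dots> = (\<Sum>i\<le>n - 1. real (n - 1 choose i) * log 2 (real (c i)))"
      using sum_Pow_card[of "{1..<n}" "\<lambda>i. log 2 (real (c i))"] by simp
    \<comment> \<open>A common range for both truncations: the binomial coefficients vanish beyond
      \<open>n - 1\<close>, the logarithms beyond \<open>k\<close>.\<close>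
    also have "\<dots> = (\<Sum>i\<le>max k (n - 1). real (n - 1 choose i) * log 2 (real (c i)))"
      by (rule sum.mono_neutral_left) (auto simp: binomial_eq_0)
    also have "\<dots> = (\<Sum>i\<le>k. real (n - 1 choose i) * log 2 (real (c i)))"
      by (rule sum.mono_neutral_right) (auto simp: ck)
    also have "\<dots> = poly p (real n)"
      using n by (simp add: p_def poly_sum poly_binomial_poly mult.commute)
    finally show ?thesis using pos by (metis of_nat_0_less_iff powr_log_cancel zero_less_numeral numeral_eq_one_iff semiring_norm(85))
  qed
  ultimately show ?thesis by (rule that)
qed

section \<open>Direct products\<close>

lemma isomorphic_prod_projections:
  fixes A :: "('f, 'a) alg" and B :: "nat \<Rightarrow> ('f, 'b) alg"
  assumes B: "\<And>i. i < r \<Longrightarrow> algebra Sg (B i)" and iso: "isomorphic Sg A (prod_alg {..<r} B)"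
  obtains \<pi> where "\<And>i. i < r \<Longrightarrow> hom_onto Sg A (B i) (\<pi> i)"
    "\<And>x y. x \<in> univ A \<Longrightarrow> y \<in> univ A \<Longrightarrow> (\<And>i. i < r \<Longrightarrow> \<pi> i x = \<pi> i y) \<Longrightarrow> x = y"
proof -
  obtain h where h: "bij_betw h (univ A) (\<Pi>\<^sub>E i\<in>{..<r}. univ (B i))"
    "\<And>f xs. f \<in> syms Sg \<Longrightarrow> xs \<in> nlists (arity Sg f) (univ A) \<Longrightarrow>
       h (interp A f xs) = interp (prod_alg {..<r} B) f (map h xs)"
    using iso unfolding isomorphic_def by (auto simp: prod_alg_def)
  have ne: "(\<Pi>\<^sub>E i\<in>{..<r}. univ (B i)) \<noteq> {}"
    using B by (auto simp: PiE_eq_empty_iff algebra_def)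
  show ?thesis
  proof (rule that[of "\<lambda>i x. h x i"])
    fix i assume i: "i < r"
    show "hom_onto Sg A (B i) (\<lambda>x. h x i)" unfolding hom_onto_def
    proof (intro conjI ballI allI impI)
      have "(\<lambda>x. h x i) ` univ A = (\<lambda>x. x i) ` (h ` univ A)" by (simp add: image_image)
      also have "\<dots> = (\<lambda>x. x i) ` (\<Pi>\<^sub>E i\<in>{..<r}. univ (B i))" using h(1) by (simp add: bij_betw_def)
      also have "\<dots> = univ (B i)" using ne i by (simp add: image_projection_PiE)
      finally show "(\<lambda>x. h x i) ` univ A = univ (B i)" .
      fix f xs assume "f \<in> syms Sg" "length xs = arity Sg f" "set xs \<subseteq> univ A"
      then have "h (interp A f xs) = interp (prod_alg {..<r} B) f (map h xs)"
        using h(2) by (simp add: nlists_def)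
      then show "h (interp A f xs) i = interp (B i) f (map (\<lambda>x. h x i) xs)"
        using i by (simp add: prod_alg_def o_def)
    qed
  next
    fix x y assume xy: "x \<in> univ A" "y \<in> univ A" "\<And>i. i < r \<Longrightarrow> h x i = h y i"
    then have "h x \<in> (\<Pi>\<^sub>E i\<in>{..<r}. univ (B i))" "h y \<in> (\<Pi>\<^sub>E i\<in>{..<r}. univ (B i))"
      using h(1) by (auto simp: bij_betw_def)
    then have "h x = h y" by (rule PiE_ext) (use xy in auto)
    then show "x = y" using h(1) xy by (auto simp: bij_betw_def inj_on_def)
  qed
qed

text \<open>Here \<open>b\<close> is the order of a factor and \<open>c\<close> that of the whole
  algebra. The base is at least 1, so the real power is monotone in the exponent; the truncated case
  \<open>h = 0\<close> is covered by \<open>c \<ge> 2\<close>.\<close>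

lemma power_le_powr_log:
  fixes c b m h :: nat
  assumes "1 \<le> m" "2 \<le> c" "b \<le> c" "2 ^ h \<le> b"
  shows "real ((m * (b - 1)) ^ (h - 1)) \<le> (real m * (real c - 1)) powr (log 2 (real c) - 1)"
proof -
  let ?x = "real (m * (c - 1))"
  have x: "?x = real m * (real c - 1)" "1 \<le> ?x"
  proof -
    show "?x = real m * (real c - 1)" using assms by (simp add: of_nat_diff)
    have "1 \<le> m * (c - 1)" using mult_le_mono[of 1 m 1 "c - 1"] assms by simp
    then show "1 \<le> ?x" using of_nat_mono[of 1 "m * (c - 1)", where 'a = real] by (simp only: of_nat_1)
  qed
  have "real ((m * (b - 1)) ^ (h - 1)) \<le> real ((m * (c - 1)) ^ (h - 1))"
    unfolding of_nat_le_iff using assms by (intro power_mono mult_le_mono diff_le_mono) auto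
  also have "\<dots> = ?x powr real (h - 1)"
    by (simp only: of_nat_power powr_realpow[OF less_le_trans[OF zero_less_one x(2)]])
  also have "\<dots> \<le> ?x powr (log 2 (real c) - 1)"
  proof (rule powr_mono[OF _ x(2)])
    have "2 ^ h \<le> c" using assms by linarith
    then have "real h \<le> log 2 (real c)" by (rule le_log2_of_power)
    moreover have "1 \<le> log 2 (real c)" using le_log2_of_power[of 1 c] assms by simp
    ultimately show "real (h - 1) \<le> log 2 (real c) - 1" by (cases h) auto
  qed
  finally show ?thesis unfolding x(1) .
qed

theorem corollary1p3:
  fixes Sg :: "'f signature" and A :: "('f, 'a) alg" and m :: nat and s :: real
  assumes "algebra Sg A"
    and "finite (univ A)"
    and "nilpotent Sg A"
    and "in_congruence_modular_variety Sg A"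
    and "product_of_prime_power_algebras Sg A"
    and "m \<ge> 1"
    and "\<forall>f\<in>syms Sg. arity Sg f \<le> m"
    and "card (univ A) > 1"
    and s: "s = (real m * (real (card (univ A)) - 1)) powr (log 2 (real (card (univ A))) - 1)"
  shows "supernilpotent (nat \<lfloor>s\<rfloor>) Sg A \<and>
    (\<exists>p :: real poly. real (degree p) \<le> s \<and>
       (\<forall>n\<ge>1. real (free_spectrum Sg A n) = 2 powr (poly p (real n))))"
proof -
  obtain k where S: "central_series Sg A k (lower_central Sg A)"
    using nilpotent_central_series[OF assms(1-3)] by blast
  obtain q where q: "malcev Sg A q" using malcev_term[OF assms(4) S] by blast
  interpret malcev_algebra Sg A q using assms(1) q by unfold_locales
  obtain r and B :: "nat \<Rightarrow> ('f, nat) alg" where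
    B: "\<And>i. i < r \<Longrightarrow> algebra Sg (B i) \<and> finite (univ (B i)) \<and> primepow (card (univ (B i)))"
    and iso: "isomorphic Sg A (prod_alg {..<r} B)"
    using assms(5) unfolding product_of_prime_power_algebras_def by blast
  obtain \<pi> where \<pi>: "\<And>i. i < r \<Longrightarrow> hom_onto Sg A (B i) (\<pi> i)"
    "\<And>x y. x \<in> univ A \<Longrightarrow> y \<in> univ A \<Longrightarrow> (\<And>i. i < r \<Longrightarrow> \<pi> i x = \<pi> i y) \<Longrightarrow> x = y"
    using isomorphic_prod_projections[OF _ iso] B by blast
  have "\<exists>p d C. deg_coords Sg (B i) p d C \<and> d \<le> nat \<lfloor>s\<rfloor>" if i: "i < r" for i
  proof -
    obtain p a where p: "prime p" "card (univ (B i)) = p ^ a"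
      using B[OF i] unfolding primepow_def by blast
    obtain C d h where *: "deg_coords Sg (B i) p d C" "2 ^ h \<le> card (univ (B i))"
      "d \<le> (m * (card (univ (B i)) - 1)) ^ (h - 1)"
      using prime_power_deg_coords[OF p(1) assms(7), of "B i" q k] B[OF i] p(2)
        hom_onto_malcev[OF alg \<pi>(1)[OF i] malc] image_central_series[OF \<pi>(1)[OF i] S] by blast
    \<comment> \<open>A factor is an image of \<open>A\<close>, so its order is at most that of
      \<open>A\<close> and the single bound \<open>s\<close> serves all factors.\<close>
    have "univ (B i) = \<pi> i ` univ A" using \<pi>(1)[OF i] by (simp add: hom_onto_def)
    then have "card (univ (B i)) \<le> card (univ A)" using card_image_le[OF assms(2)] by simp
    then have "real ((m * (card (univ (B i)) - 1)) ^ (h - 1)) \<le> s"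
      unfolding s using assms(6,8) *(2) by (intro power_le_powr_log) auto
    then have "real d \<le> s" using *(3) by (meson of_nat_mono order_trans)
    then show ?thesis using *(1) le_nat_floor by blast
  qed
  then obtain p d C where C: "\<And>i. i < r \<Longrightarrow> deg_coords Sg (B i) (p i) (d i) (C i)"
    and d: "\<And>i. i < r \<Longrightarrow> d i \<le> nat \<lfloor>s\<rfloor>" by metis
  have sn: "supernilpotent (nat \<lfloor>s\<rfloor>) Sg A"
    by (rule deg_coords_supernilpotent[OF alg \<pi> C d])
  obtain f :: "real poly" where f: "degree f \<le> nat \<lfloor>s\<rfloor>"
    "\<And>n. n \<ge> 1 \<Longrightarrow> real (free_spectrum Sg A n) = 2 powr poly f (real n)"
    using free_spectrum_polynomial[OF assms(2) S sn] by blast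
  have "s \<ge> 0" by (simp add: s)
  then have "real (degree f) \<le> s" using f(1) of_nat_floor[of s] by (meson of_nat_mono order_trans)
  then show ?thesis using sn f(2) by blast
qed

end
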